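(* Let $E$ be a category. The category $\mathrm{Fib}(E)$ of categories fibred over $E$ and cartesian functors is a proper generalized model category with the $E$-equivalences as weak equivalences, the maps that are injective on objects as cofibrations, and the isofibrations as fibrations.
   Context: Sizes are handled with Grothendieck universes, left implicit; the axiom of choice is used. $\mathrm{Fib}(E)$: objects are Grothendieck fibrations $F\to E$ (fibred categories over $E$); arrows are cartesian functors, i.e. functors over $E$ sending cartesian arrows to cartesian arrows. A functor $p\colon A\to B$ is an isofibration if for every object $a$ of $A$ and every isomorphism $\beta\colon p(a)\to b$ of $B$ there is an isomorphism $\alpha\colon a\to a'$ of $A$ with $p(\alpha)=\beta$. A map $u\colon F\to G$ of $\mathrm{Fib}(E)$ is an $E$-equivalence (resp. an isofibration, injective on objects) if its underlying functor is an equivalence of categories (resp. an isofibration, injective on objects). A generalized model category is a category $\mathcal{M}$ with three classes of maps $W$ (weak equivalences), $C$ (cofibrations), $F$ (fibrations) such that: (A1) $\mathcal{M}$ has initial and terminal objects; (A2) the pushout of a cofibration along any map exists and the pullback of a fibration along any map exists; (A3) $W$ has the two out of three property; (A4) $(C,F\cap W)$ and $(C\cap W,F)$ are weak factorization systems. It is left proper if every pushout of a weak equivalence along a cofibration is a weak equivalence, right proper if every pullback of a weak equivalence along a fibration is a weak equivalence, and proper if it is both. *)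

theory Defs
  imports "HOL-Library.FuncSet"
begin

section \<open>Categories and functors\<close>

text \<open>
  Categories have explicit carriers of objects and arrows.  The operations are total HOL functions
  whose values outside the carriers carry no meaning.  Composition is written in the order of
  application: \<open>g \<cdot>\<^bsub>C\<^esub> f\<close> is \<open>f\<close> followed by \<open>g\<close>.
\<close>

record ('o, 'a) cat =
  Obj :: "'o set"
  Arr :: "'a set"
  Dom :: "'a \<Rightarrow> 'o"
  Cod :: "'a \<Rightarrow> 'o"
  Ident :: "'o \<Rightarrow> 'a"
  Comp :: "'a \<Rightarrow> 'a \<Rightarrow> 'a"  (infixl \<open>\<cdot>\<index>\<close> 70)

definition hom :: "('o, 'a) cat \<Rightarrow> 'o \<Rightarrow> 'o \<Rightarrow> 'a set" where
  "hom C x y = {f \<in> Arr C. Dom C f = x \<and> Cod C f = y}"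

locale category =
  fixes C :: "('o, 'a) cat" (structure)
  assumes Dom_closed: "f \<in> Arr C \<Longrightarrow> Dom C f \<in> Obj C"
    and Cod_closed: "f \<in> Arr C \<Longrightarrow> Cod C f \<in> Obj C"
    and Ident_hom: "x \<in> Obj C \<Longrightarrow> Ident C x \<in> hom C x x"
    and Comp_hom: "f \<in> hom C x y \<Longrightarrow> g \<in> hom C y z \<Longrightarrow> g \<cdot> f \<in> hom C x z"
    and Ident_Comp: "f \<in> hom C x y \<Longrightarrow> Ident C y \<cdot> f = f"
    and Comp_Ident: "f \<in> hom C x y \<Longrightarrow> f \<cdot> Ident C x = f"
    and Comp_assoc: "f \<in> hom C w x \<Longrightarrow> g \<in> hom C x y \<Longrightarrow> h \<in> hom C y z \<Longrightarrow>
      (h \<cdot> g) \<cdot> f = h \<cdot> (g \<cdot> f)"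

text \<open>
  A category is normalized if its operations are \<open>undefined\<close> outside their domains.  Two normalized
  categories are equal as records exactly when they are the same category.
\<close>

definition normalized_category :: "('o, 'a) cat \<Rightarrow> bool" where
  "normalized_category C \<longleftrightarrow>
     category C \<and>
     Dom C \<in> extensional (Arr C) \<and> Cod C \<in> extensional (Arr C) \<and>
     Ident C \<in> extensional (Obj C) \<and>
     (\<forall>g f. \<not> (f \<in> Arr C \<and> g \<in> Arr C \<and> Cod C f = Dom C g) \<longrightarrow> g \<cdot>\<^bsub>C\<^esub> f = undefined)"

definition iso :: "('o, 'a) cat \<Rightarrow> 'a \<Rightarrow> bool" where
  "iso C f \<longleftrightarrow> f \<in> Arr C \<and>
     (\<exists>g \<in> hom C (Cod C f) (Dom C f).
        g \<cdot>\<^bsub>C\<^esub> f = Ident C (Dom C f) \<and> f \<cdot>\<^bsub>C\<^esub> g = Ident C (Cod C f))"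

record ('o, 'a, 'p, 'b) fctr =
  omap :: "'o \<Rightarrow> 'p"
  amap :: "'a \<Rightarrow> 'b"

locale cat_functor = A: category A + B: category B
  for A :: "('o, 'a) cat" and B :: "('p, 'b) cat" +
  fixes F :: "('o, 'a, 'p, 'b) fctr"
  assumes omap_closed: "x \<in> Obj A \<Longrightarrow> omap F x \<in> Obj B"
    and amap_hom: "f \<in> hom A x y \<Longrightarrow> amap F f \<in> hom B (omap F x) (omap F y)"
    and amap_Ident: "x \<in> Obj A \<Longrightarrow> amap F (Ident A x) = Ident B (omap F x)"
    and amap_Comp: "f \<in> hom A x y \<Longrightarrow> g \<in> hom A y z \<Longrightarrow>
      amap F (g \<cdot>\<^bsub>A\<^esub> f) = amap F g \<cdot>\<^bsub>B\<^esub> amap F f"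

definition normalized_functor ::
  "('o, 'a) cat \<Rightarrow> ('p, 'b) cat \<Rightarrow> ('o, 'a, 'p, 'b) fctr \<Rightarrow> bool" where
  "normalized_functor A B F \<longleftrightarrow>
     cat_functor A B F \<and> omap F \<in> extensional (Obj A) \<and> amap F \<in> extensional (Arr A)"

definition id_fctr :: "('o, 'a) cat \<Rightarrow> ('o, 'a, 'o, 'a) fctr" where
  "id_fctr A = \<lparr>omap = (\<lambda>x\<in>Obj A. x), amap = (\<lambda>f\<in>Arr A. f)\<rparr>"

definition comp_fctr :: "('o, 'a) cat \<Rightarrow> ('p, 'b, 'q, 'c) fctr \<Rightarrow> ('o, 'a, 'p, 'b) fctr
    \<Rightarrow> ('o, 'a, 'q, 'c) fctr" where
  "comp_fctr A G F =
     \<lparr>omap = (\<lambda>x\<in>Obj A. omap G (omap F x)), amap = (\<lambda>f\<in>Arr A. amap G (amap F f))\<rparr>"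

definition natural_iso :: "('o, 'a) cat \<Rightarrow> ('p, 'b) cat \<Rightarrow> ('o, 'a, 'p, 'b) fctr
    \<Rightarrow> ('o, 'a, 'p, 'b) fctr \<Rightarrow> ('o \<Rightarrow> 'b) \<Rightarrow> bool" where
  "natural_iso A B F G \<eta> \<longleftrightarrow>
     (\<forall>x \<in> Obj A. \<eta> x \<in> hom B (omap F x) (omap G x) \<and> iso B (\<eta> x)) \<and>
     (\<forall>f \<in> Arr A. amap G f \<cdot>\<^bsub>B\<^esub> \<eta> (Dom A f) = \<eta> (Cod A f) \<cdot>\<^bsub>B\<^esub> amap F f)"

definition cat_equivalence ::
  "('o, 'a) cat \<Rightarrow> ('p, 'b) cat \<Rightarrow> ('o, 'a, 'p, 'b) fctr \<Rightarrow> bool" where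
  "cat_equivalence A B F \<longleftrightarrow>
     cat_functor A B F \<and>
     (\<exists>G \<eta> \<epsilon>. cat_functor B A G \<and>
        natural_iso A A (id_fctr A) (comp_fctr A G F) \<eta> \<and>
        natural_iso B B (comp_fctr B F G) (id_fctr B) \<epsilon>)"

definition isofibration ::
  "('o, 'a) cat \<Rightarrow> ('p, 'b) cat \<Rightarrow> ('o, 'a, 'p, 'b) fctr \<Rightarrow> bool" where
  "isofibration A B F \<longleftrightarrow>
     cat_functor A B F \<and>
     (\<forall>a \<in> Obj A. \<forall>\<beta>. iso B \<beta> \<and> Dom B \<beta> = omap F a \<longrightarrow>
        (\<exists>\<alpha>. iso A \<alpha> \<and> Dom A \<alpha> = a \<and> amap F \<alpha> = \<beta>))"

section \<open>Generalized model categories\<close>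

definition has_initial :: "('o, 'a) cat \<Rightarrow> bool" where
  "has_initial M \<longleftrightarrow> (\<exists>x \<in> Obj M. \<forall>y \<in> Obj M. \<exists>!f. f \<in> hom M x y)"

definition has_terminal :: "('o, 'a) cat \<Rightarrow> bool" where
  "has_terminal M \<longleftrightarrow> (\<exists>x \<in> Obj M. \<forall>y \<in> Obj M. \<exists>!f. f \<in> hom M y x)"

text \<open>
  \<open>pushout_square M f g h k\<close> says that \<open>h \<cdot> f = k \<cdot> g\<close> is a pushout square, where
  \<open>f : A \<rightarrow> B\<close>, \<open>g : A \<rightarrow> X\<close>, \<open>h : B \<rightarrow> P\<close> and \<open>k : X \<rightarrow> P\<close>; thus
  \<open>k\<close> is a pushout of \<open>f\<close> along \<open>g\<close>.
\<close>

definition pushout_square :: "('o, 'a) cat \<Rightarrow> 'a \<Rightarrow> 'a \<Rightarrow> 'a \<Rightarrow> 'a \<Rightarrow> bool" where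
  "pushout_square M f g h k \<longleftrightarrow>
     f \<in> Arr M \<and> g \<in> Arr M \<and> h \<in> Arr M \<and> k \<in> Arr M \<and>
     Dom M f = Dom M g \<and> Dom M h = Cod M f \<and> Dom M k = Cod M g \<and> Cod M h = Cod M k \<and>
     h \<cdot>\<^bsub>M\<^esub> f = k \<cdot>\<^bsub>M\<^esub> g \<and>
     (\<forall>z \<in> Obj M. \<forall>s \<in> hom M (Cod M f) z. \<forall>t \<in> hom M (Cod M g) z.
        s \<cdot>\<^bsub>M\<^esub> f = t \<cdot>\<^bsub>M\<^esub> g \<longrightarrow>
        (\<exists>!r. r \<in> hom M (Cod M h) z \<and> r \<cdot>\<^bsub>M\<^esub> h = s \<and> r \<cdot>\<^bsub>M\<^esub> k = t))"

text \<open>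
  \<open>pullback_square M f g h k\<close> is the dual notion, in which \<open>k\<close> is a pullback of \<open>f\<close> along \<open>g\<close>.
\<close>

definition pullback_square :: "('o, 'a) cat \<Rightarrow> 'a \<Rightarrow> 'a \<Rightarrow> 'a \<Rightarrow> 'a \<Rightarrow> bool" where
  "pullback_square M f g h k \<longleftrightarrow>
     f \<in> Arr M \<and> g \<in> Arr M \<and> h \<in> Arr M \<and> k \<in> Arr M \<and>
     Cod M f = Cod M g \<and> Cod M h = Dom M f \<and> Cod M k = Dom M g \<and> Dom M h = Dom M k \<and>
     f \<cdot>\<^bsub>M\<^esub> h = g \<cdot>\<^bsub>M\<^esub> k \<and>
     (\<forall>z \<in> Obj M. \<forall>s \<in> hom M z (Dom M f). \<forall>t \<in> hom M z (Dom M g).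
        f \<cdot>\<^bsub>M\<^esub> s = g \<cdot>\<^bsub>M\<^esub> t \<longrightarrow>
        (\<exists>!r. r \<in> hom M z (Dom M h) \<and> h \<cdot>\<^bsub>M\<^esub> r = s \<and> k \<cdot>\<^bsub>M\<^esub> r = t))"

definition two_out_of_three :: "('o, 'a) cat \<Rightarrow> 'a set \<Rightarrow> bool" where
  "two_out_of_three M W \<longleftrightarrow>
     (\<forall>f \<in> Arr M. \<forall>g \<in> Arr M. Cod M f = Dom M g \<longrightarrow>
        (f \<in> W \<and> g \<in> W \<longrightarrow> g \<cdot>\<^bsub>M\<^esub> f \<in> W) \<and>
        (f \<in> W \<and> g \<cdot>\<^bsub>M\<^esub> f \<in> W \<longrightarrow> g \<in> W) \<and>
        (g \<in> W \<and> g \<cdot>\<^bsub>M\<^esub> f \<in> W \<longrightarrow> f \<in> W))"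

definition has_lift :: "('o, 'a) cat \<Rightarrow> 'a \<Rightarrow> 'a \<Rightarrow> bool" where
  "has_lift M i p \<longleftrightarrow>
     (\<forall>s \<in> hom M (Dom M i) (Dom M p). \<forall>t \<in> hom M (Cod M i) (Cod M p).
        p \<cdot>\<^bsub>M\<^esub> s = t \<cdot>\<^bsub>M\<^esub> i \<longrightarrow>
        (\<exists>d \<in> hom M (Cod M i) (Dom M p). d \<cdot>\<^bsub>M\<^esub> i = s \<and> p \<cdot>\<^bsub>M\<^esub> d = t))"

definition weak_factorization_system :: "('o, 'a) cat \<Rightarrow> 'a set \<Rightarrow> 'a set \<Rightarrow> bool" where
  "weak_factorization_system M L R \<longleftrightarrow>
     L = {i \<in> Arr M. \<forall>p \<in> R. has_lift M i p} \<and>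
     R = {p \<in> Arr M. \<forall>i \<in> L. has_lift M i p} \<and>
     (\<forall>f \<in> Arr M. \<exists>i \<in> L. \<exists>p \<in> R. Cod M i = Dom M p \<and> f = p \<cdot>\<^bsub>M\<^esub> i)"

locale generalized_model_category = category M
  for M :: "('o, 'a) cat" +
  fixes W :: "'a set"
    and C :: "'a set"
    and F :: "'a set"
  assumes W_sub: "W \<subseteq> Arr M"
    and C_sub: "C \<subseteq> Arr M"
    and F_sub: "F \<subseteq> Arr M"
    and initial: "has_initial M"
    and terminal: "has_terminal M"
    and pushouts: "\<And>i g. i \<in> C \<Longrightarrow> g \<in> Arr M \<Longrightarrow> Dom M g = Dom M i \<Longrightarrow>
      \<exists>h k. pushout_square M i g h k"
    and pullbacks: "\<And>p g. p \<in> F \<Longrightarrow> g \<in> Arr M \<Longrightarrow> Cod M g = Cod M p \<Longrightarrow>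
      \<exists>h k. pullback_square M p g h k"
    and two_of_three: "two_out_of_three M W"
    and wfs_cof: "weak_factorization_system M C (F \<inter> W)"
    and wfs_fib: "weak_factorization_system M (C \<inter> W) F"

definition left_proper :: "('o, 'a) cat \<Rightarrow> 'a set \<Rightarrow> 'a set \<Rightarrow> bool" where
  "left_proper M W C \<longleftrightarrow>
     (\<forall>w i h k. w \<in> W \<and> i \<in> C \<and> pushout_square M w i h k \<longrightarrow> k \<in> W)"

definition right_proper :: "('o, 'a) cat \<Rightarrow> 'a set \<Rightarrow> 'a set \<Rightarrow> bool" where
  "right_proper M W F \<longleftrightarrow>
     (\<forall>w p h k. w \<in> W \<and> p \<in> F \<and> pullback_square M w p h k \<longrightarrow> k \<in> W)"

locale proper_generalized_model_category = generalized_model_category +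
  assumes left_proper: "left_proper M W C"
    and right_proper: "right_proper M W F"

section \<open>The category of fibred categories\<close>

definition cartesian :: "('o, 'a) cat \<Rightarrow> ('p, 'b) cat \<Rightarrow> ('o, 'a, 'p, 'b) fctr \<Rightarrow> 'a \<Rightarrow> bool" where
  "cartesian F E p \<phi> \<longleftrightarrow>
     \<phi> \<in> Arr F \<and>
     (\<forall>z \<in> Obj F. \<forall>\<psi> \<in> hom F z (Cod F \<phi>). \<forall>g \<in> hom E (omap p z) (omap p (Dom F \<phi>)).
        amap p \<phi> \<cdot>\<^bsub>E\<^esub> g = amap p \<psi> \<longrightarrow>
        (\<exists>!\<chi>. \<chi> \<in> hom F z (Dom F \<phi>) \<and> amap p \<chi> = g \<and> \<phi> \<cdot>\<^bsub>F\<^esub> \<chi> = \<psi>))"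

definition grothendieck_fibration ::
  "('o, 'a) cat \<Rightarrow> ('p, 'b) cat \<Rightarrow> ('o, 'a, 'p, 'b) fctr \<Rightarrow> bool" where
  "grothendieck_fibration F E p \<longleftrightarrow>
     cat_functor F E p \<and>
     (\<forall>y \<in> Obj F. \<forall>f \<in> Arr E. Cod E f = omap p y \<longrightarrow>
        (\<exists>\<phi>. cartesian F E p \<phi> \<and> Cod F \<phi> = y \<and> amap p \<phi> = f))"

text \<open>
  The type \<open>'u\<close> plays the role of the universe: the objects and the arrows of the base and of the
  fibred categories are elements of \<open>'u\<close>.
\<close>

record 'u fibred_cat =
  total :: "('u, 'u) cat"
  proj :: "('u, 'u, 'u, 'u) fctr"

record 'u fib_map =
  src :: "'u fibred_cat"
  tgt :: "'u fibred_cat"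
  fun_of :: "('u, 'u, 'u, 'u) fctr"

definition fibred_category :: "('u, 'u) cat \<Rightarrow> 'u fibred_cat \<Rightarrow> bool" where
  "fibred_category E P \<longleftrightarrow>
     normalized_category (total P) \<and> normalized_functor (total P) E (proj P) \<and>
     grothendieck_fibration (total P) E (proj P)"

definition cartesian_functor :: "('u, 'u) cat \<Rightarrow> 'u fib_map \<Rightarrow> bool" where
  "cartesian_functor E u \<longleftrightarrow>
     fibred_category E (src u) \<and> fibred_category E (tgt u) \<and>
     normalized_functor (total (src u)) (total (tgt u)) (fun_of u) \<and>
     comp_fctr (total (src u)) (proj (tgt u)) (fun_of u) = proj (src u) \<and>
     (\<forall>\<phi>. cartesian (total (src u)) E (proj (src u)) \<phi> \<longrightarrow>
        cartesian (total (tgt u)) E (proj (tgt u)) (amap (fun_of u) \<phi>))"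

definition Fib :: "('u, 'u) cat \<Rightarrow> ('u fibred_cat, 'u fib_map) cat" where
  "Fib E =
     \<lparr>Obj = {P. fibred_category E P},
      Arr = {u. cartesian_functor E u},
      Dom = src,
      Cod = tgt,
      Ident = (\<lambda>P. \<lparr>src = P, tgt = P, fun_of = id_fctr (total P)\<rparr>),
      Comp = (\<lambda>v u. \<lparr>src = src u, tgt = tgt v,
                     fun_of = comp_fctr (total (src u)) (fun_of v) (fun_of u)\<rparr>)\<rparr>"

definition E_equivalences :: "('u, 'u) cat \<Rightarrow> 'u fib_map set" where
  "E_equivalences E =
     {u \<in> Arr (Fib E). cat_equivalence (total (src u)) (total (tgt u)) (fun_of u)}"

definition E_injections :: "('u, 'u) cat \<Rightarrow> 'u fib_map set" where
  "E_injections E = {u \<in> Arr (Fib E). inj_on (omap (fun_of u)) (Obj (total (src u)))}"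

definition E_isofibrations :: "('u, 'u) cat \<Rightarrow> 'u fib_map set" where
  "E_isofibrations E =
     {u \<in> Arr (Fib E). isofibration (total (src u)) (total (tgt u)) (fun_of u)}"

end

theory Submission
  imports Defs
begin

text \<open>
  An equivalence that is injective on objects is an equivalence onto its image with inverse
  isomorphisms that are identities on the image; transporting along these isomorphisms lifts it against
  isofibrations.  Isofibrations that are equivalences are fully faithful and surjective on objects, so
  they have lifts against injections.  Both factorizations of \<open>f : A \<rightarrow> B\<close> pull back the arrows of a
  fibred category along a surjection onto its objects: \<open>A \<squnion> B \<rightarrow> B\<close> on objects in the first case,
  the objects of \<open>A\<close> equipped with a vertical isomorphism \<open>f a \<rightarrow> b\<close> in the second.

  Pullbacks along isofibrations are strict, because the comparison of two cartesian lifts can be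
  absorbed by the isofibration.  For pushouts along an injection \<open>i\<close>, factor the other leg as an
  injection followed by a trivial fibration.  Two injections are amalgamated by words.  The pushout along
  a trivial fibration \<open>q\<close> with section \<open>\<sigma>\<close> splits an idempotent of the target of \<open>i\<close> that is
  isomorphic to the identity; this also shows that such a pushout of \<open>q\<close> is an equivalence, which
  gives left properness.
\<close>

section \<open>Categories, isomorphisms and equivalences\<close>

text \<open>Every construction has to live on the one type \<open>'u\<close>, so pairs, tagged sums
  and finite words are coded by elements of \<open>'u\<close>; this is where the infinite universe
  enters. Equalities of maps are strict, whereas a cartesian functor respects chosen cartesian lifts
  only up to vertical isomorphism, and this gap shapes the proof. For pushouts the obstacle is to
  show that the category of words is fibred: a word can be pulled back along the base consistently
  only when the cleavages of both sides agree on \<open>A\<close>. If a leg \<open>g\<close>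
  identifies two objects of \<open>A\<close>, the images of their chosen lifts may differ, and then
  no cleavage of the target extends the one of \<open>A\<close>. This is why the non-injective part
  of \<open>g\<close> is split off as a trivial fibration. The section of a trivial fibration is
  itself a lift: the map from the empty fibred category to any object is injective on objects.
  Properness speaks of every pushout or pullback square, not only of the constructed ones, so its
  proof argues from universal properties and retracts.\<close>

context category
begin

lemma Dom_Obj [simp]: "f \<in> Arr C \<Longrightarrow> Dom C f \<in> Obj C"
  by (rule Dom_closed)

lemma Cod_Obj [simp]: "f \<in> Arr C \<Longrightarrow> Cod C f \<in> Obj C"
  by (rule Cod_closed)

lemma Ident_Arr [simp]:
  assumes "x \<in> Obj C"
  shows "Ident C x \<in> Arr C" "Dom C (Ident C x) = x" "Cod C (Ident C x) = x"
  using Ident_hom[OF assms] by (auto simp: hom_def)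

lemma Comp_Arr [simp]:
  assumes "f \<in> Arr C" "g \<in> Arr C" "Cod C f = Dom C g"
  shows "g \<cdot> f \<in> Arr C" "Dom C (g \<cdot> f) = Dom C f" "Cod C (g \<cdot> f) = Cod C g"
  using Comp_hom[of f "Dom C f" "Cod C f" g "Cod C g"] assms by (auto simp: hom_def)

lemma Ident_left [simp]: "f \<in> Arr C \<Longrightarrow> Cod C f = x \<Longrightarrow> Ident C x \<cdot> f = f"
  using Ident_Comp[of f "Dom C f" "Cod C f"] by (auto simp: hom_def)

lemma Ident_right [simp]: "f \<in> Arr C \<Longrightarrow> Dom C f = x \<Longrightarrow> f \<cdot> Ident C x = f"
  using Comp_Ident[of f "Dom C f" "Cod C f"] by (auto simp: hom_def)

text \<open>Composites are normalized to the right; arguments that need another bracketing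
  instantiate this rule explicitly.\<close>

lemma Assoc [simp]:
  "f \<in> Arr C \<Longrightarrow> g \<in> Arr C \<Longrightarrow> h \<in> Arr C \<Longrightarrow> Cod C f = Dom C g \<Longrightarrow> Cod C g = Dom C h \<Longrightarrow>
    (h \<cdot> g) \<cdot> f = h \<cdot> (g \<cdot> f)"
  using Comp_assoc[of f "Dom C f" "Cod C f" g "Cod C g" h "Cod C h"] by (auto simp: hom_def)

end

lemma categoryI:
  assumes "\<And>f. f \<in> Arr C \<Longrightarrow> Dom C f \<in> Obj C" "\<And>f. f \<in> Arr C \<Longrightarrow> Cod C f \<in> Obj C"
    and "\<And>x. x \<in> Obj C \<Longrightarrow> Ident C x \<in> Arr C \<and> Dom C (Ident C x) = x \<and> Cod C (Ident C x) = x"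
    and "\<And>f g. f \<in> Arr C \<Longrightarrow> g \<in> Arr C \<Longrightarrow> Cod C f = Dom C g \<Longrightarrow>
      g \<cdot>\<^bsub>C\<^esub> f \<in> Arr C \<and> Dom C (g \<cdot>\<^bsub>C\<^esub> f) = Dom C f \<and> Cod C (g \<cdot>\<^bsub>C\<^esub> f) = Cod C g"
    and "\<And>f. f \<in> Arr C \<Longrightarrow> Ident C (Cod C f) \<cdot>\<^bsub>C\<^esub> f = f"
    and "\<And>f. f \<in> Arr C \<Longrightarrow> f \<cdot>\<^bsub>C\<^esub> Ident C (Dom C f) = f"
    and "\<And>f g h. f \<in> Arr C \<Longrightarrow> g \<in> Arr C \<Longrightarrow> h \<in> Arr C \<Longrightarrow> Cod C f = Dom C g \<Longrightarrow>
      Cod C g = Dom C h \<Longrightarrow> (h \<cdot>\<^bsub>C\<^esub> g) \<cdot>\<^bsub>C\<^esub> f = h \<cdot>\<^bsub>C\<^esub> (g \<cdot>\<^bsub>C\<^esub> f)"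
  shows "category C"
proof
  fix f x y assume "f \<in> hom C x y"
  then show "Ident C y \<cdot>\<^bsub>C\<^esub> f = f" "f \<cdot>\<^bsub>C\<^esub> Ident C x = f"
    using assms(5)[of f] assms(6)[of f] by (auto simp: hom_def)
next
  fix f g x y z assume "f \<in> hom C x y" "g \<in> hom C y z"
  then show "g \<cdot>\<^bsub>C\<^esub> f \<in> hom C x z" using assms(4)[of f g] by (auto simp: hom_def)
next
  fix f g h w x y z assume "f \<in> hom C w x" "g \<in> hom C x y" "h \<in> hom C y z"
  then show "(h \<cdot>\<^bsub>C\<^esub> g) \<cdot>\<^bsub>C\<^esub> f = h \<cdot>\<^bsub>C\<^esub> (g \<cdot>\<^bsub>C\<^esub> f)"
    using assms(7)[of f g h] by (auto simp: hom_def)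
qed (use assms(1-3) in \<open>auto simp: hom_def\<close>)

text \<open>The choice has a meaning only under \<open>iso C f\<close>, and there
  \<open>inv_arr_unique\<close> determines it.\<close>

definition inv_arr :: "('o, 'a) cat \<Rightarrow> 'a \<Rightarrow> 'a" where
  "inv_arr C f = (SOME g. g \<in> hom C (Cod C f) (Dom C f) \<and>
     g \<cdot>\<^bsub>C\<^esub> f = Ident C (Dom C f) \<and> f \<cdot>\<^bsub>C\<^esub> g = Ident C (Cod C f))"

lemma iso_Arr [simp]: "iso C f \<Longrightarrow> f \<in> Arr C"
  by (simp add: iso_def)

lemma isoI:
  assumes "f \<in> Arr C" "g \<in> Arr C" "Dom C g = Cod C f" "Cod C g = Dom C f"
    "g \<cdot>\<^bsub>C\<^esub> f = Ident C (Dom C f)" "f \<cdot>\<^bsub>C\<^esub> g = Ident C (Cod C f)"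
  shows "iso C f"
  unfolding iso_def using assms by (intro conjI bexI[of _ g]) (simp_all add: hom_def)

context category
begin

lemma inv_arr [simp]:
  assumes "iso C f"
  shows "inv_arr C f \<in> Arr C" "Dom C (inv_arr C f) = Cod C f" "Cod C (inv_arr C f) = Dom C f"
    "inv_arr C f \<cdot> f = Ident C (Dom C f)" "f \<cdot> inv_arr C f = Ident C (Cod C f)"
proof -
  have "inv_arr C f \<in> hom C (Cod C f) (Dom C f) \<and>
      inv_arr C f \<cdot> f = Ident C (Dom C f) \<and> f \<cdot> inv_arr C f = Ident C (Cod C f)"
    unfolding inv_arr_def by (rule someI_ex) (use assms in \<open>auto simp: iso_def\<close>)
  then show "inv_arr C f \<in> Arr C" "Dom C (inv_arr C f) = Cod C f" "Cod C (inv_arr C f) = Dom C f"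
    "inv_arr C f \<cdot> f = Ident C (Dom C f)" "f \<cdot> inv_arr C f = Ident C (Cod C f)"
    by (auto simp: hom_def)
qed

text \<open>The inverse laws in the form needed after rebracketing to the right, where the
  cancelling pair stands in front of a further factor \<open>g\<close>.\<close>

lemma inv_arr_cancel [simp]:
  assumes "iso C f" "g \<in> Arr C"
  shows "Cod C g = Dom C f \<Longrightarrow> inv_arr C f \<cdot> (f \<cdot> g) = g"
    "Cod C g = Cod C f \<Longrightarrow> f \<cdot> (inv_arr C f \<cdot> g) = g"
proof -
  show "inv_arr C f \<cdot> (f \<cdot> g) = g" if "Cod C g = Dom C f"
    using Assoc[of g f "inv_arr C f"] that assms by simp
  show "f \<cdot> (inv_arr C f \<cdot> g) = g" if "Cod C g = Cod C f"
    using Assoc[of g "inv_arr C f" f] that assms by simp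
qed

lemma iso_inv_arr [simp]: "iso C f \<Longrightarrow> iso C (inv_arr C f)"
  by (rule isoI[where g = f]) auto

lemma iso_Ident [simp]: "x \<in> Obj C \<Longrightarrow> iso C (Ident C x)"
  by (rule isoI[where g = "Ident C x"]) auto

lemma iso_Comp [simp]: "iso C f \<Longrightarrow> iso C g \<Longrightarrow> Cod C f = Dom C g \<Longrightarrow> iso C (g \<cdot> f)"
  by (rule isoI[where g = "inv_arr C f \<cdot> inv_arr C g"]) auto

text \<open>For an isomorphism a left inverse is enough: insert \<open>g \<cdot> f\<close> in front
  of the inverse.\<close>

lemma inv_arr_unique:
  assumes "iso C f" "g \<in> Arr C" "Dom C g = Cod C f" "g \<cdot> f = Ident C (Dom C f)"
  shows "inv_arr C f = g"
proof -
  have "inv_arr C f = (g \<cdot> f) \<cdot> inv_arr C f" using assms by simp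
  also have "\<dots> = g" using assms Assoc[of "inv_arr C f" f g] by (auto simp del: Assoc)
  finally show ?thesis .
qed

lemma inv_arr_Ident [simp]: "x \<in> Obj C \<Longrightarrow> inv_arr C (Ident C x) = Ident C x"
  by (rule inv_arr_unique) auto

lemma inv_arr_inv_arr [simp]: "iso C f \<Longrightarrow> inv_arr C (inv_arr C f) = f"
  by (rule inv_arr_unique) auto

lemma iso_cancel_left:
  assumes "iso C f" "f \<cdot> g = f \<cdot> h" "g \<in> Arr C" "h \<in> Arr C" "Cod C g = Dom C f" "Cod C h = Dom C f"
  shows "g = h"
  by (metis assms inv_arr_cancel(1))

lemma iso_cancel_right:
  assumes "iso C f" "g \<cdot> f = h \<cdot> f" "g \<in> Arr C" "h \<in> Arr C" "Dom C g = Cod C f" "Dom C h = Cod C f"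
  shows "g = h"
proof -
  have "k = (k \<cdot> f) \<cdot> inv_arr C f" if "k \<in> Arr C" "Dom C k = Cod C f" for k
    using that assms(1) by simp
  then show ?thesis using assms by metis
qed

end

context cat_functor
begin

lemma omap_Obj [simp]: "x \<in> Obj A \<Longrightarrow> omap F x \<in> Obj B"
  by (rule omap_closed)

lemma amap_Arr [simp]:
  assumes "f \<in> Arr A"
  shows "amap F f \<in> Arr B" "Dom B (amap F f) = omap F (Dom A f)"
    "Cod B (amap F f) = omap F (Cod A f)"
  using amap_hom[of f "Dom A f" "Cod A f"] assms by (auto simp: hom_def)

lemma amap_Id [simp]: "x \<in> Obj A \<Longrightarrow> amap F (Ident A x) = Ident B (omap F x)"
  by (rule amap_Ident)

lemma amap_comp [simp]:
  "f \<in> Arr A \<Longrightarrow> g \<in> Arr A \<Longrightarrow> Cod A f = Dom A g \<Longrightarrow>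
    amap F (g \<cdot>\<^bsub>A\<^esub> f) = amap F g \<cdot>\<^bsub>B\<^esub> amap F f"
  using amap_Comp[of f "Dom A f" "Cod A f" g "Cod A g"] by (auto simp: hom_def)

lemma amap_iso [simp]: "iso A f \<Longrightarrow> iso B (amap F f)"
  by (rule isoI[where g = "amap F (inv_arr A f)"]) (auto simp flip: amap_comp)

lemma amap_inv_arr [simp]: "iso A f \<Longrightarrow> amap F (inv_arr A f) = inv_arr B (amap F f)"
  by (rule B.inv_arr_unique[symmetric]) (auto simp flip: amap_comp)

end

lemma cat_functorI:
  assumes "category A" "category B"
    and "\<And>x. x \<in> Obj A \<Longrightarrow> omap F x \<in> Obj B"
    and "\<And>f. f \<in> Arr A \<Longrightarrow> amap F f \<in> Arr B \<and> Dom B (amap F f) = omap F (Dom A f) \<and>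
      Cod B (amap F f) = omap F (Cod A f)"
    and "\<And>x. x \<in> Obj A \<Longrightarrow> amap F (Ident A x) = Ident B (omap F x)"
    and "\<And>f g. f \<in> Arr A \<Longrightarrow> g \<in> Arr A \<Longrightarrow> Cod A f = Dom A g \<Longrightarrow>
      amap F (g \<cdot>\<^bsub>A\<^esub> f) = amap F g \<cdot>\<^bsub>B\<^esub> amap F f"
  shows "cat_functor A B F"
proof -
  interpret A: category A by fact
  interpret B: category B by fact
  show ?thesis
  proof
    fix f g x y z assume "f \<in> hom A x y" "g \<in> hom A y z"
    then show "amap F (g \<cdot>\<^bsub>A\<^esub> f) = amap F g \<cdot>\<^bsub>B\<^esub> amap F f"
      using assms(6)[of f g] by (auto simp: hom_def)
  next
    fix f x y assume "f \<in> hom A x y"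
    then show "amap F f \<in> hom B (omap F x) (omap F y)"
      using assms(4)[of f] by (auto simp: hom_def)
  qed (use assms(3,5) in auto)
qed

section \<open>Fully faithful functors and the criterion for equivalences\<close>

definition fully_faithful ::
  "('o, 'a) cat \<Rightarrow> ('p, 'b) cat \<Rightarrow> ('o, 'a, 'p, 'b) fctr \<Rightarrow> bool" where
  "fully_faithful A B F \<longleftrightarrow>
     (\<forall>x \<in> Obj A. \<forall>y \<in> Obj A. bij_betw (amap F) (hom A x y) (hom B (omap F x) (omap F y)))"

definition ess_surj ::
  "('o, 'a) cat \<Rightarrow> ('p, 'b) cat \<Rightarrow> ('o, 'a, 'p, 'b) fctr \<Rightarrow> bool" where
  "ess_surj A B F \<longleftrightarrow>
     (\<forall>b \<in> Obj B. \<exists>a \<in> Obj A. \<exists>\<beta>. iso B \<beta> \<and> Dom B \<beta> = omap F a \<and> Cod B \<beta> = b)"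

lemma fully_faithful_full:
  assumes "fully_faithful A B F" "g \<in> Arr B" "Dom B g = omap F x" "Cod B g = omap F y"
    "x \<in> Obj A" "y \<in> Obj A"
  obtains f where "f \<in> Arr A" "Dom A f = x" "Cod A f = y" "amap F f = g"
proof -
  have "g \<in> amap F ` hom A x y"
    using assms by (auto simp: fully_faithful_def bij_betw_def hom_def)
  then show thesis using that by (auto simp: hom_def)
qed

lemma fully_faithful_faithful:
  assumes "fully_faithful A B F" "amap F f = amap F g" "f \<in> Arr A" "g \<in> Arr A"
    "Dom A f = Dom A g" "Cod A f = Cod A g" "category A"
  shows "f = g"
proof -
  interpret category A by fact
  have "inj_on (amap F) (hom A (Dom A f) (Cod A f))"
    using assms by (auto simp: fully_faithful_def bij_betw_def)
  then show ?thesis using assms by (auto simp: hom_def inj_on_def)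
qed

lemma fully_faithfulI:
  assumes "cat_functor A B F"
    and "\<And>f g. f \<in> Arr A \<Longrightarrow> g \<in> Arr A \<Longrightarrow> Dom A f = Dom A g \<Longrightarrow> Cod A f = Cod A g \<Longrightarrow>
      amap F f = amap F g \<Longrightarrow> f = g"
    and "\<And>g x y. g \<in> Arr B \<Longrightarrow> x \<in> Obj A \<Longrightarrow> y \<in> Obj A \<Longrightarrow> Dom B g = omap F x \<Longrightarrow>
      Cod B g = omap F y \<Longrightarrow> \<exists>f \<in> Arr A. Dom A f = x \<and> Cod A f = y \<and> amap F f = g"
  shows "fully_faithful A B F"
proof -
  interpret cat_functor A B F by fact
  show ?thesis
    unfolding fully_faithful_def bij_betw_def
    by (auto simp: hom_def inj_on_def intro: assms(2)) (use assms(3) in force)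
qed

text \<open>Fullness provides a preimage of the inverse, and faithfulness turns the two inverse laws
  in \<open>B\<close> into laws in \<open>A\<close>.\<close>

lemma fully_faithful_reflects_iso:
  assumes "cat_functor A B F" "fully_faithful A B F" "f \<in> Arr A" "iso B (amap F f)"
  shows "iso A f"
proof -
  interpret cat_functor A B F by fact
  obtain g where g: "g \<in> Arr A" "Dom A g = Cod A f" "Cod A g = Dom A f"
    "amap F g = inv_arr B (amap F f)"
    by (rule fully_faithful_full[OF assms(2), of "inv_arr B (amap F f)" "Cod A f" "Dom A f"])
      (use assms in auto)
  show ?thesis
    by (rule isoI[where g = g])
      (use assms g in \<open>auto intro!: fully_faithful_faithful[OF assms(2)] simp: A.category_axioms\<close>)
qed

lemma natural_isoD:
  assumes "natural_iso A B F G \<eta>" "category A"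
  shows "x \<in> Obj A \<Longrightarrow> iso B (\<eta> x) \<and> Dom B (\<eta> x) = omap F x \<and> Cod B (\<eta> x) = omap G x"
    and "f \<in> Arr A \<Longrightarrow> amap G f \<cdot>\<^bsub>B\<^esub> \<eta> (Dom A f) = \<eta> (Cod A f) \<cdot>\<^bsub>B\<^esub> amap F f"
  using assms by (auto simp: natural_iso_def hom_def)

text \<open>Naturality writes the composite of \<open>f\<close> with \<open>\<eta>\<close> through
  \<open>G (F f)\<close>, so \<open>F f = F g\<close> forces equal composites, and
  \<open>\<eta>\<close> cancels.\<close>

lemma cat_equivalence_faithful:
  assumes "cat_functor A B F" "cat_functor B A G"
    and \<eta>: "natural_iso A A (id_fctr A) (comp_fctr A G F) \<eta>"
    and "f \<in> Arr A" "g \<in> Arr A" "Dom A f = Dom A g" "Cod A f = Cod A g" "amap F f = amap F g"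
  shows "f = g"
proof -
  interpret F: cat_functor A B F by fact
  interpret G: cat_functor B A G by fact
  note n = natural_isoD[OF \<eta> F.A.category_axioms]
  have "\<eta> (Cod A f) \<cdot>\<^bsub>A\<^esub> f = \<eta> (Cod A f) \<cdot>\<^bsub>A\<^esub> g"
    using n(2)[of f] n(2)[of g] assms by (simp add: id_fctr_def comp_fctr_def)
  then show ?thesis
    using n(1)[of "Cod A f"] assms
    by (intro F.A.iso_cancel_left[of "\<eta> (Cod A f)" f g]) (auto simp: id_fctr_def)
qed

text \<open>This replaces the quasi-inverse by two elementary conditions; every later statement
  about weak equivalences is checked in this form. The converse direction uses choice to build the
  quasi-inverse.\<close>

lemma cat_equivalence_iff:
  "cat_equivalence A B F \<longleftrightarrow> cat_functor A B F \<and> fully_faithful A B F \<and> ess_surj A B F"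
proof
  assume "cat_equivalence A B F"
  then obtain G \<eta> \<epsilon> where F: "cat_functor A B F" and G: "cat_functor B A G"
    and \<eta>: "natural_iso A A (id_fctr A) (comp_fctr A G F) \<eta>"
    and \<epsilon>: "natural_iso B B (comp_fctr B F G) (id_fctr B) \<epsilon>"
    by (auto simp: cat_equivalence_def)
  interpret F: cat_functor A B F by fact
  interpret G: cat_functor B A G by fact
  note n = natural_isoD[OF \<eta> F.A.category_axioms, simplified id_fctr_def comp_fctr_def, simplified]
  note e = natural_isoD[OF \<epsilon> F.B.category_axioms, simplified id_fctr_def comp_fctr_def, simplified]
  \<comment> \<open>The same cancellation as for \<open>F\<close>, now with the natural isomorphism
    \<open>\<epsilon>\<close>.\<close>
  have G_faithful: "f = g" if "f \<in> Arr B" "g \<in> Arr B" "Dom B f = Dom B g" "Cod B f = Cod B g"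
    "amap G f = amap G g" for f g
  proof -
    have "f \<cdot>\<^bsub>B\<^esub> \<epsilon> (Dom B f) = g \<cdot>\<^bsub>B\<^esub> \<epsilon> (Dom B f)"
      using e(2)[of f] e(2)[of g] that by simp
    then show ?thesis
      using e(1)[of "Dom B f"] that by (intro F.B.iso_cancel_right[of "\<epsilon> (Dom B f)" f g]) auto
  qed
  have "fully_faithful A B F"
  proof (rule fully_faithfulI[OF F])
    fix g x y
    assume g: "g \<in> Arr B" "x \<in> Obj A" "y \<in> Obj A" "Dom B g = omap F x" "Cod B g = omap F y"
    note nx = n(1)[of x] n(1)[of y]
    \<comment> \<open>Naturality of \<open>\<eta>\<close> leaves this as the only candidate. It
      gives \<open>G (F f) = G g\<close>, and faithfulness of \<open>G\<close> removes
      \<open>G\<close>.\<close>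
    define f where "f = inv_arr A (\<eta> y) \<cdot>\<^bsub>A\<^esub> (amap G g \<cdot>\<^bsub>A\<^esub> \<eta> x)"
    have f: "f \<in> Arr A" "Dom A f = x" "Cod A f = y" using nx g by (auto simp: f_def)
    have "\<eta> y \<cdot>\<^bsub>A\<^esub> f = amap G g \<cdot>\<^bsub>A\<^esub> \<eta> x" using nx g by (auto simp: f_def)
    then have "amap G (amap F f) \<cdot>\<^bsub>A\<^esub> \<eta> x = amap G g \<cdot>\<^bsub>A\<^esub> \<eta> x"
      using n(2)[of f] f by simp
    then have "amap G (amap F f) = amap G g"
      using nx g f by (intro F.A.iso_cancel_right[of "\<eta> x" "amap G (amap F f)" "amap G g"]) auto
    then have "amap F f = g" using f g by (intro G_faithful) auto
    then show "\<exists>f \<in> Arr A. Dom A f = x \<and> Cod A f = y \<and> amap F f = g" using f by auto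
  qed (use cat_equivalence_faithful[OF F G \<eta>] in auto)
  moreover have "ess_surj A B F"
    unfolding ess_surj_def
  proof
    fix b assume "b \<in> Obj B"
    then show "\<exists>a\<in>Obj A. \<exists>\<beta>. iso B \<beta> \<and> Dom B \<beta> = omap F a \<and> Cod B \<beta> = b"
      using e(1)[of b] by (intro bexI[of _ "omap G b"] exI[of _ "\<epsilon> b"]) auto
  qed
  ultimately show "cat_functor A B F \<and> fully_faithful A B F \<and> ess_surj A B F" using F by simp
next
  assume F: "cat_functor A B F \<and> fully_faithful A B F \<and> ess_surj A B F"
  then interpret cat_functor A B F by simp
  have ff: "fully_faithful A B F" and es: "ess_surj A B F" using F by auto
  obtain ob e where oe: "\<And>b. b \<in> Obj B \<Longrightarrow> ob b \<in> Obj A \<and> iso B (e b) \<and> Dom B (e b) = omap F (ob b) \<and>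
    Cod B (e b) = b"
    using es unfolding ess_surj_def by metis
  \<comment> \<open>The arrow part of the quasi-inverse is the preimage under \<open>F\<close> of
    \<open>g\<close> conjugated by the chosen isomorphisms \<open>e\<close>; functoriality then
    follows from faithfulness.\<close>
  have "\<exists>f. f \<in> Arr A \<and> Dom A f = ob (Dom B g) \<and> Cod A f = ob (Cod B g) \<and>
      amap F f = inv_arr B (e (Cod B g)) \<cdot>\<^bsub>B\<^esub> (g \<cdot>\<^bsub>B\<^esub> e (Dom B g))" if "g \<in> Arr B" for g
    by (rule fully_faithful_full[OF ff,
          of "inv_arr B (e (Cod B g)) \<cdot>\<^bsub>B\<^esub> (g \<cdot>\<^bsub>B\<^esub> e (Dom B g))" "ob (Dom B g)" "ob (Cod B g)"])
      (use that oe in auto)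
  then obtain m where m: "\<And>g. g \<in> Arr B \<Longrightarrow> m g \<in> Arr A \<and> Dom A (m g) = ob (Dom B g) \<and>
      Cod A (m g) = ob (Cod B g) \<and>
      amap F (m g) = inv_arr B (e (Cod B g)) \<cdot>\<^bsub>B\<^esub> (g \<cdot>\<^bsub>B\<^esub> e (Dom B g))"
    by metis
  note faithful = fully_faithful_faithful[OF ff _ _ _ _ _ A.category_axioms]
  define G where "G = \<lparr>omap = ob, amap = m\<rparr>"
  have "cat_functor B A G"
    by (rule cat_functorI) (use m oe in
      \<open>auto simp: G_def A.category_axioms B.category_axioms intro!: faithful\<close>)
  then interpret G: cat_functor B A G .
  have "\<exists>h. h \<in> Arr A \<and> Dom A h = x \<and> Cod A h = ob (omap F x) \<and>
      amap F h = inv_arr B (e (omap F x))" if "x \<in> Obj A" for x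
    by (rule fully_faithful_full[OF ff, of "inv_arr B (e (omap F x))" x "ob (omap F x)"])
      (use that oe in auto)
  then obtain h where h: "\<And>x. x \<in> Obj A \<Longrightarrow> h x \<in> Arr A \<and> Dom A (h x) = x \<and>
      Cod A (h x) = ob (omap F x) \<and> amap F (h x) = inv_arr B (e (omap F x))"
    by metis
  have "iso A (h x)" if "x \<in> Obj A" for x
    by (rule fully_faithful_reflects_iso[OF cat_functor_axioms ff]) (use h oe that in auto)
  then have "natural_iso A A (id_fctr A) (comp_fctr A G F) h"
    using h oe m by (auto simp: natural_iso_def hom_def id_fctr_def comp_fctr_def G_def
        intro!: faithful)
  moreover have "natural_iso B B (comp_fctr B F G) (id_fctr B) e"
    using oe m by (auto simp: natural_iso_def hom_def id_fctr_def comp_fctr_def G_def)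
  ultimately show "cat_equivalence A B F"
    using F \<open>cat_functor B A G\<close> by (auto simp: cat_equivalence_def)
qed

section \<open>Cartesian arrows\<close>

context cat_functor
begin

lemma cartesianI:
  assumes "\<phi> \<in> Arr A"
    and "\<And>\<psi> g. \<psi> \<in> Arr A \<Longrightarrow> Cod A \<psi> = Cod A \<phi> \<Longrightarrow> g \<in> Arr B \<Longrightarrow> Dom B g = omap F (Dom A \<psi>) \<Longrightarrow>
      Cod B g = omap F (Dom A \<phi>) \<Longrightarrow> amap F \<phi> \<cdot>\<^bsub>B\<^esub> g = amap F \<psi> \<Longrightarrow>
      \<exists>\<chi> \<in> Arr A. Dom A \<chi> = Dom A \<psi> \<and> Cod A \<chi> = Dom A \<phi> \<and> amap F \<chi> = g \<and> \<phi> \<cdot>\<^bsub>A\<^esub> \<chi> = \<psi>"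
    and "\<And>\<chi> \<chi>'. \<chi> \<in> Arr A \<Longrightarrow> \<chi>' \<in> Arr A \<Longrightarrow> Cod A \<chi> = Dom A \<phi> \<Longrightarrow> Cod A \<chi>' = Dom A \<phi> \<Longrightarrow>
      Dom A \<chi> = Dom A \<chi>' \<Longrightarrow> amap F \<chi> = amap F \<chi>' \<Longrightarrow> \<phi> \<cdot>\<^bsub>A\<^esub> \<chi> = \<phi> \<cdot>\<^bsub>A\<^esub> \<chi>' \<Longrightarrow> \<chi> = \<chi>'"
  shows "cartesian A B F \<phi>"
  unfolding cartesian_def
proof (intro conjI ballI impI)
  fix z \<psi> g
  assume h: "\<psi> \<in> hom A z (Cod A \<phi>)" "g \<in> hom B (omap F z) (omap F (Dom A \<phi>))"
    "amap F \<phi> \<cdot>\<^bsub>B\<^esub> g = amap F \<psi>"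
  then obtain \<chi> where \<chi>: "\<chi> \<in> Arr A" "Dom A \<chi> = z" "Cod A \<chi> = Dom A \<phi>" "amap F \<chi> = g"
    "\<phi> \<cdot>\<^bsub>A\<^esub> \<chi> = \<psi>"
    using assms(2)[of \<psi> g] by (auto simp: hom_def)
  show "\<exists>!\<chi>. \<chi> \<in> hom A z (Dom A \<phi>) \<and> amap F \<chi> = g \<and> \<phi> \<cdot>\<^bsub>A\<^esub> \<chi> = \<psi>"
  proof (rule ex1I[of _ \<chi>])
    fix \<xi> assume "\<xi> \<in> hom A z (Dom A \<phi>) \<and> amap F \<xi> = g \<and> \<phi> \<cdot>\<^bsub>A\<^esub> \<xi> = \<psi>"
    then show "\<xi> = \<chi>" by (intro assms(3)[of \<xi> \<chi>]) (simp_all add: hom_def \<chi>)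
  qed (simp add: hom_def \<chi>)
qed (rule assms(1))

lemma cartesian_Arr [simp]: "cartesian A B F \<phi> \<Longrightarrow> \<phi> \<in> Arr A"
  by (simp add: cartesian_def)

lemma cartesian_lift:
  assumes "cartesian A B F \<phi>" "\<psi> \<in> Arr A" "Cod A \<psi> = Cod A \<phi>" "g \<in> Arr B"
    "Dom B g = omap F (Dom A \<psi>)" "Cod B g = omap F (Dom A \<phi>)" "amap F \<phi> \<cdot>\<^bsub>B\<^esub> g = amap F \<psi>"
  obtains \<chi> where "\<chi> \<in> Arr A" "Dom A \<chi> = Dom A \<psi>" "Cod A \<chi> = Dom A \<phi>" "amap F \<chi> = g"
    "\<phi> \<cdot>\<^bsub>A\<^esub> \<chi> = \<psi>"
proof -
  have "\<exists>!\<chi>. \<chi> \<in> hom A (Dom A \<psi>) (Dom A \<phi>) \<and> amap F \<chi> = g \<and> \<phi> \<cdot>\<^bsub>A\<^esub> \<chi> = \<psi>"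
    using assms unfolding cartesian_def hom_def by simp
  then show thesis using that by (auto simp: hom_def)
qed

lemma cartesian_cancel:
  assumes "cartesian A B F \<phi>" "\<chi> \<in> Arr A" "\<chi>' \<in> Arr A" "Cod A \<chi> = Dom A \<phi>" "Cod A \<chi>' = Dom A \<phi>"
    "Dom A \<chi> = Dom A \<chi>'" "amap F \<chi> = amap F \<chi>'" "\<phi> \<cdot>\<^bsub>A\<^esub> \<chi> = \<phi> \<cdot>\<^bsub>A\<^esub> \<chi>'"
  shows "\<chi> = \<chi>'"
proof -
  have \<phi>: "\<phi> \<in> Arr A" using assms(1) by simp
  have "amap F \<phi> \<cdot>\<^bsub>B\<^esub> amap F \<chi> = amap F (\<phi> \<cdot>\<^bsub>A\<^esub> \<chi>)" using assms \<phi> by (simp del: assms(8))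
  then have "\<exists>!\<xi>. \<xi> \<in> hom A (Dom A \<chi>) (Dom A \<phi>) \<and> amap F \<xi> = amap F \<chi> \<and> \<phi> \<cdot>\<^bsub>A\<^esub> \<xi> = \<phi> \<cdot>\<^bsub>A\<^esub> \<chi>"
    using assms(1-6) \<phi> unfolding cartesian_def hom_def by simp
  then show ?thesis using assms by (auto simp: hom_def)
qed

text \<open>The lift through an isomorphism is forced to be the inverse followed by nothing else:
  compose it with \<open>\<psi>\<close>. It lies over \<open>g\<close> because the image of
  \<open>\<phi>\<close> is invertible.\<close>

lemma iso_cartesian [simp]:
  assumes "iso A \<phi>"
  shows "cartesian A B F \<phi>"
proof (rule cartesianI)
  fix \<psi> g
  assume h: "\<psi> \<in> Arr A" "Cod A \<psi> = Cod A \<phi>" "g \<in> Arr B" "Dom B g = omap F (Dom A \<psi>)"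
    "Cod B g = omap F (Dom A \<phi>)" "amap F \<phi> \<cdot>\<^bsub>B\<^esub> g = amap F \<psi>"
  have "inv_arr B (amap F \<phi>) \<cdot>\<^bsub>B\<^esub> amap F \<psi> = g"
    using h(1-5) assms by (simp flip: h(6))
  then show "\<exists>\<chi>\<in>Arr A. Dom A \<chi> = Dom A \<psi> \<and> Cod A \<chi> = Dom A \<phi> \<and> amap F \<chi> = g \<and> \<phi> \<cdot>\<^bsub>A\<^esub> \<chi> = \<psi>"
    using h(1-5) assms by (intro bexI[of _ "inv_arr A \<phi> \<cdot>\<^bsub>A\<^esub> \<psi>"]) auto
next
  show "\<chi> = \<chi>'" if "\<chi> \<in> Arr A" "\<chi>' \<in> Arr A" "Cod A \<chi> = Dom A \<phi>" "Cod A \<chi>' = Dom A \<phi>"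
      "\<phi> \<cdot>\<^bsub>A\<^esub> \<chi> = \<phi> \<cdot>\<^bsub>A\<^esub> \<chi>'" for \<chi> \<chi>'
    by (rule A.iso_cancel_left[OF assms that(5)]) fact+
qed (use assms in simp)

lemma cartesian_Comp [simp]:
  assumes "cartesian A B F \<phi>" "cartesian A B F \<psi>" "Cod A \<phi> = Dom A \<psi>"
  shows "cartesian A B F (\<psi> \<cdot>\<^bsub>A\<^esub> \<phi>)"
proof (rule cartesianI)
  fix \<xi> g
  assume h: "\<xi> \<in> Arr A" "Cod A \<xi> = Cod A (\<psi> \<cdot>\<^bsub>A\<^esub> \<phi>)" "g \<in> Arr B" "Dom B g = omap F (Dom A \<xi>)"
    "Cod B g = omap F (Dom A (\<psi> \<cdot>\<^bsub>A\<^esub> \<phi>))" "amap F (\<psi> \<cdot>\<^bsub>A\<^esub> \<phi>) \<cdot>\<^bsub>B\<^esub> g = amap F \<xi>"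
  obtain \<chi> where \<chi>: "\<chi> \<in> Arr A" "Dom A \<chi> = Dom A \<xi>" "Cod A \<chi> = Dom A \<psi>"
    "amap F \<chi> = amap F \<phi> \<cdot>\<^bsub>B\<^esub> g" "\<psi> \<cdot>\<^bsub>A\<^esub> \<chi> = \<xi>"
    by (rule cartesian_lift[OF assms(2), of \<xi> "amap F \<phi> \<cdot>\<^bsub>B\<^esub> g"]) (use h assms in auto)
  obtain \<chi>' where \<chi>': "\<chi>' \<in> Arr A" "Dom A \<chi>' = Dom A \<chi>" "Cod A \<chi>' = Dom A \<phi>"
    "amap F \<chi>' = g" "\<phi> \<cdot>\<^bsub>A\<^esub> \<chi>' = \<chi>"
    by (rule cartesian_lift[OF assms(1), of \<chi> g]) (use h \<chi> assms in auto)
  show "\<exists>\<chi>\<in>Arr A. Dom A \<chi> = Dom A \<xi> \<and> Cod A \<chi> = Dom A (\<psi> \<cdot>\<^bsub>A\<^esub> \<phi>) \<and> amap F \<chi> = g \<and>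
      \<psi> \<cdot>\<^bsub>A\<^esub> \<phi> \<cdot>\<^bsub>A\<^esub> \<chi> = \<xi>"
    by (rule bexI[of _ \<chi>']) (use \<chi> \<chi>' assms in auto)
next
  fix \<chi> \<chi>'
  assume h: "\<chi> \<in> Arr A" "\<chi>' \<in> Arr A" "Cod A \<chi> = Dom A (\<psi> \<cdot>\<^bsub>A\<^esub> \<phi>)" "Cod A \<chi>' = Dom A (\<psi> \<cdot>\<^bsub>A\<^esub> \<phi>)"
    "Dom A \<chi> = Dom A \<chi>'" "amap F \<chi> = amap F \<chi>'" "\<psi> \<cdot>\<^bsub>A\<^esub> \<phi> \<cdot>\<^bsub>A\<^esub> \<chi> = \<psi> \<cdot>\<^bsub>A\<^esub> \<phi> \<cdot>\<^bsub>A\<^esub> \<chi>'"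
  have "\<phi> \<cdot>\<^bsub>A\<^esub> \<chi> = \<phi> \<cdot>\<^bsub>A\<^esub> \<chi>'"
    by (rule cartesian_cancel[OF assms(2)]) (use h assms in auto)
  then show "\<chi> = \<chi>'"
    by (intro cartesian_cancel[OF assms(1), of \<chi> \<chi>']) (use h assms(1-3) in simp_all)
qed (use assms in auto)

text \<open>Lift each of the two arrows through the other over an identity;
  \<open>cartesian_cancel\<close> makes the two lifts mutually inverse.\<close>

lemma cartesian_unique:
  assumes "cartesian A B F \<phi>" "cartesian A B F \<phi>'" "Cod A \<phi>' = Cod A \<phi>" "amap F \<phi>' = amap F \<phi>"
  obtains \<iota> where "iso A \<iota>" "Dom A \<iota> = Dom A \<phi>'" "Cod A \<iota> = Dom A \<phi>"
    "amap F \<iota> = Ident B (omap F (Dom A \<phi>))" "\<phi>' = \<phi> \<cdot>\<^bsub>A\<^esub> \<iota>"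
proof -
  have d: "omap F (Dom A \<phi>') = omap F (Dom A \<phi>)"
    using assms by (metis amap_Arr(2) cartesian_Arr)
  obtain \<iota> where \<iota>: "\<iota> \<in> Arr A" "Dom A \<iota> = Dom A \<phi>'" "Cod A \<iota> = Dom A \<phi>"
    "amap F \<iota> = Ident B (omap F (Dom A \<phi>))" "\<phi> \<cdot>\<^bsub>A\<^esub> \<iota> = \<phi>'"
    by (rule cartesian_lift[OF assms(1), of \<phi>' "Ident B (omap F (Dom A \<phi>))"]) (use assms d in auto)
  obtain \<kappa> where \<kappa>: "\<kappa> \<in> Arr A" "Dom A \<kappa> = Dom A \<phi>" "Cod A \<kappa> = Dom A \<phi>'"
    "amap F \<kappa> = Ident B (omap F (Dom A \<phi>))" "\<phi>' \<cdot>\<^bsub>A\<^esub> \<kappa> = \<phi>"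
    by (rule cartesian_lift[OF assms(2), of \<phi> "Ident B (omap F (Dom A \<phi>))"]) (use assms d in auto)
  have "\<phi> \<cdot>\<^bsub>A\<^esub> (\<iota> \<cdot>\<^bsub>A\<^esub> \<kappa>) = (\<phi> \<cdot>\<^bsub>A\<^esub> \<iota>) \<cdot>\<^bsub>A\<^esub> \<kappa>" using \<iota>(1-4) \<kappa>(1-4) assms by simp
  then have "\<iota> \<cdot>\<^bsub>A\<^esub> \<kappa> = Ident A (Dom A \<phi>)"
    by (intro cartesian_cancel[OF assms(1), of "\<iota> \<cdot>\<^bsub>A\<^esub> \<kappa>" "Ident A (Dom A \<phi>)"]) (use \<iota> \<kappa> assms d in simp_all)
  moreover have "\<phi>' \<cdot>\<^bsub>A\<^esub> (\<kappa> \<cdot>\<^bsub>A\<^esub> \<iota>) = (\<phi>' \<cdot>\<^bsub>A\<^esub> \<kappa>) \<cdot>\<^bsub>A\<^esub> \<iota>" using \<iota>(1-4) \<kappa>(1-4) assms by simp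
  then have "\<kappa> \<cdot>\<^bsub>A\<^esub> \<iota> = Ident A (Dom A \<phi>')"
    by (intro cartesian_cancel[OF assms(2), of "\<kappa> \<cdot>\<^bsub>A\<^esub> \<iota>" "Ident A (Dom A \<phi>')"]) (use \<iota> \<kappa> assms d in simp_all)
  ultimately have "iso A \<iota>" by (intro isoI[of \<iota> A \<kappa>]) (use \<iota> \<kappa> in auto)
  then show thesis using that \<iota> by auto
qed

text \<open>Lifting the identity of the codomain over the inverse in the base yields a right
  inverse; cancelling \<open>\<phi>\<close> shows that it is also a left inverse.\<close>

lemma cartesian_over_iso:
  assumes "cartesian A B F \<phi>" "iso B (amap F \<phi>)"
  shows "iso A \<phi>"
proof -
  have \<phi>: "\<phi> \<in> Arr A" using assms by simp
  obtain \<kappa> where \<kappa>: "\<kappa> \<in> Arr A" "Dom A \<kappa> = Cod A \<phi>" "Cod A \<kappa> = Dom A \<phi>"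
    "amap F \<kappa> = inv_arr B (amap F \<phi>)" "\<phi> \<cdot>\<^bsub>A\<^esub> \<kappa> = Ident A (Cod A \<phi>)"
    by (rule cartesian_lift[OF assms(1), of "Ident A (Cod A \<phi>)" "inv_arr B (amap F \<phi>)"])
      (use assms \<phi> in auto)
  have "\<phi> \<cdot>\<^bsub>A\<^esub> (\<kappa> \<cdot>\<^bsub>A\<^esub> \<phi>) = (\<phi> \<cdot>\<^bsub>A\<^esub> \<kappa>) \<cdot>\<^bsub>A\<^esub> \<phi>" using \<kappa>(1-4) \<phi> by simp
  then have "\<kappa> \<cdot>\<^bsub>A\<^esub> \<phi> = Ident A (Dom A \<phi>)"
    by (intro cartesian_cancel[OF assms(1), of "\<kappa> \<cdot>\<^bsub>A\<^esub> \<phi>" "Ident A (Dom A \<phi>)"]) (use \<kappa> \<phi> assms in simp_all)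
  then show ?thesis by (intro isoI[of \<phi> A \<kappa>]) (use \<kappa> \<phi> in auto)
qed

end

section \<open>Functors over the base and cartesian arrows\<close>

definition over :: "('o, 'a) cat \<Rightarrow> ('o, 'a, 'p, 'b) fctr \<Rightarrow> ('o, 'a, 'q, 'c) fctr \<Rightarrow>
    ('q, 'c, 'p, 'b) fctr \<Rightarrow> bool" where
  "over A p u q \<longleftrightarrow> (\<forall>f \<in> Arr A. amap q (amap u f) = amap p f)"

lemma over_amap: "over A p u q \<Longrightarrow> f \<in> Arr A \<Longrightarrow> amap q (amap u f) = amap p f"
  by (simp add: over_def)

text \<open>Objects are compared through their identity arrows, which is why \<open>over\<close>
  speaks of arrows only.\<close>

lemma over_omap:
  assumes "cat_functor A E p" "cat_functor B E q" "cat_functor A B u" "over A p u q" "x \<in> Obj A"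
  shows "omap q (omap u x) = omap p x"
proof -
  interpret p: cat_functor A E p by fact
  interpret q: cat_functor B E q by fact
  interpret u: cat_functor A B u by fact
  have "Dom E (amap q (amap u (Ident A x))) = Dom E (amap p (Ident A x))"
    using assms(4,5) by (metis over_amap p.A.Ident_Arr(1))
  then show ?thesis using assms(5) by simp
qed

text \<open>A lift found in \<open>B\<close> has a unique preimage between the right objects of
  \<open>A\<close>, and its image in the base is unchanged because \<open>u\<close> lies over
  \<open>E\<close>. Functors obtained through a fully faithful one are shown to be cartesian in this
  way.\<close>

lemma fully_faithful_reflects_cartesian:
  assumes "cat_functor A E p" "cat_functor B E q" "cat_functor A B u" "over A p u q"
    and ff: "fully_faithful A B u" and "\<phi> \<in> Arr A" "cartesian B E q (amap u \<phi>)"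
  shows "cartesian A E p \<phi>"
proof -
  interpret p: cat_functor A E p by fact
  interpret q: cat_functor B E q by fact
  interpret u: cat_functor A B u by fact
  note o [simp] = over_omap[OF assms(1-4)] over_amap[OF assms(4)]
  note faithful = fully_faithful_faithful[OF ff _ _ _ _ _ p.A.category_axioms]
  show ?thesis
  proof (rule p.cartesianI)
    fix \<psi> g
    assume h: "\<psi> \<in> Arr A" "Cod A \<psi> = Cod A \<phi>" "g \<in> Arr E" "Dom E g = omap p (Dom A \<psi>)"
      "Cod E g = omap p (Dom A \<phi>)" "amap p \<phi> \<cdot>\<^bsub>E\<^esub> g = amap p \<psi>"
    obtain \<xi> where \<xi>: "\<xi> \<in> Arr B" "Dom B \<xi> = omap u (Dom A \<psi>)" "Cod B \<xi> = omap u (Dom A \<phi>)"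
      "amap q \<xi> = g" "amap u \<phi> \<cdot>\<^bsub>B\<^esub> \<xi> = amap u \<psi>"
      by (rule q.cartesian_lift[OF assms(7), of "amap u \<psi>" g]) (use h assms(6) in auto)
    obtain \<chi> where \<chi>: "\<chi> \<in> Arr A" "Dom A \<chi> = Dom A \<psi>" "Cod A \<chi> = Dom A \<phi>" "amap u \<chi> = \<xi>"
      by (rule fully_faithful_full[OF ff, of \<xi> "Dom A \<psi>" "Dom A \<phi>"]) (use h assms(6) \<xi> in auto)
    have "\<phi> \<cdot>\<^bsub>A\<^esub> \<chi> = \<psi>" by (rule faithful) (use h \<chi> \<xi> assms(6) in auto)
    moreover have "amap p \<chi> = g" using \<chi> \<xi> o(2)[of \<chi>] by simp
    ultimately show "\<exists>\<chi>\<in>Arr A. Dom A \<chi> = Dom A \<psi> \<and> Cod A \<chi> = Dom A \<phi> \<and> amap p \<chi> = g \<and> \<phi> \<cdot>\<^bsub>A\<^esub> \<chi> = \<psi>"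
      using \<chi> by auto
  next
    fix \<chi> \<chi>'
    assume h: "\<chi> \<in> Arr A" "\<chi>' \<in> Arr A" "Cod A \<chi> = Dom A \<phi>" "Cod A \<chi>' = Dom A \<phi>"
      "Dom A \<chi> = Dom A \<chi>'" "amap p \<chi> = amap p \<chi>'" "\<phi> \<cdot>\<^bsub>A\<^esub> \<chi> = \<phi> \<cdot>\<^bsub>A\<^esub> \<chi>'"
    have "amap u \<chi> = amap u \<chi>'"
      by (rule q.cartesian_cancel[OF assms(7)]) (use h assms(6) in \<open>auto simp flip: u.amap_comp\<close>)
    then show "\<chi> = \<chi>'" by (rule faithful) (use h in simp_all)
  qed fact
qed

text \<open>Any cartesian arrow is a given lift precomposed with an isomorphism, and isomorphisms
  are cartesian. A constructed functor thus needs to be tested only on one convenient lift for each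
  \<open>y\<close> and \<open>f\<close>.\<close>

lemma preserves_cartesian_if_lifts:
  assumes "cat_functor A E p" "cat_functor B E q" "cat_functor A B u" "over A p u q"
    and lifts: "\<And>y f. y \<in> Obj A \<Longrightarrow> f \<in> Arr E \<Longrightarrow> Cod E f = omap p y \<Longrightarrow>
      \<exists>\<phi>. cartesian A E p \<phi> \<and> Cod A \<phi> = y \<and> amap p \<phi> = f \<and> cartesian B E q (amap u \<phi>)"
    and "cartesian A E p \<phi>"
  shows "cartesian B E q (amap u \<phi>)"
proof -
  interpret p: cat_functor A E p by fact
  interpret q: cat_functor B E q by fact
  interpret u: cat_functor A B u by fact
  obtain \<phi>' where \<phi>': "cartesian A E p \<phi>'" "Cod A \<phi>' = Cod A \<phi>" "amap p \<phi>' = amap p \<phi>"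
    "cartesian B E q (amap u \<phi>')"
    using lifts[of "Cod A \<phi>" "amap p \<phi>"] assms(6) by auto
  obtain \<iota> where "iso A \<iota>" "Cod A \<iota> = Dom A \<phi>'" "\<phi> = \<phi>' \<cdot>\<^bsub>A\<^esub> \<iota>"
    by (rule p.cartesian_unique[OF \<phi>'(1) assms(6)]) (use \<phi>' in auto)
  then show ?thesis using \<phi>' by simp
qed

section \<open>Normalization of categories and functors\<close>

definition norm_cat :: "('o, 'a) cat \<Rightarrow> ('o, 'a) cat" where
  "norm_cat C = \<lparr>Obj = Obj C, Arr = Arr C, Dom = restrict (Dom C) (Arr C),
     Cod = restrict (Cod C) (Arr C), Ident = restrict (Ident C) (Obj C),
     Comp = (\<lambda>g f. if f \<in> Arr C \<and> g \<in> Arr C \<and> Cod C f = Dom C g then g \<cdot>\<^bsub>C\<^esub> f else undefined)\<rparr>"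

definition norm_fctr :: "('o, 'a) cat \<Rightarrow> ('o, 'a, 'p, 'b) fctr \<Rightarrow> ('o, 'a, 'p, 'b) fctr" where
  "norm_fctr A F = \<lparr>omap = restrict (omap F) (Obj A), amap = restrict (amap F) (Arr A)\<rparr>"

lemma norm_cat_simps [simp]:
  "Obj (norm_cat C) = Obj C" "Arr (norm_cat C) = Arr C"
  "f \<in> Arr C \<Longrightarrow> Dom (norm_cat C) f = Dom C f"
  "f \<in> Arr C \<Longrightarrow> Cod (norm_cat C) f = Cod C f"
  "x \<in> Obj C \<Longrightarrow> Ident (norm_cat C) x = Ident C x"
  "f \<in> Arr C \<Longrightarrow> g \<in> Arr C \<Longrightarrow> Cod C f = Dom C g \<Longrightarrow> g \<cdot>\<^bsub>norm_cat C\<^esub> f = g \<cdot>\<^bsub>C\<^esub> f"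
  "hom (norm_cat C) x y = hom C x y"
  by (auto simp: norm_cat_def hom_def)

lemma norm_fctr_simps [simp]:
  "x \<in> Obj A \<Longrightarrow> omap (norm_fctr A F) x = omap F x"
  "f \<in> Arr A \<Longrightarrow> amap (norm_fctr A F) f = amap F f"
  by (auto simp: norm_fctr_def)

lemma category_norm_cat:
  assumes "category C"
  shows "category (norm_cat C)"
proof -
  interpret category C by fact
  show ?thesis by (rule categoryI) auto
qed

lemma normalized_norm_cat: "category C \<Longrightarrow> normalized_category (norm_cat C)"
  by (auto simp: normalized_category_def category_norm_cat) (auto simp: norm_cat_def)

lemma cat_functor_norm:
  assumes "cat_functor A B F"
  shows "cat_functor A B (norm_fctr A F)" "cat_functor (norm_cat A) B F" "cat_functor A (norm_cat B) F"
proof -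
  interpret cat_functor A B F by fact
  show "cat_functor A B (norm_fctr A F)"
    by (rule cat_functorI) (auto simp: A.category_axioms B.category_axioms)
  show "cat_functor (norm_cat A) B F"
    by (rule cat_functorI) (auto simp: A.category_axioms B.category_axioms category_norm_cat)
  show "cat_functor A (norm_cat B) F"
    by (rule cat_functorI) (auto simp: A.category_axioms B.category_axioms category_norm_cat)
qed

lemma iso_norm_cat [simp]:
  assumes "category C"
  shows "iso (norm_cat C) f \<longleftrightarrow> iso C f"
proof -
  interpret category C by fact
  show ?thesis unfolding iso_def by (auto simp: hom_def intro!: bexI)
qed

lemma cartesian_norm [simp]:
  assumes "cat_functor A E p"
  shows "cartesian (norm_cat A) E (norm_fctr A p) \<phi> \<longleftrightarrow> cartesian A E p \<phi>"
proof -
  interpret cat_functor A E p by fact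
  have *: "(\<chi> \<in> hom A z (Dom A \<phi>) \<and> amap (norm_fctr A p) \<chi> = g \<and> \<phi> \<cdot>\<^bsub>norm_cat A\<^esub> \<chi> = \<psi>) \<longleftrightarrow>
      (\<chi> \<in> hom A z (Dom A \<phi>) \<and> amap p \<chi> = g \<and> \<phi> \<cdot>\<^bsub>A\<^esub> \<chi> = \<psi>)" if "\<phi> \<in> Arr A" for \<chi> z \<phi> g \<psi>
    using that by (auto simp: hom_def)
  show ?thesis
    unfolding cartesian_def by (cases "\<phi> \<in> Arr A") (auto simp: hom_def[of A _ "Cod A \<phi>"] *)
qed

section \<open>The category of fibred categories\<close>

abbreviation Ob :: "'u fibred_cat \<Rightarrow> 'u set" where "Ob P \<equiv> Obj (total P)"
abbreviation Ar :: "'u fibred_cat \<Rightarrow> 'u set" where "Ar P \<equiv> Arr (total P)"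
abbreviation dm :: "'u fibred_cat \<Rightarrow> 'u \<Rightarrow> 'u" where "dm P \<equiv> Dom (total P)"
abbreviation cd :: "'u fibred_cat \<Rightarrow> 'u \<Rightarrow> 'u" where "cd P \<equiv> Cod (total P)"
abbreviation idt :: "'u fibred_cat \<Rightarrow> 'u \<Rightarrow> 'u" where "idt P \<equiv> Ident (total P)"
abbreviation po :: "'u fibred_cat \<Rightarrow> 'u \<Rightarrow> 'u" where "po P \<equiv> omap (proj P)"
abbreviation pa :: "'u fibred_cat \<Rightarrow> 'u \<Rightarrow> 'u" where "pa P \<equiv> amap (proj P)"
abbreviation fo :: "'u fib_map \<Rightarrow> 'u \<Rightarrow> 'u" where "fo u \<equiv> omap (fun_of u)"
abbreviation fa :: "'u fib_map \<Rightarrow> 'u \<Rightarrow> 'u" where "fa u \<equiv> amap (fun_of u)"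
abbreviation cart :: "('u, 'u) cat \<Rightarrow> 'u fibred_cat \<Rightarrow> 'u \<Rightarrow> bool" where
  "cart E P \<equiv> cartesian (total P) E (proj P)"

definition mk_fib :: "('u, 'u) cat \<Rightarrow> ('u, 'u, 'u, 'u) fctr \<Rightarrow> 'u fibred_cat" where
  "mk_fib T p = \<lparr>total = norm_cat T, proj = norm_fctr T p\<rparr>"

lemma mk_fib_simps [simp]: "total (mk_fib T p) = norm_cat T" "proj (mk_fib T p) = norm_fctr T p"
  by (simp_all add: mk_fib_def)

lemma mk_fib_fibred:
  assumes "cat_functor T E p"
    and "\<And>y f. y \<in> Obj T \<Longrightarrow> f \<in> Arr E \<Longrightarrow> Cod E f = omap p y \<Longrightarrow>
      \<exists>\<phi>. cartesian T E p \<phi> \<and> Cod T \<phi> = y \<and> amap p \<phi> = f"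
  shows "fibred_category E (mk_fib T p)"
proof -
  interpret cat_functor T E p by fact
  have f: "cat_functor (norm_cat T) E (norm_fctr T p)"
    using cat_functor_norm(2)[OF cat_functor_norm(1)[OF assms(1)]] by simp
  have "\<exists>\<phi>. cartesian T E p \<phi> \<and> Cod (norm_cat T) \<phi> = y \<and> amap (norm_fctr T p) \<phi> = f"
    if "y \<in> Obj T" "f \<in> Arr E" "Cod E f = omap p y" for y f
    using assms(2)[OF that] by force
  then show ?thesis
    using f assms(1) by (auto simp: fibred_category_def normalized_functor_def grothendieck_fibration_def
        normalized_norm_cat A.category_axioms) (auto simp: norm_fctr_def)
qed

locale fibred =
  fixes E :: "('u, 'u) cat" and P :: "'u fibred_cat"
  assumes base: "category E"
    and fib: "fibred_category E P"
begin

sublocale cat_functor "total P" E "proj P"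
  using fib by (simp add: fibred_category_def grothendieck_fibration_def)

lemma cartesian_over:
  assumes "y \<in> Ob P" "f \<in> Arr E" "Cod E f = po P y"
  obtains \<phi> where "cart E P \<phi>" "cd P \<phi> = y" "pa P \<phi> = f"
  using assms fib unfolding fibred_category_def grothendieck_fibration_def by blast

end

lemma Fib_simps [simp]:
  "P \<in> Obj (Fib E) \<longleftrightarrow> fibred_category E P"
  "Dom (Fib E) u = src u" "Cod (Fib E) u = tgt u"
  "Ident (Fib E) P = \<lparr>src = P, tgt = P, fun_of = id_fctr (total P)\<rparr>"
  "src (v \<cdot>\<^bsub>Fib E\<^esub> u) = src u" "tgt (v \<cdot>\<^bsub>Fib E\<^esub> u) = tgt v"
  by (auto simp: Fib_def)

lemma amap_Fib_Comp [simp]: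
  "f \<in> Ar (src u) \<Longrightarrow> fa (v \<cdot>\<^bsub>Fib E\<^esub> u) f = fa v (fa u f)"
  "x \<in> Ob (src u) \<Longrightarrow> fo (v \<cdot>\<^bsub>Fib E\<^esub> u) x = fo v (fo u x)"
  by (auto simp: Fib_def comp_fctr_def)

lemma id_fctr_simps [simp]:
  "f \<in> Arr A \<Longrightarrow> amap (id_fctr A) f = f" "x \<in> Obj A \<Longrightarrow> omap (id_fctr A) x = x"
  by (auto simp: id_fctr_def)

locale fib_arrow =
  fixes E :: "('u, 'u) cat" and A B :: "'u fibred_cat" and u :: "'u fib_map"
  assumes base: "category E"
    and arrow: "u \<in> Arr (Fib E)"
    and src [simp]: "src u = A"
    and tgt [simp]: "tgt u = B"
begin

sublocale S: fibred E A
  by (rule fibred.intro[OF base]) (use arrow in \<open>simp add: Fib_def cartesian_functor_def\<close>)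

sublocale T: fibred E B
  by (rule fibred.intro[OF base]) (use arrow in \<open>simp add: Fib_def cartesian_functor_def\<close>)

sublocale cat_functor "total A" "total B" "fun_of u"
  using arrow by (simp add: Fib_def cartesian_functor_def normalized_functor_def)

lemma over_base: "over (total A) (proj A) (fun_of u) (proj B)"
proof -
  have *: "comp_fctr (total A) (proj B) (fun_of u) = proj A"
    using arrow by (simp add: Fib_def cartesian_functor_def)
  have "amap (comp_fctr (total A) (proj B) (fun_of u)) f = pa A f" for f
    by (simp only: *)
  then show ?thesis unfolding over_def comp_fctr_def by (metis fctr.select_convs(2) restrict_apply')
qed

lemmas proj_amap [simp] = over_amap[OF over_base]
lemmas proj_omap [simp] =
  over_omap[OF S.cat_functor_axioms T.cat_functor_axioms cat_functor_axioms over_base]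

lemma amap_cartesian [simp]:
  "cart E A \<phi> \<Longrightarrow> cart E B (fa u \<phi>)"
  using arrow by (simp add: Fib_def cartesian_functor_def)

end

lemma fib_arrow_hom:
  "category E \<Longrightarrow> u \<in> hom (Fib E) A B \<Longrightarrow> fib_arrow E A B u"
  by (auto simp: hom_def intro: fib_arrow.intro)

lemma fib_arrow_Arr:
  assumes "category E" "u \<in> Arr (Fib E)"
  obtains A B where "fib_arrow E A B u" "A = src u" "B = tgt u"
  using assms by (auto intro: fib_arrow.intro)

lemma normalized_functor_norm [simp]: "cat_functor A B F \<Longrightarrow> normalized_functor A B (norm_fctr A F)"
  by (auto simp: normalized_functor_def cat_functor_norm) (auto simp: norm_fctr_def)

lemma fctr_eqI:
  assumes "normalized_functor A B F" "normalized_functor A B' G"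
    and "\<And>f. f \<in> Arr A \<Longrightarrow> amap F f = amap G f"
    and "\<And>x. x \<in> Obj A \<Longrightarrow> omap F x = omap G x"
  shows "F = G"
proof -
  have "omap F = omap G" "amap F = amap G"
    using assms by (auto simp: normalized_functor_def intro!: extensionalityI)
  then show ?thesis by simp
qed

text \<open>The object map is recovered from the values on identities, and normalization excludes
  differences outside the carriers.\<close>

lemma fib_map_eqI:
  assumes "fib_arrow E A B u" "fib_arrow E A B v"
    and "\<And>f. f \<in> Ar A \<Longrightarrow> fa u f = fa v f"
  shows "u = v"
proof -
  interpret u: fib_arrow E A B u by fact
  interpret v: fib_arrow E A B v by fact
  have "fo u x = fo v x" if "x \<in> Ob A" for x
    using that u.amap_Arr(2)[of "idt A x"] v.amap_Arr(2)[of "idt A x"]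
      assms(3) by simp
  then have "fun_of u = fun_of v"
    using assms(3) u.arrow v.arrow
    by (intro fctr_eqI[of "total A" "total B" "fun_of u" "total B"])
      (auto simp: Fib_def cartesian_functor_def)
  then show ?thesis using u.src v.src u.tgt v.tgt by (intro fib_map.equality) simp_all
qed

definition mk_map :: "'u fibred_cat \<Rightarrow> 'u fibred_cat \<Rightarrow> ('u, 'u, 'u, 'u) fctr \<Rightarrow> 'u fib_map" where
  "mk_map A B G = \<lparr>src = A, tgt = B, fun_of = norm_fctr (total A) G\<rparr>"

lemma mk_map_simps [simp]:
  "src (mk_map A B G) = A" "tgt (mk_map A B G) = B"
  "f \<in> Ar A \<Longrightarrow> fa (mk_map A B G) f = amap G f"
  "x \<in> Ob A \<Longrightarrow> fo (mk_map A B G) x = omap G x"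
  by (auto simp: mk_map_def)

lemma mk_map_Arr:
  assumes "category E" "fibred_category E A" "fibred_category E B" "cat_functor (total A) (total B) G"
    and "over (total A) (proj A) G (proj B)"
    and "\<And>\<phi>. cart E A \<phi> \<Longrightarrow> cart E B (amap G \<phi>)"
  shows "mk_map A B G \<in> Arr (Fib E)"
proof -
  interpret A: fibred E A by (rule fibred.intro) (use assms in auto)
  interpret B: fibred E B by (rule fibred.intro) (use assms in auto)
  interpret G: cat_functor "total A" "total B" G by fact
  have "comp_fctr (total A) (proj B) (norm_fctr (total A) G) = proj A"
  proof (rule fctr_eqI[of "total A" E _ E])
    show "normalized_functor (total A) E (proj A)"
      using A.fib by (simp add: fibred_category_def)
    have *: "cat_functor (total A) E (comp_fctr (total A) (proj B) (norm_fctr (total A) G))"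
      by (rule cat_functorI) (auto simp: comp_fctr_def A.A.category_axioms A.B.category_axioms)
    show "normalized_functor (total A) E (comp_fctr (total A) (proj B) (norm_fctr (total A) G))"
      by (simp add: normalized_functor_def *) (simp add: comp_fctr_def)
  qed (use over_amap[OF assms(5)] over_omap[OF A.cat_functor_axioms B.cat_functor_axioms assms(4,5)] in
      \<open>auto simp: comp_fctr_def\<close>)
  then show ?thesis
    using assms by (simp add: Fib_def cartesian_functor_def mk_map_def)
qed

lemma mk_map_Arr_lifts:
  assumes "category E" "fibred_category E A" "fibred_category E B" "cat_functor (total A) (total B) G"
    and "over (total A) (proj A) G (proj B)"
    and "\<And>y f. y \<in> Ob A \<Longrightarrow> f \<in> Arr E \<Longrightarrow> Cod E f = po A y \<Longrightarrow>
      \<exists>\<phi>. cart E A \<phi> \<and> cd A \<phi> = y \<and> pa A \<phi> = f \<and>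
        cart E B (amap G \<phi>)"
  shows "mk_map A B G \<in> Arr (Fib E)"
proof -
  interpret A: fibred E A by (rule fibred.intro) (use assms in auto)
  interpret B: fibred E B by (rule fibred.intro) (use assms in auto)
  show ?thesis
    by (rule mk_map_Arr[OF assms(1-5)])
      (rule preserves_cartesian_if_lifts[OF A.cat_functor_axioms B.cat_functor_axioms assms(4-6)])
qed

lemma fib_arrow_Comp:
  assumes "fib_arrow E A B u" "fib_arrow E B C v"
  shows "fib_arrow E A C (v \<cdot>\<^bsub>Fib E\<^esub> u)"
proof -
  interpret u: fib_arrow E A B u by fact
  interpret v: fib_arrow E B C v by fact
  let ?h = "\<lparr>omap = \<lambda>x. fo v (fo u x), amap = \<lambda>f. fa v (fa u f)\<rparr>"
  have "v \<cdot>\<^bsub>Fib E\<^esub> u = mk_map A C ?h"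
    by (simp add: mk_map_def norm_fctr_def comp_fctr_def Fib_def)
  moreover have "cat_functor (total A) (total C) ?h"
    by (rule cat_functorI) (auto simp: u.S.A.category_axioms v.T.A.category_axioms)
  then have "mk_map A C ?h \<in> Arr (Fib E)"
    by (intro mk_map_Arr) (auto simp: u.base u.S.fib v.T.fib over_def)
  ultimately show ?thesis using u.base by (intro fib_arrow.intro) simp_all
qed

lemma fib_arrow_Ident:
  assumes "category E" "fibred_category E P"
  shows "fib_arrow E P P (Ident (Fib E) P)"
proof -
  interpret P: fibred E P by (rule fibred.intro) (use assms in auto)
  have "Ident (Fib E) P = mk_map P P (id_fctr (total P))"
    by (auto simp: mk_map_def norm_fctr_def id_fctr_def)
  moreover have "cat_functor (total P) (total P) (id_fctr (total P))"
    by (rule cat_functorI) (auto simp: P.A.category_axioms)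
  then have "mk_map P P (id_fctr (total P)) \<in> Arr (Fib E)"
    by (intro mk_map_Arr) (auto simp: assms over_def)
  ultimately show ?thesis by (intro fib_arrow.intro) (simp_all add: assms)
qed

lemma category_Fib:
  assumes "category E"
  shows "category (Fib E)"
proof (rule categoryI)
  show "Ident (Fib E) P \<in> Arr (Fib E) \<and> Dom (Fib E) (Ident (Fib E) P) = P \<and>
      Cod (Fib E) (Ident (Fib E) P) = P" if "P \<in> Obj (Fib E)" for P
    using fib_arrow.arrow[OF fib_arrow_Ident[of E P]] that assms by simp
next
  fix f g assume fg: "f \<in> Arr (Fib E)" "g \<in> Arr (Fib E)" "Cod (Fib E) f = Dom (Fib E) g"
  then have "fib_arrow E (src f) (tgt g) (g \<cdot>\<^bsub>Fib E\<^esub> f)"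
    by (intro fib_arrow_Comp[of E "src f" "tgt f"] fib_arrow.intro) (simp_all add: assms)
  then show "g \<cdot>\<^bsub>Fib E\<^esub> f \<in> Arr (Fib E) \<and> Dom (Fib E) (g \<cdot>\<^bsub>Fib E\<^esub> f) = Dom (Fib E) f \<and>
      Cod (Fib E) (g \<cdot>\<^bsub>Fib E\<^esub> f) = Cod (Fib E) g"
    by (simp add: fib_arrow.arrow)
next
  fix f assume fg: "f \<in> Arr (Fib E)"
  then obtain A B where "fib_arrow E A B f" using assms by (auto elim: fib_arrow_Arr)
  then interpret f: fib_arrow E A B f .
  show "Dom (Fib E) f \<in> Obj (Fib E)" "Cod (Fib E) f \<in> Obj (Fib E)" by (auto simp: f.S.fib f.T.fib)
  have "fib_arrow E A B (Ident (Fib E) (Cod (Fib E) f) \<cdot>\<^bsub>Fib E\<^esub> f)"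
    by (rule fib_arrow_Comp[OF f.fib_arrow_axioms]) (use fib_arrow_Ident[OF assms] f.T.fib in simp)
  then show "Ident (Fib E) (Cod (Fib E) f) \<cdot>\<^bsub>Fib E\<^esub> f = f"
    by (rule fib_map_eqI) (use f.fib_arrow_axioms in auto)
  have "fib_arrow E A B (f \<cdot>\<^bsub>Fib E\<^esub> Ident (Fib E) (Dom (Fib E) f))"
    by (rule fib_arrow_Comp[OF _ f.fib_arrow_axioms]) (use fib_arrow_Ident[OF assms] f.S.fib in simp)
  then show "f \<cdot>\<^bsub>Fib E\<^esub> Ident (Fib E) (Dom (Fib E) f) = f"
    by (rule fib_map_eqI) (use f.fib_arrow_axioms in auto)
next
  fix f g h
  assume fg: "f \<in> Arr (Fib E)" "g \<in> Arr (Fib E)" "h \<in> Arr (Fib E)" "Cod (Fib E) f = Dom (Fib E) g"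
  interpret f: fib_arrow E "src f" "src g" f by (rule fib_arrow.intro) (use assms fg in auto)
  show "(h \<cdot>\<^bsub>Fib E\<^esub> g) \<cdot>\<^bsub>Fib E\<^esub> f = h \<cdot>\<^bsub>Fib E\<^esub> (g \<cdot>\<^bsub>Fib E\<^esub> f)"
    using f.omap_Obj f.amap_Arr(1) by (simp add: Fib_def comp_fctr_def del: f.src f.tgt cong: restrict_cong)
qed

section \<open>Lifting properties\<close>

context fib_arrow
begin

lemma E_injections_iff: "u \<in> E_injections E \<longleftrightarrow> inj_on (fo u) (Ob A)"
  using arrow by (simp add: E_injections_def)

lemma E_isofibrations_iff:
  "u \<in> E_isofibrations E \<longleftrightarrow>
    (\<forall>a \<in> Ob A. \<forall>\<beta>. iso (total B) \<beta> \<longrightarrow> dm B \<beta> = fo u a \<longrightarrow>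
      (\<exists>\<alpha>. iso (total A) \<alpha> \<and> dm A \<alpha> = a \<and> fa u \<alpha> = \<beta>))"
  using arrow cat_functor_axioms by (auto simp: E_isofibrations_def isofibration_def)

lemma E_equivalences_iff:
  "u \<in> E_equivalences E \<longleftrightarrow>
    fully_faithful (total A) (total B) (fun_of u) \<and> ess_surj (total A) (total B) (fun_of u)"
  using arrow cat_functor_axioms by (simp add: E_equivalences_def cat_equivalence_iff)

end

lemma Fib_square:
  assumes "fib_arrow E A X s" "fib_arrow E A B i" "p \<cdot>\<^bsub>Fib E\<^esub> s = t \<cdot>\<^bsub>Fib E\<^esub> i"
  shows "f \<in> Ar A \<Longrightarrow> fa p (fa s f) = fa t (fa i f)"
    and "x \<in> Ob A \<Longrightarrow> fo p (fo s x) = fo t (fo i x)"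
proof -
  interpret s: fib_arrow E A X s by fact
  interpret i: fib_arrow E A B i by fact
  show "fa p (fa s f) = fa t (fa i f)" if "f \<in> Ar A"
    using arg_cong[OF assms(3), of "\<lambda>h. fa h f"] that by simp
  show "fo p (fo s x) = fo t (fo i x)" if "x \<in> Ob A"
    using arg_cong[OF assms(3), of "\<lambda>h. fo h x"] that by simp
qed

text \<open>Essential surjectivity reaches \<open>y\<close> by an isomorphism from some image; the
  codomain of its lift to \<open>X\<close> is mapped to \<open>y\<close> itself.\<close>

lemma trivial_fibration_surj:
  assumes "fib_arrow E X Y p" "p \<in> E_isofibrations E" "p \<in> E_equivalences E" "y \<in> Ob Y"
  obtains x where "x \<in> Ob X" "fo p x = y"
proof -
  interpret p: fib_arrow E X Y p by fact
  obtain a \<beta> where a: "a \<in> Ob X" "iso (total Y) \<beta>" "dm Y \<beta> = fo p a"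
    "cd Y \<beta> = y"
    using assms(3,4) unfolding p.E_equivalences_iff ess_surj_def by blast
  then obtain \<alpha> where "iso (total X) \<alpha>" "fa p \<alpha> = \<beta>"
    using assms(2) unfolding p.E_isofibrations_iff by blast
  then show thesis using that[of "cd X \<alpha>"] a by (metis iso_Arr p.S.A.Cod_Obj p.amap_Arr(3))
qed

text \<open>Only the object part of the diagonal involves a choice. The arrows are forced by full
  faithfulness of \<open>p\<close>, and all equations between them are checked after applying
  \<open>p\<close>.\<close>

lemma has_lift_cof_trivial_fib:
  assumes "category E" "i \<in> E_injections E" "p \<in> E_isofibrations E" "p \<in> E_equivalences E"
  shows "has_lift (Fib E) i p"
proof -
  obtain A B where "fib_arrow E A B i" using assms by (auto simp: E_injections_def elim: fib_arrow_Arr)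
  then interpret i: fib_arrow E A B i .
  obtain X Y where "fib_arrow E X Y p" using assms by (auto simp: E_isofibrations_def elim: fib_arrow_Arr)
  then interpret p: fib_arrow E X Y p .
  have ff: "fully_faithful (total X) (total Y) (fun_of p)"
    using assms(4) by (simp add: p.E_equivalences_iff)
  note faithful = fully_faithful_faithful[OF ff _ _ _ _ _ p.S.A.category_axioms]
  have inj: "inj_on (fo i) (Ob A)" using assms(2) by (simp add: i.E_injections_iff)
  show ?thesis
    unfolding has_lift_def
  proof (intro ballI impI)
    fix s t
    assume "s \<in> hom (Fib E) (Dom (Fib E) i) (Dom (Fib E) p)" "t \<in> hom (Fib E) (Cod (Fib E) i) (Cod (Fib E) p)"
      and sq: "p \<cdot>\<^bsub>Fib E\<^esub> s = t \<cdot>\<^bsub>Fib E\<^esub> i"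
    then have "fib_arrow E A X s" "fib_arrow E B Y t" by (auto intro!: fib_arrow_hom assms)
    then interpret s: fib_arrow E A X s + t: fib_arrow E B Y t .
    note sq' [simp] = Fib_square[OF s.fib_arrow_axioms i.fib_arrow_axioms sq]
    \<comment> \<open>On the image of \<open>i\<close> the value has to be the one prescribed by
      \<open>s\<close>, which is unambiguous by injectivity; elsewhere any preimage of the image
      under \<open>t\<close> will do.\<close>
    have "\<exists>x \<in> Ob X. fo p x = fo t b \<and>
        (\<forall>a \<in> Ob A. fo i a = b \<longrightarrow> x = fo s a)" if b: "b \<in> Ob B" for b
    proof (cases "b \<in> fo i ` Ob A")
      case True
      then obtain a where a: "a \<in> Ob A" "b = fo i a" by auto
      then show ?thesis using inj by (intro bexI[of _ "fo s a"]) (auto simp: inj_on_def)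
    next
      case False
      obtain x where "x \<in> Ob X" "fo p x = fo t b"
        by (rule trivial_fibration_surj[OF p.fib_arrow_axioms assms(3,4), of "fo t b"])
          (use b in auto)
      then show ?thesis using False by auto
    qed
    then obtain ob where ob: "\<And>b. b \<in> Ob B \<Longrightarrow> ob b \<in> Ob X"
      "\<And>b. b \<in> Ob B \<Longrightarrow> fo p (ob b) = fo t b"
      "\<And>a. a \<in> Ob A \<Longrightarrow> ob (fo i a) = fo s a"
      by (metis i.omap_Obj)
    have "\<exists>\<xi>. \<xi> \<in> Ar X \<and> dm X \<xi> = ob (dm B \<beta>) \<and>
        cd X \<xi> = ob (cd B \<beta>) \<and> fa p \<xi> = fa t \<beta>"
      if "\<beta> \<in> Ar B" for \<beta>
      by (rule fully_faithful_full[OF ff, of "fa t \<beta>" "ob (dm B \<beta>)" "ob (cd B \<beta>)"])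
        (use that ob in auto)
    then obtain m where m [simp]: "\<And>\<beta>. \<beta> \<in> Ar B \<Longrightarrow> m \<beta> \<in> Ar X"
      "\<And>\<beta>. \<beta> \<in> Ar B \<Longrightarrow> dm X (m \<beta>) = ob (dm B \<beta>)"
      "\<And>\<beta>. \<beta> \<in> Ar B \<Longrightarrow> cd X (m \<beta>) = ob (cd B \<beta>)"
      "\<And>\<beta>. \<beta> \<in> Ar B \<Longrightarrow> fa p (m \<beta>) = fa t \<beta>"
      by metis
    let ?G = "\<lparr>omap = ob, amap = m\<rparr>"
    have [simp]: "m (idt B b) = idt X (ob b)" if "b \<in> Ob B" for b
      by (rule faithful) (use that ob in auto)
    have [simp]: "m (\<beta>' \<cdot>\<^bsub>total B\<^esub> \<beta>) = m \<beta>' \<cdot>\<^bsub>total X\<^esub> m \<beta>"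
      if "\<beta> \<in> Ar B" "\<beta>' \<in> Ar B" "cd B \<beta> = dm B \<beta>'" for \<beta> \<beta>'
      by (rule faithful) (use that ob in auto)
    have [simp]: "m (fa i \<alpha>) = fa s \<alpha>" if "\<alpha> \<in> Ar A" for \<alpha>
      by (rule faithful) (use that ob in auto)
    have f: "cat_functor (total B) (total X) ?G"
      by (rule cat_functorI) (auto simp: ob i.T.A.category_axioms p.S.A.category_axioms)
    have o: "over (total B) (proj B) ?G (proj X)"
      unfolding over_def
    proof
      fix \<beta> assume b: "\<beta> \<in> Ar B"
      then have "pa X (m \<beta>) = pa Y (fa p (m \<beta>))"
        using p.proj_amap[of "m \<beta>"] by simp
      also have "\<dots> = pa B \<beta>" using b by simp
      finally show "pa X (amap ?G \<beta>) = pa B \<beta>" by simp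
    qed
    have "mk_map B X ?G \<in> Arr (Fib E)"
    proof (rule mk_map_Arr)
      \<comment> \<open>Under \<open>p\<close> the diagonal becomes \<open>t\<close>, which is
        cartesian, and \<open>p\<close> reflects cartesian arrows.\<close>
      fix \<phi> assume "cart E B \<phi>"
      then show "cart E X (amap ?G \<phi>)"
        by (intro fully_faithful_reflects_cartesian[OF p.S.cat_functor_axioms p.T.cat_functor_axioms
              p.cat_functor_axioms p.over_base ff]) auto
    qed (use f o i.T.fib p.S.fib assms in auto)
    then have d: "fib_arrow E B X (mk_map B X ?G)" by (intro fib_arrow.intro) (simp_all add: assms)
    have "mk_map B X ?G \<cdot>\<^bsub>Fib E\<^esub> i = s"
      by (rule fib_map_eqI[OF fib_arrow_Comp[OF i.fib_arrow_axioms d] s.fib_arrow_axioms])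
        (auto simp: ob)
    moreover have "p \<cdot>\<^bsub>Fib E\<^esub> mk_map B X ?G = t"
      by (rule fib_map_eqI[OF fib_arrow_Comp[OF d p.fib_arrow_axioms] t.fib_arrow_axioms]) auto
    ultimately show "\<exists>d\<in>hom (Fib E) (Cod (Fib E) i) (Dom (Fib E) p).
        d \<cdot>\<^bsub>Fib E\<^esub> i = s \<and> p \<cdot>\<^bsub>Fib E\<^esub> d = t"
      by (intro bexI[of _ "mk_map B X ?G"]) (auto simp: hom_def fib_arrow.arrow[OF d])
  qed
qed

text \<open>A retraction \<open>n\<close> of \<open>i\<close> with isomorphisms
  \<open>\<epsilon>\<close> to the identity gives a first approximation, \<open>s\<close> after
  \<open>n\<close>. Its image under \<open>p\<close> differs from \<open>t\<close> by the images of
  \<open>\<epsilon>\<close>; lifting these through the isofibration corrects it.\<close>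

lemma has_lift_trivial_cof_fib:
  assumes "category E" "i \<in> E_injections E" "i \<in> E_equivalences E" "p \<in> E_isofibrations E"
  shows "has_lift (Fib E) i p"
proof -
  obtain A B where "fib_arrow E A B i" using assms by (auto simp: E_injections_def elim: fib_arrow_Arr)
  then interpret i: fib_arrow E A B i .
  obtain X Y where "fib_arrow E X Y p" using assms by (auto simp: E_isofibrations_def elim: fib_arrow_Arr)
  then interpret p: fib_arrow E X Y p .
  have ff: "fully_faithful (total A) (total B) (fun_of i)"
    using assms(3) by (simp add: i.E_equivalences_iff)
  note faithful = fully_faithful_faithful[OF ff _ _ _ _ _ i.S.A.category_axioms]
  have inj: "inj_on (fo i) (Ob A)" using assms(2) by (simp add: i.E_injections_iff)
  \<comment> \<open>Identities are chosen on the image of \<open>i\<close>, so that the retraction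
    is strict there and the diagonal restricts to \<open>s\<close> exactly.\<close>
  have "\<exists>a \<in> Ob A. \<exists>\<epsilon>. iso (total B) \<epsilon> \<and> dm B \<epsilon> = fo i a \<and> cd B \<epsilon> = b \<and>
      (\<forall>a' \<in> Ob A. fo i a' = b \<longrightarrow> a = a' \<and> \<epsilon> = idt B b)"
    if "b \<in> Ob B" for b
  proof (cases "b \<in> fo i ` Ob A")
    case True
    then obtain a where a: "a \<in> Ob A" "b = fo i a" by auto
    then show ?thesis
      using inj by (intro bexI[of _ a] exI[of _ "idt B b"]) (auto simp: inj_on_def)
  next
    case False
    then show ?thesis using assms(3) that unfolding i.E_equivalences_iff ess_surj_def by blast
  qed
  then obtain r \<epsilon> where r0: "\<And>b. b \<in> Ob B \<Longrightarrow> r b \<in> Ob A \<and> iso (total B) (\<epsilon> b) \<and>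
      dm B (\<epsilon> b) = fo i (r b) \<and> cd B (\<epsilon> b) = b \<and>
      (\<forall>a' \<in> Ob A. fo i a' = b \<longrightarrow> r b = a' \<and> \<epsilon> b = idt B b)"
    by metis
  then have r [simp]: "\<And>b. b \<in> Ob B \<Longrightarrow> r b \<in> Ob A"
    "\<And>b. b \<in> Ob B \<Longrightarrow> iso (total B) (\<epsilon> b)"
    "\<And>b. b \<in> Ob B \<Longrightarrow> dm B (\<epsilon> b) = fo i (r b)"
    "\<And>b. b \<in> Ob B \<Longrightarrow> cd B (\<epsilon> b) = b"
    "\<And>a. a \<in> Ob A \<Longrightarrow> r (fo i a) = a"
    "\<And>a. a \<in> Ob A \<Longrightarrow> \<epsilon> (fo i a) = idt B (fo i a)"
    by auto
  have "\<exists>\<alpha>. \<alpha> \<in> Ar A \<and> dm A \<alpha> = r (dm B \<beta>) \<and>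
      cd A \<alpha> = r (cd B \<beta>) \<and>
      fa i \<alpha> = inv_arr (total B) (\<epsilon> (cd B \<beta>)) \<cdot>\<^bsub>total B\<^esub> (\<beta> \<cdot>\<^bsub>total B\<^esub> \<epsilon> (dm B \<beta>))"
    if "\<beta> \<in> Ar B" for \<beta>
    by (rule fully_faithful_full[OF ff, of "inv_arr (total B) (\<epsilon> (cd B \<beta>)) \<cdot>\<^bsub>total B\<^esub>
        (\<beta> \<cdot>\<^bsub>total B\<^esub> \<epsilon> (dm B \<beta>))" "r (dm B \<beta>)" "r (cd B \<beta>)"])
      (use that in auto)
  then obtain n where n [simp]: "\<And>\<beta>. \<beta> \<in> Ar B \<Longrightarrow> n \<beta> \<in> Ar A"
    "\<And>\<beta>. \<beta> \<in> Ar B \<Longrightarrow> dm A (n \<beta>) = r (dm B \<beta>)"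
    "\<And>\<beta>. \<beta> \<in> Ar B \<Longrightarrow> cd A (n \<beta>) = r (cd B \<beta>)"
    "\<And>\<beta>. \<beta> \<in> Ar B \<Longrightarrow> fa i (n \<beta>) =
      inv_arr (total B) (\<epsilon> (cd B \<beta>)) \<cdot>\<^bsub>total B\<^esub> (\<beta> \<cdot>\<^bsub>total B\<^esub> \<epsilon> (dm B \<beta>))"
    by metis
  have n_id [simp]: "n (idt B b) = idt A (r b)" if "b \<in> Ob B" for b
    by (rule faithful) (use that in auto)
  have n_comp [simp]: "n (\<beta>' \<cdot>\<^bsub>total B\<^esub> \<beta>) = n \<beta>' \<cdot>\<^bsub>total A\<^esub> n \<beta>"
    if "\<beta> \<in> Ar B" "\<beta>' \<in> Ar B" "cd B \<beta> = dm B \<beta>'" for \<beta> \<beta>'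
    by (rule faithful) (use that in auto)
  have n_i [simp]: "n (fa i \<alpha>) = \<alpha>" if "\<alpha> \<in> Ar A" for \<alpha>
    by (rule faithful) (use that in auto)
  \<comment> \<open>The image under \<open>i\<close> is \<open>\<phi>\<close> conjugated by
    isomorphisms, hence cartesian, and \<open>i\<close> reflects this.\<close>
  have n_cart: "cart E A (n \<phi>)" if "cart E B \<phi>" for \<phi>
    by (rule fully_faithful_reflects_cartesian[OF i.S.cat_functor_axioms i.T.cat_functor_axioms
              i.cat_functor_axioms i.over_base ff]) (use that in auto)
  show ?thesis
    unfolding has_lift_def
  proof (intro ballI impI)
    fix s t
    assume "s \<in> hom (Fib E) (Dom (Fib E) i) (Dom (Fib E) p)" "t \<in> hom (Fib E) (Cod (Fib E) i) (Cod (Fib E) p)"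
      and sq: "p \<cdot>\<^bsub>Fib E\<^esub> s = t \<cdot>\<^bsub>Fib E\<^esub> i"
    then have "fib_arrow E A X s" "fib_arrow E B Y t" by (auto intro!: fib_arrow_hom assms)
    then interpret s: fib_arrow E A X s + t: fib_arrow E B Y t .
    note sq' [simp] = Fib_square[OF s.fib_arrow_axioms i.fib_arrow_axioms sq]
    \<comment> \<open>Lifts of the images of \<open>\<epsilon>\<close> along \<open>p\<close>, again
      taken to be identities on the image of \<open>i\<close>.\<close>
    have "\<exists>\<tau>. iso (total X) \<tau> \<and> dm X \<tau> = fo s (r b) \<and>
        fa p \<tau> = fa t (\<epsilon> b) \<and>
        (\<forall>a \<in> Ob A. fo i a = b \<longrightarrow> \<tau> = idt X (fo s a))"
      if "b \<in> Ob B" for b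
    proof (cases "b \<in> fo i ` Ob A")
      case True
      then obtain a where a: "a \<in> Ob A" "b = fo i a" by auto
      then show ?thesis
        using inj by (intro exI[of _ "idt X (fo s a)"]) (auto simp: inj_on_def)
    next
      case False
      moreover have "\<exists>\<tau>. iso (total X) \<tau> \<and> dm X \<tau> = fo s (r b) \<and>
          fa p \<tau> = fa t (\<epsilon> b)"
        using assms(4) that unfolding p.E_isofibrations_iff by simp
      ultimately show ?thesis by blast
    qed
    then obtain \<tau> where \<tau> [simp]: "\<And>b. b \<in> Ob B \<Longrightarrow> iso (total X) (\<tau> b)"
      "\<And>b. b \<in> Ob B \<Longrightarrow> dm X (\<tau> b) = fo s (r b)"
      "\<And>b. b \<in> Ob B \<Longrightarrow> fa p (\<tau> b) = fa t (\<epsilon> b)"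
      "\<And>a. a \<in> Ob A \<Longrightarrow> \<tau> (fo i a) = idt X (fo s a)"
      by (metis i.omap_Obj)
    define G where "G = \<lparr>omap = \<lambda>b. cd X (\<tau> b), amap = \<lambda>\<beta>. \<tau> (cd B \<beta>) \<cdot>\<^bsub>total X\<^esub>
      (fa s (n \<beta>) \<cdot>\<^bsub>total X\<^esub> inv_arr (total X) (\<tau> (dm B \<beta>)))\<rparr>"
    have [simp]: "omap G b = cd X (\<tau> b)" "amap G \<beta> = \<tau> (cd B \<beta>) \<cdot>\<^bsub>total X\<^esub>
      (fa s (n \<beta>) \<cdot>\<^bsub>total X\<^esub> inv_arr (total X) (\<tau> (dm B \<beta>)))" for b \<beta>
      by (simp_all add: G_def)
    \<comment> \<open>Since \<open>p\<close> takes \<open>\<tau>\<close> to the image of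
      \<open>\<epsilon>\<close> under \<open>t\<close>, the conjugation by \<open>\<tau>\<close>
      undoes the conjugation by \<open>\<epsilon>\<close> hidden in \<open>n\<close>.\<close>
    have pG: "fa p (amap G \<beta>) = fa t \<beta>" if "\<beta> \<in> Ar B" for \<beta>
      using that by simp
    have f: "cat_functor (total B) (total X) G"
      by (rule cat_functorI) (auto simp: i.T.A.category_axioms p.S.A.category_axioms)
    then interpret G: cat_functor "total B" "total X" G .
    have o: "over (total B) (proj B) G (proj X)"
      unfolding over_def
    proof
      fix \<beta> assume b: "\<beta> \<in> Ar B"
      then have "pa X (amap G \<beta>) = pa Y (fa p (amap G \<beta>))"
        using p.proj_amap[OF G.amap_Arr(1)[OF b]] by (simp del: p.proj_amap)
      also have "\<dots> = pa B \<beta>" unfolding pG[OF b] using b by simp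
      finally show "pa X (amap G \<beta>) = pa B \<beta>" .
    qed
    have "mk_map B X G \<in> Arr (Fib E)"
      by (rule mk_map_Arr) (use f o i.T.fib p.S.fib assms(1) n_cart in auto)
    then have d: "fib_arrow E B X (mk_map B X G)" by (intro fib_arrow.intro) (simp_all add: assms)
    have "mk_map B X G \<cdot>\<^bsub>Fib E\<^esub> i = s"
      by (rule fib_map_eqI[OF fib_arrow_Comp[OF i.fib_arrow_axioms d] s.fib_arrow_axioms]) auto
    moreover have "p \<cdot>\<^bsub>Fib E\<^esub> mk_map B X G = t"
      by (rule fib_map_eqI[OF fib_arrow_Comp[OF d p.fib_arrow_axioms] t.fib_arrow_axioms])
        (use pG in \<open>simp del: \<tau>\<close>)
    ultimately show "\<exists>d\<in>hom (Fib E) (Cod (Fib E) i) (Dom (Fib E) p).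
        d \<cdot>\<^bsub>Fib E\<^esub> i = s \<and> p \<cdot>\<^bsub>Fib E\<^esub> d = t"
      by (intro bexI[of _ "mk_map B X G"]) (auto simp: hom_def fib_arrow.arrow[OF d])
  qed
qed

section \<open>Retracts and two out of three\<close>

text \<open>Here \<open>f\<close> is a retract of \<open>p\<close> with fixed codomain, as
  \<open>p\<close> after \<open>j\<close> equals \<open>f\<close>. Lift in \<open>Q\<close> starting
  from the image of \<open>a\<close>, then apply \<open>r\<close>.\<close>

lemma isofibration_retract:
  assumes "fib_arrow E A B f" "fib_arrow E A Q j" "fib_arrow E Q B p" "fib_arrow E Q A r"
    and rj: "r \<cdot>\<^bsub>Fib E\<^esub> j = Ident (Fib E) A" and fr: "f \<cdot>\<^bsub>Fib E\<^esub> r = p"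
    and p: "p \<in> E_isofibrations E"
  shows "f \<in> E_isofibrations E"
proof -
  interpret f: fib_arrow E A B f by fact
  interpret j: fib_arrow E A Q j by fact
  interpret p: fib_arrow E Q B p by fact
  interpret r: fib_arrow E Q A r by fact
  have [simp]: "fo r (fo j a) = a" if "a \<in> Ob A" for a
    using arg_cong[OF rj, of "\<lambda>h. fo h a"] that by simp
  have fro [simp]: "fo p x = fo f (fo r x)" if "x \<in> Ob Q" for x
    using that by (simp flip: fr)
  have fra: "fa p x = fa f (fa r x)" if "x \<in> Ar Q" for x
    using that by (simp flip: fr)
  show ?thesis
    unfolding f.E_isofibrations_iff
  proof (intro ballI allI impI)
    fix a \<beta> assume h: "a \<in> Ob A" "iso (total B) \<beta>" "dm B \<beta> = fo f a"
    have "dm B \<beta> = fo p (fo j a)" using h by simp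
    then obtain \<alpha> where "iso (total Q) \<alpha>" "dm Q \<alpha> = fo j a" "fa p \<alpha> = \<beta>"
      using p h unfolding p.E_isofibrations_iff by (metis j.omap_Obj)
    then show "\<exists>\<alpha>. iso (total A) \<alpha> \<and> dm A \<alpha> = a \<and> fa f \<alpha> = \<beta>"
      using h fra[of \<alpha>] by (intro exI[of _ "fa r \<alpha>"]) auto
  qed
qed

text \<open>Faithfulness is inherited through \<open>j\<close>, which has the left inverse
  \<open>r\<close>; full preimages and essential preimages are found in \<open>Q\<close> and carried
  to \<open>A\<close> by \<open>r\<close>.\<close>

lemma equivalence_retract_left:
  assumes "fib_arrow E A B f" "fib_arrow E A Q j" "fib_arrow E Q B p" "fib_arrow E Q A r"
    and rj: "r \<cdot>\<^bsub>Fib E\<^esub> j = Ident (Fib E) A" and fr: "f \<cdot>\<^bsub>Fib E\<^esub> r = p"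
    and p: "p \<in> E_equivalences E"
  shows "f \<in> E_equivalences E"
proof -
  interpret f: fib_arrow E A B f by fact
  interpret j: fib_arrow E A Q j by fact
  interpret p: fib_arrow E Q B p by fact
  interpret r: fib_arrow E Q A r by fact
  have rjo [simp]: "fo r (fo j a) = a" if "a \<in> Ob A" for a
    using arg_cong[OF rj, of "\<lambda>h. fo h a"] that by simp
  have rja [simp]: "fa r (fa j a) = a" if "a \<in> Ar A" for a
    using arg_cong[OF rj, of "\<lambda>h. fa h a"] that by simp
  have fro: "fo p x = fo f (fo r x)" if "x \<in> Ob Q" for x
    using that by (simp flip: fr)
  have fra: "fa p x = fa f (fa r x)" if "x \<in> Ar Q" for x
    using that by (simp flip: fr)
  have ff: "fully_faithful (total Q) (total B) (fun_of p)" and es: "ess_surj (total Q) (total B) (fun_of p)"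
    using p by (auto simp: p.E_equivalences_iff)
  have "fully_faithful (total A) (total B) (fun_of f)"
  proof (rule fully_faithfulI[OF f.cat_functor_axioms])
    fix \<alpha> \<alpha>'
    assume h: "\<alpha> \<in> Ar A" "\<alpha>' \<in> Ar A" "dm A \<alpha> = dm A \<alpha>'"
      "cd A \<alpha> = cd A \<alpha>'" "fa f \<alpha> = fa f \<alpha>'"
    have "fa j \<alpha> = fa j \<alpha>'"
      by (rule fully_faithful_faithful[OF ff]) (use h in \<open>simp_all add: fra j.T.A.category_axioms\<close>)
    then show "\<alpha> = \<alpha>'" using h rja by metis
  next
    fix g x y
    assume h: "g \<in> Ar B" "x \<in> Ob A" "y \<in> Ob A"
      "dm B g = fo f x" "cd B g = fo f y"
    obtain \<delta> where "\<delta> \<in> Ar Q" "dm Q \<delta> = fo j x"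
      "cd Q \<delta> = fo j y" "fa p \<delta> = g"
      by (rule fully_faithful_full[OF ff, of g "fo j x" "fo j y"])
        (use h in \<open>simp_all add: fro\<close>)
    then show "\<exists>\<alpha>\<in>Ar A. dm A \<alpha> = x \<and> cd A \<alpha> = y \<and> fa f \<alpha> = g"
      using h fra[of \<delta>] by (intro bexI[of _ "fa r \<delta>"]) auto
  qed
  moreover have "ess_surj (total A) (total B) (fun_of f)"
    unfolding ess_surj_def
  proof
    fix b assume "b \<in> Ob B"
    then obtain x \<beta> where "x \<in> Ob Q" "iso (total B) \<beta>" "dm B \<beta> = fo p x"
      "cd B \<beta> = b"
      using es unfolding ess_surj_def by blast
    then show "\<exists>a\<in>Ob A. \<exists>\<beta>. iso (total B) \<beta> \<and> dm B \<beta> = fo f a \<and> cd B \<beta> = b"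
      by (intro bexI[of _ "fo r x"] exI[of _ \<beta>]) (auto simp: fro)
  qed
  ultimately show ?thesis by (simp add: f.E_equivalences_iff)
qed

text \<open>Dually, \<open>i\<close> is a retract of \<open>j\<close> with fixed domain: a preimage
  under \<open>j\<close> of the image of \<open>g\<close> under \<open>d\<close> is a preimage of
  \<open>g\<close> under \<open>i\<close>, as one sees by applying \<open>p\<close>.\<close>

lemma equivalence_retract_right:
  assumes "fib_arrow E A B i" "fib_arrow E A Q j" "fib_arrow E Q B p" "fib_arrow E B Q d"
    and pd: "p \<cdot>\<^bsub>Fib E\<^esub> d = Ident (Fib E) B" and di: "d \<cdot>\<^bsub>Fib E\<^esub> i = j"
    and j: "j \<in> E_equivalences E"
  shows "i \<in> E_equivalences E"
proof -
  interpret i: fib_arrow E A B i by fact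
  interpret j: fib_arrow E A Q j by fact
  interpret p: fib_arrow E Q B p by fact
  interpret d: fib_arrow E B Q d by fact
  have pdo [simp]: "fo p (fo d b) = b" if "b \<in> Ob B" for b
    using arg_cong[OF pd, of "\<lambda>h. fo h b"] that by simp
  have pda [simp]: "fa p (fa d b) = b" if "b \<in> Ar B" for b
    using arg_cong[OF pd, of "\<lambda>h. fa h b"] that by simp
  have dio: "fo j x = fo d (fo i x)" if "x \<in> Ob A" for x
    using that by (simp flip: di)
  have dia: "fa j x = fa d (fa i x)" if "x \<in> Ar A" for x
    using that by (simp flip: di)
  have ff: "fully_faithful (total A) (total Q) (fun_of j)" and es: "ess_surj (total A) (total Q) (fun_of j)"
    using j by (auto simp: j.E_equivalences_iff)
  have "fully_faithful (total A) (total B) (fun_of i)"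
  proof (rule fully_faithfulI[OF i.cat_functor_axioms])
    fix \<alpha> \<alpha>'
    assume h: "\<alpha> \<in> Ar A" "\<alpha>' \<in> Ar A" "dm A \<alpha> = dm A \<alpha>'"
      "cd A \<alpha> = cd A \<alpha>'" "fa i \<alpha> = fa i \<alpha>'"
    show "\<alpha> = \<alpha>'"
      by (rule fully_faithful_faithful[OF ff]) (use h in \<open>simp_all add: dia i.S.A.category_axioms\<close>)
  next
    fix g x y
    assume h: "g \<in> Ar B" "x \<in> Ob A" "y \<in> Ob A"
      "dm B g = fo i x" "cd B g = fo i y"
    obtain \<alpha> where \<alpha>: "\<alpha> \<in> Ar A" "dm A \<alpha> = x" "cd A \<alpha> = y"
      "fa j \<alpha> = fa d g"
      by (rule fully_faithful_full[OF ff, of "fa d g" x y]) (use h in \<open>simp_all add: dio\<close>)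
    have "fa i \<alpha> = g" using \<alpha> h pda dia i.amap_Arr(1) by metis
    then show "\<exists>\<alpha>\<in>Ar A. dm A \<alpha> = x \<and> cd A \<alpha> = y \<and> fa i \<alpha> = g"
      using \<alpha> by blast
  qed
  moreover have "ess_surj (total A) (total B) (fun_of i)"
    unfolding ess_surj_def
  proof
    fix b assume b: "b \<in> Ob B"
    then obtain a \<beta> where "a \<in> Ob A" "iso (total Q) \<beta>" "dm Q \<beta> = fo j a"
      "cd Q \<beta> = fo d b"
      using es unfolding ess_surj_def by (meson d.omap_Obj)
    then show "\<exists>a\<in>Ob A. \<exists>\<beta>. iso (total B) \<beta> \<and> dm B \<beta> = fo i a \<and> cd B \<beta> = b"
      using b by (intro bexI[of _ a] exI[of _ "fa p \<beta>"]) (auto simp: dio)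
  qed
  ultimately show ?thesis by (simp add: i.E_equivalences_iff)
qed

lemma ess_surj_Comp:
  assumes "fib_arrow E A B u" "fib_arrow E B C v"
    "ess_surj (total A) (total B) (fun_of u)" "ess_surj (total B) (total C) (fun_of v)"
  shows "ess_surj (total A) (total C) (fun_of (v \<cdot>\<^bsub>Fib E\<^esub> u))"
proof -
  interpret u: fib_arrow E A B u by fact
  interpret v: fib_arrow E B C v by fact
  show ?thesis
    unfolding ess_surj_def
  proof
    fix c assume "c \<in> Ob C"
    then obtain b \<gamma> where b: "b \<in> Ob B" "iso (total C) \<gamma>"
      "dm C \<gamma> = fo v b" "cd C \<gamma> = c"
      using assms(4) unfolding ess_surj_def by blast
    then obtain a \<beta> where "a \<in> Ob A" "iso (total B) \<beta>"
      "dm B \<beta> = fo u a" "cd B \<beta> = b"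
      using assms(3) unfolding ess_surj_def by blast
    then show "\<exists>a\<in>Ob A. \<exists>\<beta>. iso (total C) \<beta> \<and>
        dm C \<beta> = fo (v \<cdot>\<^bsub>Fib E\<^esub> u) a \<and> cd C \<beta> = c"
      using b by (intro bexI[of _ a] exI[of _ "\<gamma> \<cdot>\<^bsub>total C\<^esub> fa v \<beta>"]) auto
  qed
qed

text \<open>Each case is split into full faithfulness and essential surjectivity. The substantial
  case is full faithfulness of \<open>v\<close> from \<open>u\<close> and the composite, since
  objects of \<open>B\<close> come from \<open>A\<close> only up to isomorphism.\<close>

lemma two_out_of_three_E_equivalences:
  assumes "category E"
  shows "two_out_of_three (Fib E) (E_equivalences E)"
  unfolding two_out_of_three_def
proof (intro ballI impI)
  fix u v assume uv: "u \<in> Arr (Fib E)" "v \<in> Arr (Fib E)" "Cod (Fib E) u = Dom (Fib E) v"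
  obtain A B where "fib_arrow E A B u" "B = tgt u" using uv assms by (auto elim: fib_arrow_Arr)
  then interpret u: fib_arrow E A B u by simp
  obtain C where "fib_arrow E B C v" using uv assms by (auto intro!: that[of "tgt v"] fib_arrow.intro)
  then interpret v: fib_arrow E B C v .
  interpret vu: fib_arrow E A C "v \<cdot>\<^bsub>Fib E\<^esub> u"
    by (rule fib_arrow_Comp[OF u.fib_arrow_axioms v.fib_arrow_axioms])
  let ?ff = "\<lambda>A B u. fully_faithful (total A) (total B) (fun_of u)"
  let ?es = "\<lambda>A B u. ess_surj (total A) (total B) (fun_of u)"
  have ff1: "?ff A C (v \<cdot>\<^bsub>Fib E\<^esub> u)" if "?ff A B u" "?ff B C v"
    unfolding fully_faithful_def
  proof (intro ballI)
    fix x y assume h: "x \<in> Ob A" "y \<in> Ob A"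
    have "bij_betw (fa v \<circ> fa u) (hom (total A) x y)
        (hom (total C) (fo v (fo u x)) (fo v (fo u y)))"
      using that h unfolding fully_faithful_def by (intro bij_betw_trans) auto
    then show "bij_betw (fa (v \<cdot>\<^bsub>Fib E\<^esub> u)) (hom (total A) x y)
        (hom (total C) (fo (v \<cdot>\<^bsub>Fib E\<^esub> u) x) (fo (v \<cdot>\<^bsub>Fib E\<^esub> u) y))"
      using h by (subst bij_betw_cong[of _ _ "fa v \<circ> fa u"]) (auto simp: hom_def)
  qed
  have ff2: "?ff A B u" if v: "?ff B C v" and vu: "?ff A C (v \<cdot>\<^bsub>Fib E\<^esub> u)"
  proof (rule fully_faithfulI[OF u.cat_functor_axioms])
    fix f g
    assume h: "f \<in> Ar A" "g \<in> Ar A" "dm A f = dm A g"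
      "cd A f = cd A g" "fa u f = fa u g"
    show "f = g"
      by (rule fully_faithful_faithful[OF vu]) (use h in \<open>simp_all add: u.S.A.category_axioms\<close>)
  next
    fix g x y
    assume h: "g \<in> Ar B" "x \<in> Ob A" "y \<in> Ob A"
      "dm B g = fo u x" "cd B g = fo u y"
    obtain f where f: "f \<in> Ar A" "dm A f = x" "cd A f = y"
      "fa (v \<cdot>\<^bsub>Fib E\<^esub> u) f = fa v g"
      by (rule fully_faithful_full[OF vu, of "fa v g" x y]) (use h in simp_all)
    have "fa u f = g"
      by (rule fully_faithful_faithful[OF v]) (use f h in \<open>simp_all add: u.T.A.category_axioms\<close>)
    then show "\<exists>f\<in>Ar A. dm A f = x \<and> cd A f = y \<and> fa u f = g"
      using f by blast
  qed
  have es2: "?es A B u" if v: "?ff B C v" and vu: "?es A C (v \<cdot>\<^bsub>Fib E\<^esub> u)"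
    unfolding ess_surj_def
  proof
    fix b assume b: "b \<in> Ob B"
    then obtain a \<gamma> where a: "a \<in> Ob A" "iso (total C) \<gamma>"
      "dm C \<gamma> = fo (v \<cdot>\<^bsub>Fib E\<^esub> u) a" "cd C \<gamma> = fo v b"
      using vu unfolding ess_surj_def by (meson v.omap_Obj)
    obtain \<beta> where \<beta>: "\<beta> \<in> Ar B" "dm B \<beta> = fo u a" "cd B \<beta> = b"
      "fa v \<beta> = \<gamma>"
      by (rule fully_faithful_full[OF v, of \<gamma> "fo u a" b]) (use a b in simp_all)
    have "iso (total B) \<beta>"
      by (rule fully_faithful_reflects_iso[OF v.cat_functor_axioms v]) (use \<beta> a in simp_all)
    then show "\<exists>a\<in>Ob A. \<exists>\<beta>. iso (total B) \<beta> \<and> dm B \<beta> = fo u a \<and> cd B \<beta> = b"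
      using \<beta> a by blast
  qed
  have es3: "?es B C v" if vu: "?es A C (v \<cdot>\<^bsub>Fib E\<^esub> u)"
    unfolding ess_surj_def
  proof
    fix c assume "c \<in> Ob C"
    then obtain a \<gamma> where "a \<in> Ob A" "iso (total C) \<gamma>"
      "dm C \<gamma> = fo (v \<cdot>\<^bsub>Fib E\<^esub> u) a" "cd C \<gamma> = c"
      using vu unfolding ess_surj_def by blast
    then show "\<exists>a\<in>Ob B. \<exists>\<beta>. iso (total C) \<beta> \<and> dm C \<beta> = fo v a \<and> cd C \<beta> = c"
      by (intro bexI[of _ "fo u a"] exI[of _ \<gamma>]) auto
  qed
  have ff3: "?ff B C v" if u: "?ff A B u" "?es A B u" and vu: "?ff A C (v \<cdot>\<^bsub>Fib E\<^esub> u)"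
  proof (rule fully_faithfulI[OF v.cat_functor_axioms])
    \<comment> \<open>Every object of \<open>B\<close> is replaced by an isomorphic image
      \<open>u (k b)\<close>. Conjugation by \<open>\<epsilon>\<close> moves arrows of
      \<open>B\<close> between such images, where \<open>u\<close> and the composite decide.\<close>
    obtain k \<epsilon> where k: "\<And>b. b \<in> Ob B \<Longrightarrow> k b \<in> Ob A \<and> iso (total B) (\<epsilon> b) \<and>
        dm B (\<epsilon> b) = fo u (k b) \<and> cd B (\<epsilon> b) = b"
      using u(2) unfolding ess_surj_def by metis
    have conj: "\<exists>f. f \<in> Ar A \<and> dm A f = k x \<and> cd A f = k y \<and>
        g = fa v (\<epsilon> y \<cdot>\<^bsub>total B\<^esub> (fa u f \<cdot>\<^bsub>total B\<^esub> inv_arr (total B) (\<epsilon> x)))"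
      if g: "g \<in> Ar C" "x \<in> Ob B" "y \<in> Ob B" "dm C g = fo v x"
        "cd C g = fo v y" for g x y
    proof -
      let ?g = "inv_arr (total C) (fa v (\<epsilon> y)) \<cdot>\<^bsub>total C\<^esub> (g \<cdot>\<^bsub>total C\<^esub> fa v (\<epsilon> x))"
      obtain f where f: "f \<in> Ar A" "dm A f = k x" "cd A f = k y"
        "fa (v \<cdot>\<^bsub>Fib E\<^esub> u) f = ?g"
        by (rule fully_faithful_full[OF vu, of ?g "k x" "k y"]) (use g k in simp_all)
      have "g = fa v (\<epsilon> y \<cdot>\<^bsub>total B\<^esub> (fa u f \<cdot>\<^bsub>total B\<^esub> inv_arr (total B) (\<epsilon> x)))"
        using f g k by simp
      then show ?thesis using f by blast
    qed
    show "\<exists>f\<in>Ar B. dm B f = x \<and> cd B f = y \<and> fa v f = g"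
      if g: "g \<in> Ar C" "x \<in> Ob B" "y \<in> Ob B" "dm C g = fo v x"
        "cd C g = fo v y" for g x y
    proof -
      obtain f where f: "f \<in> Ar A" "dm A f = k x" "cd A f = k y"
        "g = fa v (\<epsilon> y \<cdot>\<^bsub>total B\<^esub> (fa u f \<cdot>\<^bsub>total B\<^esub> inv_arr (total B) (\<epsilon> x)))"
        using conj[OF g] by blast
      show ?thesis
        by (rule bexI[of _ "\<epsilon> y \<cdot>\<^bsub>total B\<^esub> (fa u f \<cdot>\<^bsub>total B\<^esub> inv_arr (total B) (\<epsilon> x))"])
          (use f g k in auto)
    qed
    show "f = g" if h: "f \<in> Ar B" "g \<in> Ar B" "dm B f = dm B g"
      "cd B f = cd B g" "fa v f = fa v g" for f g
    proof -
      define x y where "x = dm B g" and "y = cd B g"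
      have xy: "x \<in> Ob B" "y \<in> Ob B" using h by (auto simp: x_def y_def)
      define c where "c = (\<lambda>f. inv_arr (total B) (\<epsilon> y) \<cdot>\<^bsub>total B\<^esub> (f \<cdot>\<^bsub>total B\<^esub> \<epsilon> x))"
      have c: "c f \<in> Ar B" "dm B (c f) = fo u (k x)"
        "cd B (c f) = fo u (k y)"
        "f = \<epsilon> y \<cdot>\<^bsub>total B\<^esub> (c f \<cdot>\<^bsub>total B\<^esub> inv_arr (total B) (\<epsilon> x))"
        "fa v (c f) = fa v (inv_arr (total B) (\<epsilon> y)) \<cdot>\<^bsub>total C\<^esub> (fa v f \<cdot>\<^bsub>total C\<^esub> fa v (\<epsilon> x))"
        if "f \<in> Ar B" "dm B f = x" "cd B f = y" for f
        using that xy k unfolding c_def by simp_all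
      have fx: "dm B f = x" "cd B f = y" "dm B g = x" "cd B g = y"
        using h by (simp_all add: x_def y_def)
      obtain f' where f': "f' \<in> Ar A" "dm A f' = k x" "cd A f' = k y"
        "fa u f' = c f"
        by (rule fully_faithful_full[OF u(1), of "c f" "k x" "k y"]) (use c h fx k xy in auto)
      obtain g' where g': "g' \<in> Ar A" "dm A g' = k x" "cd A g' = k y"
        "fa u g' = c g"
        by (rule fully_faithful_full[OF u(1), of "c g" "k x" "k y"]) (use c h fx k xy in auto)
      have "f' = g'"
        by (rule fully_faithful_faithful[OF vu])
          (use f' g' c(5)[OF h(1) fx(1,2)] c(5)[OF h(2) fx(3,4)] h(5) in \<open>simp_all add: u.S.A.category_axioms\<close>)
      then have "c f = c g" using f' g' by simp
      then show "f = g" using c(4)[OF h(1) fx(1,2)] c(4)[OF h(2) fx(3,4)] by metis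
    qed
  qed
  show "(u \<in> E_equivalences E \<and> v \<in> E_equivalences E \<longrightarrow> v \<cdot>\<^bsub>Fib E\<^esub> u \<in> E_equivalences E) \<and>
      (u \<in> E_equivalences E \<and> v \<cdot>\<^bsub>Fib E\<^esub> u \<in> E_equivalences E \<longrightarrow> v \<in> E_equivalences E) \<and>
      (v \<in> E_equivalences E \<and> v \<cdot>\<^bsub>Fib E\<^esub> u \<in> E_equivalences E \<longrightarrow> u \<in> E_equivalences E)"
    unfolding u.E_equivalences_iff v.E_equivalences_iff vu.E_equivalences_iff
    using ff1 ff2 ff3 es2 es3 ess_surj_Comp[OF u.fib_arrow_axioms v.fib_arrow_axioms] by blast
qed

lemma
  assumes "fib_arrow E A B u" "fib_arrow E B C v"
  shows E_equivalences_Comp: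
      "u \<in> E_equivalences E \<Longrightarrow> v \<in> E_equivalences E \<Longrightarrow> v \<cdot>\<^bsub>Fib E\<^esub> u \<in> E_equivalences E"
    and E_equivalences_left_cancel:
      "v \<in> E_equivalences E \<Longrightarrow> v \<cdot>\<^bsub>Fib E\<^esub> u \<in> E_equivalences E \<Longrightarrow> u \<in> E_equivalences E"
proof -
  interpret u: fib_arrow E A B u by fact
  interpret v: fib_arrow E B C v by fact
  have "u \<in> Arr (Fib E)" "v \<in> Arr (Fib E)" "Cod (Fib E) u = Dom (Fib E) v"
    using u.arrow v.arrow by simp_all
  note * = two_out_of_three_E_equivalences[OF u.base, unfolded two_out_of_three_def, rule_format, OF this]
  show "u \<in> E_equivalences E \<Longrightarrow> v \<in> E_equivalences E \<Longrightarrow> v \<cdot>\<^bsub>Fib E\<^esub> u \<in> E_equivalences E"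
    "v \<in> E_equivalences E \<Longrightarrow> v \<cdot>\<^bsub>Fib E\<^esub> u \<in> E_equivalences E \<Longrightarrow> u \<in> E_equivalences E"
    using * by blast+
qed

section \<open>Coding pairs and tags in the universe\<close>

definition upair :: "'u \<Rightarrow> 'u \<Rightarrow> 'u" where
  "upair = (SOME f. \<forall>a b c d. f a b = f c d \<longrightarrow> a = c \<and> b = d)"

definition ufst :: "'u \<Rightarrow> 'u" where "ufst p = (SOME a. \<exists>b. p = upair a b)"

definition usnd :: "'u \<Rightarrow> 'u" where "usnd p = (SOME b. \<exists>a. p = upair a b)"

definition utag :: "bool \<Rightarrow> 'u" where "utag = (SOME f. f True \<noteq> f False)"

locale infinite_base =
  fixes E :: "('u, 'u) cat"
  assumes infinite: "infinite (UNIV :: 'u set)"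
    and base: "category E"
begin

text \<open>An infinite type has the cardinality of its square, so the choice in
  \<open>upair\<close> has a witness.\<close>

lemma upair_inject [simp]: "upair (a :: 'u) b = upair c d \<longleftrightarrow> a = c \<and> b = d"
proof -
  have "(card_of (UNIV \<times> UNIV :: ('u \<times> 'u) set), card_of (UNIV :: 'u set)) \<in> ordLeq"
    using card_of_Times_same_infinite[OF infinite] by (rule ordIso_imp_ordLeq)
  then obtain f :: "'u \<times> 'u \<Rightarrow> 'u" where "inj f"
    by (auto simp flip: card_of_ordLeq)
  then have "\<forall>a b c d. f (a, b) = f (c, d) \<longrightarrow> a = c \<and> b = d" by (auto dest: injD)
  then have "\<forall>a b c d :: 'u. upair a b = upair c d \<longrightarrow> a = c \<and> b = d"
    unfolding upair_def by (intro someI_ex[where P = "\<lambda>f. \<forall>a b c d. f a b = f c d \<longrightarrow> a = c \<and> b = d"])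
      (intro exI[of _ "\<lambda>a b. f (a, b)"])
  then show ?thesis by blast
qed

lemma ufst_upair [simp]: "ufst (upair (a :: 'u) b) = a"
  by (simp add: ufst_def)

lemma usnd_upair [simp]: "usnd (upair (a :: 'u) b) = b"
  by (simp add: usnd_def)

lemma utag_inject [simp]: "(utag s :: 'u) = utag t \<longleftrightarrow> s = t"
proof -
  obtain a b :: 'u where "a \<noteq> b"
    using infinite by (metis finite.emptyI finite.insertI finite_subset insertCI subsetI)
  then have "(utag True :: 'u) \<noteq> utag False"
    unfolding utag_def by (intro someI_ex[where P = "\<lambda>f. f True \<noteq> f False"] exI[of _ "\<lambda>s. if s then a else b"]) simp
  then show ?thesis by (cases s; cases t) auto
qed

end

section \<open>Reindexing objects\<close>

text \<open>The pullback of \<open>T\<close> along a map \<open>h\<close> from a set of new objects.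
  An arrow records both of its ends because \<open>h\<close> may identify objects and the underlying
  arrow then no longer determines them.\<close>

definition reindex_cat :: "('u, 'u) cat \<Rightarrow> 'u set \<Rightarrow> ('u \<Rightarrow> 'u) \<Rightarrow> ('u, 'u) cat" where
  "reindex_cat T S h =
     \<lparr>Obj = S,
      Arr = {upair x (upair \<alpha> y) | x \<alpha> y. x \<in> S \<and> y \<in> S \<and> \<alpha> \<in> hom T (h x) (h y)},
      Dom = ufst, Cod = (\<lambda>f. usnd (usnd f)), Ident = (\<lambda>x. upair x (upair (Ident T (h x)) x)),
      Comp = (\<lambda>g f. upair (ufst f) (upair (ufst (usnd g) \<cdot>\<^bsub>T\<^esub> ufst (usnd f)) (usnd (usnd g))))\<rparr>"

definition reindex_fctr :: "('u \<Rightarrow> 'u) \<Rightarrow> ('u, 'u, 'u, 'u) fctr" where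
  "reindex_fctr h = \<lparr>omap = h, amap = (\<lambda>f. ufst (usnd f))\<rparr>"

definition reindex :: "'u fibred_cat \<Rightarrow> 'u set \<Rightarrow> ('u \<Rightarrow> 'u) \<Rightarrow> 'u fibred_cat" where
  "reindex P S h = mk_fib (reindex_cat (total P) S h)
     \<lparr>omap = (\<lambda>x. po P (h x)), amap = (\<lambda>f. pa P (ufst (usnd f)))\<rparr>"

definition reindex_map :: "'u fibred_cat \<Rightarrow> 'u set \<Rightarrow> ('u \<Rightarrow> 'u) \<Rightarrow> 'u fib_map" where
  "reindex_map P S h = mk_map (reindex P S h) P (reindex_fctr h)"

definition reindex_lift :: "'u fibred_cat \<Rightarrow> 'u fibred_cat \<Rightarrow> 'u set \<Rightarrow> ('u \<Rightarrow> 'u) \<Rightarrow> 'u fib_map \<Rightarrow>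
    ('u \<Rightarrow> 'u) \<Rightarrow> 'u fib_map" where
  "reindex_lift A P S h v m = mk_map A (reindex P S h) \<lparr>omap = m,
     amap = (\<lambda>f. upair (m (dm A f)) (upair (fa v f) (m (cd A f))))\<rparr>"

context infinite_base
begin

lemma reindex_cat_simps [simp]:
  fixes T :: "('u, 'u) cat"
  shows "Obj (reindex_cat T S h) = S"
  "upair x (upair \<alpha> y) \<in> Arr (reindex_cat T S h) \<longleftrightarrow>
    x \<in> S \<and> y \<in> S \<and> \<alpha> \<in> Arr T \<and> Dom T \<alpha> = h x \<and> Cod T \<alpha> = h y"
  "Dom (reindex_cat T S h) (upair x z) = x"
  "Cod (reindex_cat T S h) (upair x (upair \<alpha> y)) = y"
  "Ident (reindex_cat T S h) x = upair x (upair (Ident T (h x)) x)"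
  "upair y' (upair \<beta> z) \<cdot>\<^bsub>reindex_cat T S h\<^esub> upair x (upair \<alpha> y) = upair x (upair (\<beta> \<cdot>\<^bsub>T\<^esub> \<alpha>) z)"
  by (auto simp: reindex_cat_def hom_def)

lemma reindex_cat_Arr:
  fixes T :: "('u, 'u) cat"
  assumes "f \<in> Arr (reindex_cat T S h)"
  obtains x \<alpha> y where "f = upair x (upair \<alpha> y)" "x \<in> S" "y \<in> S" "\<alpha> \<in> Arr T" "Dom T \<alpha> = h x" "Cod T \<alpha> = h y"
  using assms by (auto simp: reindex_cat_def hom_def)

lemma reindex_fctr_simps [simp]:
  "omap (reindex_fctr h) x = h x"
  "amap (reindex_fctr h) (upair (x :: 'u) (upair \<alpha> y)) = \<alpha>"
  by (auto simp: reindex_fctr_def)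

lemma reindex_simps [simp]:
  "total (reindex P S h) = norm_cat (reindex_cat (total P) S h)"
  by (simp add: reindex_def)

lemma category_reindex_cat:
  fixes T :: "('u, 'u) cat"
  assumes "category T" "\<And>x. x \<in> S \<Longrightarrow> h x \<in> Obj T"
  shows "category (reindex_cat T S h)"
proof -
  interpret category T by fact
  show ?thesis by (rule categoryI) (use assms(2) in \<open>auto elim!: reindex_cat_Arr\<close>)
qed

text \<open>All three claims rest on the surjectivity of \<open>h\<close>: the domain of a cartesian
  lift and the codomain of an isomorphism of \<open>P\<close> have names in \<open>S\<close>, so
  arrows of \<open>P\<close> become arrows of the reindexed category once their ends are
  named.\<close>

lemma
  fixes P :: "'u fibred_cat"
  assumes "fibred_category E P" "h ` S = Ob P"
  shows reindex_map_arrow: "fib_arrow E (reindex P S h) P (reindex_map P S h)"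
    and reindex_map_equivalence: "reindex_map P S h \<in> E_equivalences E"
    and reindex_map_isofibration: "reindex_map P S h \<in> E_isofibrations E"
proof -
  interpret P: fibred E P by (rule fibred.intro) (use assms base in auto)
  have h [simp]: "h x \<in> Ob P" if "x \<in> S" for x using assms that by auto
  let ?T = "reindex_cat (total P) S h"
  let ?p = "\<lparr>omap = (\<lambda>x. po P (h x)), amap = (\<lambda>f. pa P (ufst (usnd f)))\<rparr>"
  have T: "category ?T" by (rule category_reindex_cat) (use h in \<open>auto simp: P.A.category_axioms\<close>)
  have u: "cat_functor ?T (total P) (reindex_fctr h)"
    by (rule cat_functorI) (auto simp: T P.A.category_axioms elim!: reindex_cat_Arr)
  have p: "cat_functor ?T E ?p"
    by (rule cat_functorI) (auto simp: T base elim!: reindex_cat_Arr)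
  have o: "over ?T ?p (reindex_fctr h) (proj P)"
    by (auto simp: over_def elim!: reindex_cat_Arr)
  have ff: "fully_faithful ?T (total P) (reindex_fctr h)"
  proof (rule fully_faithfulI[OF u])
    fix g x y assume "g \<in> Ar P" "x \<in> Obj ?T" "y \<in> Obj ?T"
      "dm P g = omap (reindex_fctr h) x" "cd P g = omap (reindex_fctr h) y"
    then show "\<exists>f\<in>Arr ?T. Dom ?T f = x \<and> Cod ?T f = y \<and> amap (reindex_fctr h) f = g"
      by (intro bexI[of _ "upair x (upair g y)"]) auto
  qed (auto elim!: reindex_cat_Arr)
  have lifts: "\<exists>\<phi>. cartesian ?T E ?p \<phi> \<and> Cod ?T \<phi> = y \<and> amap ?p \<phi> = f \<and>
      cart E P (amap (reindex_fctr h) \<phi>)"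
    if y: "y \<in> S" "f \<in> Arr E" "Cod E f = po P (h y)" for y f
  proof -
    obtain \<phi> where \<phi>: "cart E P \<phi>" "cd P \<phi> = h y" "pa P \<phi> = f"
      by (rule P.cartesian_over[of "h y" f]) (use y in auto)
    \<comment> \<open>The lift taken in \<open>P\<close> needs a domain in \<open>S\<close>.\<close>
    have "dm P \<phi> \<in> h ` S" unfolding assms(2) using \<phi> by simp
    then obtain x where x: "x \<in> S" "dm P \<phi> = h x" by auto
    have "cartesian ?T E ?p (upair x (upair \<phi> y))"
      by (rule fully_faithful_reflects_cartesian[OF p P.cat_functor_axioms u o ff])
        (use \<phi> x y in auto)
    then show ?thesis using \<phi> by (intro exI[of _ "upair x (upair \<phi> y)"]) simp
  qed
  have fib: "fibred_category E (reindex P S h)"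
    unfolding reindex_def by (rule mk_fib_fibred[OF p]) (use lifts in fastforce)
  have u': "cat_functor (norm_cat ?T) (total P) (reindex_fctr h)" by (rule cat_functor_norm(2)[OF u])
  have "reindex_map P S h \<in> Arr (Fib E)"
    unfolding reindex_map_def
  proof (rule mk_map_Arr_lifts)
    show "over (total (reindex P S h)) (proj (reindex P S h)) (reindex_fctr h) (proj P)"
      using o by (simp add: over_def reindex_def)
    fix y f assume yf: "y \<in> Ob (reindex P S h)" "f \<in> Arr E" "Cod E f = po (reindex P S h) y"
    then obtain \<phi> where "cartesian ?T E ?p \<phi>" "Cod ?T \<phi> = y" "amap ?p \<phi> = f"
      "cart E P (amap (reindex_fctr h) \<phi>)"
      using lifts[of y f] by (auto simp: reindex_def)
    moreover from this have "\<phi> \<in> Arr ?T" by (simp add: cartesian_def)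
    ultimately show "\<exists>\<phi>. cart E (reindex P S h) \<phi> \<and>
        cd (reindex P S h) \<phi> = y \<and> pa (reindex P S h) \<phi> = f \<and>
        cart E P (amap (reindex_fctr h) \<phi>)"
      by (intro exI[of _ \<phi>]) (simp add: reindex_def p)
  qed (use base fib assms u' in auto)
  then show a: "fib_arrow E (reindex P S h) P (reindex_map P S h)"
    using base by (intro fib_arrow.intro) (simp_all add: reindex_map_def)
  then interpret q: fib_arrow E "reindex P S h" P "reindex_map P S h" .
  have o: "fo (reindex_map P S h) x = h x" if "x \<in> S" for x
    using that by (simp add: reindex_map_def)
  have m: "fa (reindex_map P S h) f = amap (reindex_fctr h) f" if "f \<in> Arr ?T" for f
    using that by (simp add: reindex_map_def)
  have "fully_faithful (total (reindex P S h)) (total P) (fun_of (reindex_map P S h))"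
    unfolding fully_faithful_def
  proof (intro ballI)
    fix x y assume h: "x \<in> Ob (reindex P S h)" "y \<in> Ob (reindex P S h)"
    then have "bij_betw (fa (reindex_map P S h)) (hom ?T x y) (hom (total P) (h x) (h y))"
      using ff unfolding fully_faithful_def
      by (subst bij_betw_cong[of _ _ "amap (reindex_fctr h)"]) (auto simp: hom_def m)
    then show "bij_betw (fa (reindex_map P S h)) (hom (total (reindex P S h)) x y)
        (hom (total P) (fo (reindex_map P S h) x) (fo (reindex_map P S h) y))"
      using h by (simp add: o)
  qed
  moreover have "ess_surj (total (reindex P S h)) (total P) (fun_of (reindex_map P S h))"
    unfolding ess_surj_def
  proof
    fix b assume b: "b \<in> Ob P"
    then obtain x where "x \<in> S" "b = h x" using assms(2) by auto
    then show "\<exists>a\<in>Ob (reindex P S h). \<exists>\<beta>. iso (total P) \<beta> \<and>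
        dm P \<beta> = fo (reindex_map P S h) a \<and> cd P \<beta> = b"
      using b by (intro bexI[of _ x] exI[of _ "idt P b"]) (auto simp: o)
  qed
  ultimately show "reindex_map P S h \<in> E_equivalences E" by (simp add: q.E_equivalences_iff)
  show "reindex_map P S h \<in> E_isofibrations E"
    unfolding q.E_isofibrations_iff
  proof (intro ballI allI impI)
    fix x \<beta> assume h: "x \<in> Ob (reindex P S h)" "iso (total P) \<beta>"
      "dm P \<beta> = fo (reindex_map P S h) x"
    have "cd P \<beta> \<in> h ` S" unfolding assms(2) using h by simp
    then obtain y where y: "y \<in> S" "cd P \<beta> = h y" by auto
    have "iso ?T (upair x (upair \<beta> y))"
      by (rule fully_faithful_reflects_iso[OF u ff]) (use h y in \<open>simp_all add: o\<close>)
    then show "\<exists>\<alpha>. iso (total (reindex P S h)) \<alpha> \<and> dm (reindex P S h) \<alpha> = x \<and>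
        fa (reindex_map P S h) \<alpha> = \<beta>"
      using h y by (intro exI[of _ "upair x (upair \<beta> y)"]) (simp add: T o m)
  qed
qed

text \<open>Once \<open>m\<close> names the objects, full faithfulness of \<open>reindex_map\<close>
  forces the arrow part and reflects cartesian arrows. Injectivity of \<open>m\<close> becomes
  injectivity on objects of the lift.\<close>

lemma
  fixes P A :: "'u fibred_cat"
  assumes "fibred_category E P" "h ` S = Ob P" "fib_arrow E A P v"
    and m: "\<And>a. a \<in> Ob A \<Longrightarrow> m a \<in> S \<and> h (m a) = fo v a"
  shows reindex_lift_arrow: "fib_arrow E A (reindex P S h) (reindex_lift A P S h v m)"
    and reindex_map_lift: "reindex_map P S h \<cdot>\<^bsub>Fib E\<^esub> reindex_lift A P S h v m = v"
    and reindex_lift_omap: "\<And>a. a \<in> Ob A \<Longrightarrow> fo (reindex_lift A P S h v m) a = m a"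
    and reindex_lift_amap: "\<And>f. f \<in> Ar A \<Longrightarrow> fa (reindex_lift A P S h v m) f =
      upair (m (dm A f)) (upair (fa v f) (m (cd A f)))"
proof -
  interpret v: fib_arrow E A P v by fact
  interpret q: fib_arrow E "reindex P S h" P "reindex_map P S h"
    by (rule reindex_map_arrow[OF assms(1,2)])
  have ff: "fully_faithful (total (reindex P S h)) (total P) (fun_of (reindex_map P S h))"
    using reindex_map_equivalence[OF assms(1,2)] unfolding q.E_equivalences_iff by simp
  note m [simp]
  let ?G = "\<lparr>omap = m,
     amap = (\<lambda>f. upair (m (dm A f)) (upair (fa v f) (m (cd A f))))\<rparr>"
  have f: "cat_functor (total A) (total (reindex P S h)) ?G"
    by (rule cat_functorI) (auto simp: v.S.A.category_axioms q.S.A.category_axioms simp del: reindex_simps, auto)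
  have q: "fa (reindex_map P S h) (amap ?G f) = fa v f" if "f \<in> Ar A" for f
    using that by (simp add: reindex_map_def)
  have "reindex_lift A P S h v m \<in> Arr (Fib E)"
    unfolding reindex_lift_def
  proof (rule mk_map_Arr)
    show "over (total A) (proj A) ?G (proj (reindex P S h))"
      by (auto simp: over_def reindex_def)
    fix \<phi> assume "cart E A \<phi>"
    then show "cart E (reindex P S h) (amap ?G \<phi>)"
      by (intro fully_faithful_reflects_cartesian[OF q.S.cat_functor_axioms v.T.cat_functor_axioms
            q.cat_functor_axioms q.over_base ff]) (simp_all only: q v.S.cartesian_Arr v.amap_cartesian, simp)
  qed (use f base v.S.fib q.S.fib in auto)
  then show a: "fib_arrow E A (reindex P S h) (reindex_lift A P S h v m)"
    by (intro fib_arrow.intro) (simp_all add: base reindex_lift_def)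
  show o: "\<And>a. a \<in> Ob A \<Longrightarrow> fo (reindex_lift A P S h v m) a = m a"
    and m: "\<And>f. f \<in> Ar A \<Longrightarrow> fa (reindex_lift A P S h v m) f =
      upair (m (dm A f)) (upair (fa v f) (m (cd A f)))"
    by (simp_all add: reindex_lift_def)
  show "reindex_map P S h \<cdot>\<^bsub>Fib E\<^esub> reindex_lift A P S h v m = v"
    by (rule fib_map_eqI[OF fib_arrow_Comp[OF a q.fib_arrow_axioms] assms(3)])
      (simp add: reindex_lift_def reindex_map_def)
qed

section \<open>Factorizations\<close>

text \<open>The analogue of a mapping cylinder: the tags make the copy of \<open>A\<close> embed
  without identifications, and the copy of \<open>B\<close> makes \<open>h\<close>
  surjective.\<close>

lemma factorization_cof_trivial_fib:
  assumes "f \<in> Arr (Fib E)"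
  shows "\<exists>i \<in> E_injections E. \<exists>p \<in> E_isofibrations E \<inter> E_equivalences E.
    Cod (Fib E) i = Dom (Fib E) p \<and> f = p \<cdot>\<^bsub>Fib E\<^esub> i"
proof -
  obtain A B where "fib_arrow E A B f" using assms base by (auto elim: fib_arrow_Arr)
  then interpret f: fib_arrow E A B f .
  define S where "S = upair (utag True) ` Ob A \<union> upair (utag False) ` Ob B"
  define h where "h = (\<lambda>z :: 'u. if ufst z = utag True then fo f (usnd z) else usnd z)"
  have hS: "h ` S = Ob B"
  proof
    show "Ob B \<subseteq> h ` S"
    proof
      fix b assume "b \<in> Ob B"
      then show "b \<in> h ` S"
        by (intro image_eqI[of _ _ "upair (utag False) b"]) (auto simp: h_def S_def)
    qed
  qed (auto simp: S_def h_def)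
  have m: "upair (utag True) a \<in> S \<and> h (upair (utag True) a) = fo f a" if "a \<in> Ob A" for a
    using that by (auto simp: S_def h_def)
  let ?i = "reindex_lift A B S h f (upair (utag True))"
  interpret i: fib_arrow E A "reindex B S h" ?i
    by (rule reindex_lift_arrow[OF f.T.fib hS f.fib_arrow_axioms m])
  interpret p: fib_arrow E "reindex B S h" B "reindex_map B S h"
    by (rule reindex_map_arrow[OF f.T.fib hS])
  have "?i \<in> E_injections E"
    unfolding i.E_injections_iff
    by (rule inj_onI) (simp add: reindex_lift_omap[OF f.T.fib hS f.fib_arrow_axioms m])
  then show ?thesis
    using reindex_map_equivalence[OF f.T.fib hS] reindex_map_isofibration[OF f.T.fib hS]
      reindex_map_lift[OF f.T.fib hS f.fib_arrow_axioms m]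
    by (intro bexI[of _ ?i] bexI[of _ "reindex_map B S h"]) simp_all
qed

text \<open>
  The middle object consists of the vertical isomorphisms \<open>f a \<rightarrow> b\<close>.  Because they are vertical,
  forgetting \<open>b\<close> is a functor over the base.
\<close>

lemma factorization_trivial_cof_fib:
  assumes "f \<in> Arr (Fib E)"
  shows "\<exists>i \<in> E_injections E \<inter> E_equivalences E. \<exists>p \<in> E_isofibrations E.
    Cod (Fib E) i = Dom (Fib E) p \<and> f = p \<cdot>\<^bsub>Fib E\<^esub> i"
proof -
  obtain A B where "fib_arrow E A B f" using assms base by (auto elim: fib_arrow_Arr)
  then interpret f: fib_arrow E A B f .
  define S where "S = {upair a \<beta> | a \<beta>. a \<in> Ob A \<and> iso (total B) \<beta> \<and>
    dm B \<beta> = fo f a \<and> pa B \<beta> = Ident E (po A a)}"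
  have S_iff [simp]: "upair a \<beta> \<in> S \<longleftrightarrow> a \<in> Ob A \<and> iso (total B) \<beta> \<and>
    dm B \<beta> = fo f a \<and> pa B \<beta> = Ident E (po A a)" for a \<beta>
    by (auto simp: S_def)
  have S_cases: "\<exists>a \<beta>. x = upair a \<beta>" if "x \<in> S" for x using that by (auto simp: S_def)
  let ?R = "reindex A S ufst" and ?T = "reindex_cat (total A) S ufst"
  \<comment> \<open>The object \<open>a\<close> is paired with the identity of its image under
    \<open>f\<close>; the first component recovers \<open>a\<close>, whence injectivity.\<close>
  define m where "m = (\<lambda>a. upair a (idt B (fo f a)))"
  have hS: "ufst ` S = Ob A"
  proof
    show "Ob A \<subseteq> ufst ` S"
    proof
      fix a assume "a \<in> Ob A"
      then show "a \<in> ufst ` S" by (intro image_eqI[of _ _ "m a"]) (auto simp: m_def)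
    qed
  qed (auto simp: S_def)
  obtain I where I: "I = Ident (Fib E) A" by blast
  have ident: "fib_arrow E A A I" unfolding I by (rule fib_arrow_Ident[OF base f.S.fib])
  have [simp]: "x \<in> Ob A \<Longrightarrow> fo I x = x" "g \<in> Ar A \<Longrightarrow> fa I g = g"
    for x g by (simp_all add: I)
  have m: "m a \<in> S \<and> ufst (m a) = fo I a" if "a \<in> Ob A" for a
    using that by (auto simp: m_def)
  let ?i = "reindex_lift A A S ufst I m"
  interpret i: fib_arrow E A ?R ?i by (rule reindex_lift_arrow[OF f.S.fib hS ident m])
  interpret q: fib_arrow E ?R A "reindex_map A S ufst" by (rule reindex_map_arrow[OF f.S.fib hS])
  have "?i \<in> E_injections E"
    unfolding i.E_injections_iff
    by (rule inj_onI) (metis ufst_upair m_def reindex_lift_omap[OF f.S.fib hS ident m])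
  have qi: "reindex_map A S ufst \<cdot>\<^bsub>Fib E\<^esub> ?i = I"
    by (rule reindex_map_lift[OF f.S.fib hS ident m])
  have "I \<in> E_equivalences E"
  proof -
    interpret fib_arrow E A A "I" by (rule ident)
    have "fully_faithful (total A) (total A) (fun_of I)"
      by (rule fully_faithfulI[OF cat_functor_axioms]) auto
    moreover have "ess_surj (total A) (total A) (fun_of I)"
      unfolding ess_surj_def
    proof
      fix b assume "b \<in> Ob A"
      then show "\<exists>a\<in>Ob A. \<exists>\<beta>. iso (total A) \<beta> \<and> dm A \<beta> = fo I a \<and> cd A \<beta> = b"
        by (intro bexI[of _ b] exI[of _ "idt A b"]) auto
    qed
    ultimately show ?thesis by (simp only: E_equivalences_iff)
  qed
  \<comment> \<open>The lift \<open>?i\<close> is a section of the equivalence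
    \<open>reindex_map\<close>, so two out of three applies.\<close>
  then have "?i \<in> E_equivalences E"
    using E_equivalences_left_cancel[OF i.fib_arrow_axioms q.fib_arrow_axioms
        reindex_map_equivalence[OF f.S.fib hS]] qi by simp
  \<comment> \<open>The other projection: an object \<open>f a \<rightarrow> b\<close> goes to
    \<open>b\<close>, and an arrow \<open>\<alpha>\<close> goes to its image under \<open>f\<close>
    transported along the two isomorphisms.\<close>
  define G where "G = \<lparr>omap = \<lambda>x. cd B (usnd x), amap = \<lambda>z. usnd (usnd (usnd z)) \<cdot>\<^bsub>total B\<^esub>
    (fa f (ufst (usnd z)) \<cdot>\<^bsub>total B\<^esub> inv_arr (total B) (usnd (ufst z)))\<rparr>"
  have G [simp]: "omap G (upair a \<beta>) = cd B \<beta>"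
    "amap G (upair (upair a \<beta>) (upair \<alpha> (upair a' \<beta>'))) =
      \<beta>' \<cdot>\<^bsub>total B\<^esub> (fa f \<alpha> \<cdot>\<^bsub>total B\<^esub> inv_arr (total B) \<beta>)" for a \<beta> \<alpha> a' \<beta>'
    by (simp_all add: G_def)
  have T_cases: thesis if z: "z \<in> Arr ?T" and goal: "\<And>a \<beta> \<alpha> a' \<beta>'. z = upair (upair a \<beta>) (upair \<alpha> (upair a' \<beta>')) \<Longrightarrow>
    upair a \<beta> \<in> S \<Longrightarrow> upair a' \<beta>' \<in> S \<Longrightarrow> \<alpha> \<in> Ar A \<Longrightarrow> dm A \<alpha> = a \<Longrightarrow> cd A \<alpha> = a' \<Longrightarrow>
    thesis" for z thesis
  proof -
    obtain x \<alpha> y where z: "z = upair x (upair \<alpha> y)" "x \<in> S" "y \<in> S" "\<alpha> \<in> Ar A"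
      "dm A \<alpha> = ufst x" "cd A \<alpha> = ufst y" using z by (rule reindex_cat_Arr)
    obtain a \<beta> a' \<beta>' where "x = upair a \<beta>" "y = upair a' \<beta>'" using S_cases z by meson
    then show thesis using z by (intro goal[of a \<beta> \<alpha> a' \<beta>']) simp_all
  qed
  have "cat_functor ?T (total B) G"
    by (rule cat_functorI)
      (use S_cases in \<open>force simp: f.T.A.category_axioms intro!: category_reindex_cat f.S.A.category_axioms elim!: T_cases\<close>)+
  then have f': "cat_functor (total ?R) (total B) G" by (simp add: cat_functor_norm)
  then interpret G: cat_functor "total ?R" "total B" G .
  let ?p = "mk_map ?R B G"
  have "?p \<in> Arr (Fib E)"
  proof (rule mk_map_Arr)
    show "over (total ?R) (proj ?R) G (proj B)"
      unfolding over_def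
    proof
      fix z assume "z \<in> Ar ?R"
      then have "z \<in> Arr ?T" by simp
      then show "pa B (amap G z) = pa ?R z"
        by (elim T_cases) (simp add: reindex_def)
    qed
    fix \<phi> assume c: "cart E ?R \<phi>"
    \<comment> \<open>The component of \<open>\<phi>\<close> in \<open>A\<close> is cartesian, and
      the value of \<open>G\<close> is its image under \<open>f\<close> composed with
      isomorphisms.\<close>
    have "\<phi> \<in> Arr ?T" using i.T.cartesian_Arr[OF c] by simp
    then show "cart E B (amap G \<phi>)"
      using q.amap_cartesian[OF c] by (elim T_cases) (simp add: reindex_map_def)
  qed (use base f.T.fib i.T.fib f' in auto)
  then have p: "fib_arrow E ?R B ?p" by (intro fib_arrow.intro) (simp_all add: base)
  then interpret p: fib_arrow E ?R B ?p .
  have "?p \<in> E_isofibrations E"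
    unfolding p.E_isofibrations_iff
  proof (intro ballI allI impI)
    fix x \<gamma> assume h: "x \<in> Ob ?R" "iso (total B) \<gamma>" "dm B \<gamma> = fo ?p x"
    then have "x \<in> S" by simp
    then obtain a \<beta> where x: "x = upair a \<beta>" using S_cases by blast
    have a: "a \<in> Ob A" "iso (total B) \<beta>" "dm B \<beta> = fo f a"
      "pa B \<beta> = Ident E (po A a)" "dm B \<gamma> = cd B \<beta>"
      using h by (auto simp: x)
    have pb: "po B (cd B \<beta>) = po A a"
      using f.T.amap_Arr(3)[of \<beta>] a by simp
    \<comment> \<open>Composing \<open>\<beta>\<close> with \<open>\<gamma>\<close> alone would
      leave the vertical isomorphisms. Therefore \<open>a\<close> is moved as well, along an
      isomorphism \<open>\<alpha>\<close> of \<open>A\<close> over the same base arrow as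
      \<open>\<gamma>\<close>, obtained by inverting a cartesian lift.\<close>
    obtain \<phi> where \<phi>: "cart E A \<phi>" "cd A \<phi> = a"
      "pa A \<phi> = inv_arr E (pa B \<gamma>)"
      by (rule f.S.cartesian_over[of a "inv_arr E (pa B \<gamma>)"]) (use h a pb in auto)
    have \<phi>i: "iso (total A) \<phi>" by (rule f.S.cartesian_over_iso[OF \<phi>(1)]) (use \<phi> h in simp)
    define \<alpha> where "\<alpha> = inv_arr (total A) \<phi>"
    have \<alpha>: "iso (total A) \<alpha>" "dm A \<alpha> = a" "pa A \<alpha> = pa B \<gamma>"
      using \<phi> \<phi>i h by (simp_all add: \<alpha>_def)
    \<comment> \<open>The base arrows of \<open>\<gamma>\<close> and \<open>\<alpha>\<close> cancel
      here, so the result is vertical again.\<close>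
    define \<beta>' where "\<beta>' = \<gamma> \<cdot>\<^bsub>total B\<^esub> (\<beta> \<cdot>\<^bsub>total B\<^esub> inv_arr (total B) (fa f \<alpha>))"
    have \<beta>': "iso (total B) \<beta>'" "dm B \<beta>' = fo f (cd A \<alpha>)"
      using \<alpha> h a by (auto simp: \<beta>'_def)
    have c: "po A (cd A \<alpha>) = po B (cd B \<gamma>)"
      using f.S.amap_Arr(3)[of \<alpha>] f.T.amap_Arr(3)[of \<gamma>] \<alpha> h by simp
    have "pa B \<beta>' = Ident E (po A (cd A \<alpha>))"
      using \<alpha> h a pb c by (simp add: \<beta>'_def)
    then have y: "upair (cd A \<alpha>) \<beta>' \<in> S" using \<alpha> \<beta>' by simp
    let ?z = "upair x (upair \<alpha> (upair (cd A \<alpha>) \<beta>'))"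
    have z: "?z \<in> Arr ?T" using \<alpha> y h x by simp
    have ff: "fully_faithful (total ?R) (total A) (fun_of (reindex_map A S ufst))"
      using reindex_map_equivalence[OF f.S.fib hS] unfolding q.E_equivalences_iff by simp
    have "iso (total ?R) ?z"
      by (rule fully_faithful_reflects_iso[OF q.cat_functor_axioms ff])
        (use z \<alpha> in \<open>simp_all add: reindex_map_def\<close>)
    moreover have "fa ?p ?z = \<gamma>"
      using z \<alpha> \<beta>' a h by (simp add: x) (simp add: \<beta>'_def)
    ultimately show "\<exists>\<alpha>. iso (total ?R) \<alpha> \<and> dm ?R \<alpha> = x \<and> fa ?p \<alpha> = \<gamma>"
      using z by (intro exI[of _ ?z]) simp
  qed
  moreover have "f = ?p \<cdot>\<^bsub>Fib E\<^esub> ?i"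
    by (rule fib_map_eqI[OF f.fib_arrow_axioms fib_arrow_Comp[OF i.fib_arrow_axioms p]])
      (use m in \<open>simp add: reindex_lift_amap[OF f.S.fib hS ident m]\<close>, simp add: m_def)
  ultimately show ?thesis
    using \<open>?i \<in> E_injections E\<close> \<open>?i \<in> E_equivalences E\<close>
    by (intro bexI[of _ ?i] bexI[of _ ?p]) simp_all
qed

end

section \<open>Initial and terminal objects\<close>

context infinite_base
begin

text \<open>Over the identity functor every arrow is cartesian: lifts are given by the base arrow
  itself.\<close>

lemma terminal_fibred: "fibred_category E (mk_fib E (id_fctr E))"
proof (rule mk_fib_fibred)
  interpret E: category E by (rule base)
  show f: "cat_functor E E (id_fctr E)" by (rule cat_functorI) (auto simp: base)
  interpret I: cat_functor E E "id_fctr E" by (rule f)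
  fix y f assume "y \<in> Obj E" "f \<in> Arr E" "Cod E f = omap (id_fctr E) y"
  moreover from this have "cartesian E E (id_fctr E) f" by (intro I.cartesianI) auto
  ultimately show "\<exists>\<phi>. cartesian E E (id_fctr E) \<phi> \<and> Cod E \<phi> = y \<and> amap (id_fctr E) \<phi> = f" by auto
qed

lemma has_terminal_Fib: "has_terminal (Fib E)"
  unfolding has_terminal_def
proof (intro bexI[of _ "mk_fib E (id_fctr E)"] ballI)
  interpret E: category E by (rule base)
  let ?T = "mk_fib E (id_fctr E)"
  interpret T: fibred E ?T by (rule fibred.intro[OF base terminal_fibred])
  show "?T \<in> Obj (Fib E)" using T.fib by simp
  fix P assume "P \<in> Obj (Fib E)"
  then interpret P: fibred E P by (intro fibred.intro) (simp_all add: base)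
  have c: "cart E ?T f" if "f \<in> Arr E" for f
    by (rule T.cartesianI) (use that in auto)
  have "mk_map P ?T (proj P) \<in> Arr (Fib E)"
    by (rule mk_map_Arr)
      (use c in \<open>auto simp: base P.fib T.fib over_def cat_functor_norm[OF P.cat_functor_axioms] simp del: cartesian_norm\<close>)
  then have u: "mk_map P ?T (proj P) \<in> hom (Fib E) P ?T" by (simp add: hom_def)
  show "\<exists>!f. f \<in> hom (Fib E) P ?T"
  proof (rule ex1I)
    show "mk_map P ?T (proj P) \<in> hom (Fib E) P ?T" by (rule u)
    fix v assume "v \<in> hom (Fib E) P ?T"
    then interpret v: fib_arrow E P ?T v by (rule fib_arrow_hom[OF base])
    show "v = mk_map P ?T (proj P)"
    proof (rule fib_map_eqI[OF v.fib_arrow_axioms fib_arrow_hom[OF base u]])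
      fix f assume f: "f \<in> Ar P"
      have "fa v f \<in> Arr E" using v.amap_Arr(1)[OF f] by simp
      then show "fa v f = fa (mk_map P ?T (proj P)) f"
        using v.proj_amap[OF f] f by simp
    qed
  qed
qed

text \<open>The emptiness of the witness is exported because
  \<open>trivial_fibration_section\<close> lifts against the resulting injections.\<close>

lemma empty_initial:
  obtains N where "fibred_category E N" "Ob N = {}"
    "\<forall>P. fibred_category E P \<longrightarrow> (\<exists>!f. f \<in> hom (Fib E) N P)"
proof -
  interpret E: category E by (rule base)
  let ?O = "\<lparr>Obj = {}, Arr = {}, Dom = undefined, Cod = undefined, Ident = undefined, Comp = undefined\<rparr> :: ('u, 'u) cat"
  let ?I = "mk_fib ?O undefined"
  have O: "category ?O" by (rule categoryI) simp_all
  have "cat_functor ?O E undefined" by (rule cat_functorI) (simp_all add: base O)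
  then have I: "fibred_category E ?I" by (rule mk_fib_fibred) simp
  show thesis
  proof (rule that[OF I], simp, intro allI impI)
    fix P assume "fibred_category E P"
    then interpret P: fibred E P by (rule fibred.intro[OF base])
    have "mk_map ?I P undefined \<in> Arr (Fib E)"
    proof (rule mk_map_Arr)
      show "cat_functor (total ?I) (total P) undefined"
        by (rule cat_functorI) (auto simp: category_norm_cat[OF O] P.A.category_axioms)
    qed (auto simp: base P.fib I over_def cartesian_def)
    then have u: "mk_map ?I P undefined \<in> hom (Fib E) ?I P" by (simp add: hom_def)
    show "\<exists>!f. f \<in> hom (Fib E) ?I P"
    proof (rule ex1I)
      show "mk_map ?I P undefined \<in> hom (Fib E) ?I P" by (rule u)
      fix v assume "v \<in> hom (Fib E) ?I P"
      then show "v = mk_map ?I P undefined"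
        by (intro fib_map_eqI[OF fib_arrow_hom[OF base] fib_arrow_hom[OF base u]]) auto
    qed
  qed
qed

lemma has_initial_Fib: "has_initial (Fib E)"
proof (rule empty_initial)
  fix N assume "fibred_category E N" "\<forall>P. fibred_category E P \<longrightarrow> (\<exists>!f. f \<in> hom (Fib E) N P)"
  then show "has_initial (Fib E)" unfolding has_initial_def by (intro bexI[of _ N]) simp_all
qed

end

section \<open>Pullbacks of isofibrations\<close>

definition pb_cat :: "('u, 'u) cat \<Rightarrow> ('u, 'u) cat \<Rightarrow> ('u, 'u, 'u, 'u) fctr \<Rightarrow> ('u, 'u, 'u, 'u) fctr \<Rightarrow>
    ('u, 'u) cat" where
  "pb_cat A X p g =
     \<lparr>Obj = {upair a x | a x. a \<in> Obj A \<and> x \<in> Obj X \<and> omap p a = omap g x},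
      Arr = {upair \<alpha> \<xi> | \<alpha> \<xi>. \<alpha> \<in> Arr A \<and> \<xi> \<in> Arr X \<and> amap p \<alpha> = amap g \<xi>},
      Dom = (\<lambda>z. upair (Dom A (ufst z)) (Dom X (usnd z))),
      Cod = (\<lambda>z. upair (Cod A (ufst z)) (Cod X (usnd z))),
      Ident = (\<lambda>z. upair (Ident A (ufst z)) (Ident X (usnd z))),
      Comp = (\<lambda>w z. upair (ufst w \<cdot>\<^bsub>A\<^esub> ufst z) (usnd w \<cdot>\<^bsub>X\<^esub> usnd z))\<rparr>"

definition fst_fctr :: "('u, 'u, 'u, 'u) fctr" where "fst_fctr = \<lparr>omap = ufst, amap = ufst\<rparr>"

definition snd_fctr :: "('u, 'u, 'u, 'u) fctr" where "snd_fctr = \<lparr>omap = usnd, amap = usnd\<rparr>"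

context infinite_base
begin

lemma pb_cat_simps [simp]:
  fixes A X :: "('u, 'u) cat"
  shows "upair a x \<in> Obj (pb_cat A X p g) \<longleftrightarrow> a \<in> Obj A \<and> x \<in> Obj X \<and> omap p a = omap g x"
    "upair \<alpha> \<xi> \<in> Arr (pb_cat A X p g) \<longleftrightarrow> \<alpha> \<in> Arr A \<and> \<xi> \<in> Arr X \<and> amap p \<alpha> = amap g \<xi>"
    "Dom (pb_cat A X p g) (upair \<alpha> \<xi>) = upair (Dom A \<alpha>) (Dom X \<xi>)"
    "Cod (pb_cat A X p g) (upair \<alpha> \<xi>) = upair (Cod A \<alpha>) (Cod X \<xi>)"
    "Ident (pb_cat A X p g) (upair a x) = upair (Ident A a) (Ident X x)"
    "upair \<beta> \<upsilon> \<cdot>\<^bsub>pb_cat A X p g\<^esub> upair \<alpha> \<xi> = upair (\<beta> \<cdot>\<^bsub>A\<^esub> \<alpha>) (\<upsilon> \<cdot>\<^bsub>X\<^esub> \<xi>)"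
  by (auto simp: pb_cat_def)

lemma pb_cat_Arr:
  fixes A X :: "('u, 'u) cat"
  assumes "z \<in> Arr (pb_cat A X p g)"
  obtains \<alpha> \<xi> where "z = upair \<alpha> \<xi>" "\<alpha> \<in> Arr A" "\<xi> \<in> Arr X" "amap p \<alpha> = amap g \<xi>"
  using assms by (auto simp: pb_cat_def)

lemma pb_cat_Obj:
  fixes A X :: "('u, 'u) cat"
  assumes "z \<in> Obj (pb_cat A X p g)"
  obtains a x where "z = upair a x" "a \<in> Obj A" "x \<in> Obj X" "omap p a = omap g x"
  using assms by (auto simp: pb_cat_def)

lemma fst_snd_fctr_simps [simp]:
  "omap fst_fctr (upair (a :: 'u) x) = a" "amap fst_fctr (upair (a :: 'u) x) = a"
  "omap snd_fctr (upair (a :: 'u) x) = x" "amap snd_fctr (upair (a :: 'u) x) = x"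
  by (simp_all add: fst_fctr_def snd_fctr_def)

text \<open>The pullback of the underlying categories works once cartesian arrows of
  \<open>A\<close> and \<open>X\<close> can be matched exactly in \<open>Y\<close>. The last
  conjunct is right properness for this particular square.\<close>

lemma isofibration_pullback:
  assumes "fib_arrow E A Y p" "fib_arrow E X Y g" and iso: "p \<in> E_isofibrations E"
  shows "\<exists>P h k. fib_arrow E P A h \<and> fib_arrow E P X k \<and> pullback_square (Fib E) p g h k \<and>
    (g \<in> E_equivalences E \<longrightarrow> h \<in> E_equivalences E)"
proof -
  interpret p: fib_arrow E A Y p by fact
  interpret g: fib_arrow E X Y g by fact
  let ?T = "pb_cat (total A) (total X) (fun_of p) (fun_of g)"
  have ends: "fo p (dm A \<alpha>) = fo g (dm X \<xi>)"
    "fo p (cd A \<alpha>) = fo g (cd X \<xi>)"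
    if "fa p \<alpha> = fa g \<xi>" "\<alpha> \<in> Ar A" "\<xi> \<in> Ar X" for \<alpha> \<xi>
    using that by (metis p.amap_Arr(2) g.amap_Arr(2), metis p.amap_Arr(3) g.amap_Arr(3))
  have T: "category ?T"
    by (rule categoryI) (auto intro: ends elim!: pb_cat_Arr pb_cat_Obj)
  let ?q = "\<lparr>omap = (\<lambda>z. po X (usnd z)), amap = (\<lambda>z. pa X (usnd z))\<rparr>"
  have q: "cat_functor ?T E ?q"
    by (rule cat_functorI) (auto simp: T base elim!: pb_cat_Arr pb_cat_Obj)
  then interpret q: cat_functor ?T E ?q .
  have vert: "pa A \<alpha> = pa X \<xi>" if "fa p \<alpha> = fa g \<xi>"
    "\<alpha> \<in> Ar A" "\<xi> \<in> Ar X" for \<alpha> \<xi>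
    using that by (metis p.proj_amap g.proj_amap)
  have vert': "po A a = po X x" if "fo p a = fo g x"
    "a \<in> Ob A" "x \<in> Ob X" for a x
    using that by (metis p.proj_omap g.proj_omap)
  \<comment> \<open>Lifts are formed in each component.\<close>
  have cart: "cartesian ?T E ?q (upair \<phi>1 \<phi>2)"
    if c: "cart E A \<phi>1" "cart E X \<phi>2"
      "fa p \<phi>1 = fa g \<phi>2" for \<phi>1 \<phi>2
  proof (rule q.cartesianI)
    note v = vert[OF c(3)] and c' [simp] = c(3) p.S.cartesian_Arr[OF c(1)] g.S.cartesian_Arr[OF c(2)]
    show "upair \<phi>1 \<phi>2 \<in> Arr ?T" by simp
    fix z f
    assume h: "z \<in> Arr ?T" "Cod ?T z = Cod ?T (upair \<phi>1 \<phi>2)" "f \<in> Arr E" "Dom E f = omap ?q (Dom ?T z)"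
      "Cod E f = omap ?q (Dom ?T (upair \<phi>1 \<phi>2))" "amap ?q (upair \<phi>1 \<phi>2) \<cdot>\<^bsub>E\<^esub> f = amap ?q z"
    obtain \<alpha> \<xi> where z: "z = upair \<alpha> \<xi>" "\<alpha> \<in> Ar A" "\<xi> \<in> Ar X"
      "fa p \<alpha> = fa g \<xi>" using h(1) by (rule pb_cat_Arr)
    have d: "po A (dm A \<alpha>) = po X (dm X \<xi>)"
      "po A (dm A \<phi>1) = po X (dm X \<phi>2)"
      using p.S.amap_Arr(2) g.S.amap_Arr(2) vert z c' by metis+
    obtain \<chi>1 where \<chi>1: "\<chi>1 \<in> Ar A" "dm A \<chi>1 = dm A \<alpha>"
      "cd A \<chi>1 = dm A \<phi>1" "pa A \<chi>1 = f" "\<phi>1 \<cdot>\<^bsub>total A\<^esub> \<chi>1 = \<alpha>"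
      by (rule p.S.cartesian_lift[OF c(1), of \<alpha> f]) (use h z v vert[of \<alpha> \<xi>] d in auto)
    obtain \<chi>2 where \<chi>2: "\<chi>2 \<in> Ar X" "dm X \<chi>2 = dm X \<xi>"
      "cd X \<chi>2 = dm X \<phi>2" "pa X \<chi>2 = f" "\<phi>2 \<cdot>\<^bsub>total X\<^esub> \<chi>2 = \<xi>"
      by (rule g.S.cartesian_lift[OF c(2), of \<xi> f]) (use h z in auto)
    have o: "fo p (dm A \<alpha>) = fo g (dm X \<xi>)"
      "fo p (dm A \<phi>1) = fo g (dm X \<phi>2)"
      using p.amap_Arr(2) g.amap_Arr(2) z c' by metis+
    \<comment> \<open>The two lifts agree in \<open>Y\<close> because they have the same base arrow
      and the same composite with the cartesian image of \<open>\<phi>1\<close>.\<close>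
    have "fa p \<chi>1 = fa g \<chi>2"
    proof (rule p.T.cartesian_cancel[OF p.amap_cartesian[OF c(1)]])
      show "fa p \<phi>1 \<cdot>\<^bsub>total Y\<^esub> fa p \<chi>1 = fa p \<phi>1 \<cdot>\<^bsub>total Y\<^esub> fa g \<chi>2"
        using z(4) unfolding \<chi>1(5)[symmetric] \<chi>2(5)[symmetric]
        using \<chi>1(1-3) \<chi>2(1-3) by simp
    qed (use \<chi>1(1-4) \<chi>2(1-4) o in simp_all)
    then show "\<exists>\<chi>\<in>Arr ?T. Dom ?T \<chi> = Dom ?T z \<and> Cod ?T \<chi> = Dom ?T (upair \<phi>1 \<phi>2) \<and> amap ?q \<chi> = f \<and>
        upair \<phi>1 \<phi>2 \<cdot>\<^bsub>?T\<^esub> \<chi> = z"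
      using \<chi>1 \<chi>2 z by (intro bexI[of _ "upair \<chi>1 \<chi>2"]) simp_all
  next
    note v = vert[OF c(3)]
    fix z z'
    assume h: "z \<in> Arr ?T" "z' \<in> Arr ?T" "Cod ?T z = Dom ?T (upair \<phi>1 \<phi>2)" "Cod ?T z' = Dom ?T (upair \<phi>1 \<phi>2)"
      "Dom ?T z = Dom ?T z'" "amap ?q z = amap ?q z'" "upair \<phi>1 \<phi>2 \<cdot>\<^bsub>?T\<^esub> z = upair \<phi>1 \<phi>2 \<cdot>\<^bsub>?T\<^esub> z'"
    obtain \<alpha> \<xi> where z: "z = upair \<alpha> \<xi>" "\<alpha> \<in> Ar A" "\<xi> \<in> Ar X"
      "fa p \<alpha> = fa g \<xi>" using h(1) by (rule pb_cat_Arr)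
    obtain \<alpha>' \<xi>' where z': "z' = upair \<alpha>' \<xi>'" "\<alpha>' \<in> Ar A" "\<xi>' \<in> Ar X"
      "fa p \<alpha>' = fa g \<xi>'" using h(2) by (rule pb_cat_Arr)
    have "\<alpha> = \<alpha>'" by (rule p.S.cartesian_cancel[OF c(1)]) (use h z z' vert[of \<alpha> \<xi>] vert[of \<alpha>' \<xi>'] in auto)
    moreover have "\<xi> = \<xi>'" by (rule g.S.cartesian_cancel[OF c(2)]) (use h z z' in auto)
    ultimately show "z = z'" using z z' by simp
  qed
  have lifts: "\<exists>\<phi>1 \<phi>2. cart E A \<phi>1 \<and> cart E X \<phi>2 \<and>
      fa p \<phi>1 = fa g \<phi>2 \<and> cd A \<phi>1 = a \<and> cd X \<phi>2 = x \<and> pa X \<phi>2 = f"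
    if ax: "a \<in> Ob A" "x \<in> Ob X" "fo p a = fo g x"
      "f \<in> Arr E" "Cod E f = po X x" for a x f
  proof -
    have [simp]: "po A a = po X x" using vert' ax by simp
    obtain \<phi>2 where \<phi>2: "cart E X \<phi>2" "cd X \<phi>2 = x" "pa X \<phi>2 = f"
      by (rule g.S.cartesian_over[of x f]) (use ax in auto)
    obtain \<psi> where \<psi>: "cart E A \<psi>" "cd A \<psi> = a" "pa A \<psi> = f"
      by (rule p.S.cartesian_over[of a f]) (use ax in auto)
    have Arr [simp]: "\<phi>2 \<in> Ar X" "\<psi> \<in> Ar A" using \<phi>2 \<psi> by simp_all
    have "cd Y (fa g \<phi>2) = cd Y (fa p \<psi>)"
      "pa Y (fa g \<phi>2) = pa Y (fa p \<psi>)"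
      using \<phi>2 \<psi> ax by simp_all
    note unique = p.T.cartesian_unique[OF p.amap_cartesian[OF \<psi>(1)] g.amap_cartesian[OF \<phi>2(1)] this]
    obtain \<iota> where \<iota>: "iso (total Y) \<iota>" "dm Y \<iota> = dm Y (fa g \<phi>2)"
      "cd Y \<iota> = dm Y (fa p \<psi>)"
      "fa g \<phi>2 = fa p \<psi> \<cdot>\<^bsub>total Y\<^esub> \<iota>"
      by (rule unique)
    have c: "cd Y \<iota> = fo p (dm A \<psi>)" using \<iota>(3) by simp
    \<comment> \<open>The images of \<open>\<psi>\<close> and \<open>\<phi>2\<close> are cartesian
      over the same arrow and differ by the vertical \<open>\<iota>\<close>. Lifting its inverse
      from the domain of \<open>\<psi>\<close> allows \<open>\<psi>\<close> to be altered so that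
      the images coincide.\<close>
    obtain \<kappa> where \<kappa>: "iso (total A) \<kappa>" "dm A \<kappa> = dm A \<psi>"
      "fa p \<kappa> = inv_arr (total Y) \<iota>"
      using iso[unfolded p.E_isofibrations_iff, rule_format, of "dm A \<psi>" "inv_arr (total Y) \<iota>"] \<iota>(1) c
      by auto
    show ?thesis
      by (rule exI[of _ "\<psi> \<cdot>\<^bsub>total A\<^esub> inv_arr (total A) \<kappa>"], rule exI[of _ \<phi>2])
        (use \<psi> \<phi>2 \<kappa> \<iota>(1,4) c in simp)
  qed
  let ?P = "mk_fib ?T ?q"
  have Pfib: "fibred_category E ?P"
  proof (rule mk_fib_fibred[OF q])
    fix y f assume h: "y \<in> Obj ?T" "f \<in> Arr E" "Cod E f = omap ?q y"
    obtain a x where y: "y = upair a x" "a \<in> Ob A" "x \<in> Ob X"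
      "fo p a = fo g x" using h(1) by (rule pb_cat_Obj)
    then obtain \<phi>1 \<phi>2 where "cart E A \<phi>1" "cart E X \<phi>2"
      "fa p \<phi>1 = fa g \<phi>2" "cd A \<phi>1 = a" "cd X \<phi>2 = x" "pa X \<phi>2 = f"
      using lifts[of a x f] h by auto
    then show "\<exists>\<phi>. cartesian ?T E ?q \<phi> \<and> Cod ?T \<phi> = y \<and> amap ?q \<phi> = f"
      using y by (intro exI[of _ "upair \<phi>1 \<phi>2"]) (simp add: cart)
  qed
  have lifts': "\<exists>\<phi>. cart E ?P \<phi> \<and> cd ?P \<phi> = y \<and> pa ?P \<phi> = f \<and>
      cart E A (ufst \<phi>) \<and> cart E X (usnd \<phi>)"
    if h: "y \<in> Ob ?P" "f \<in> Arr E" "Cod E f = po ?P y" for y f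
  proof -
    obtain a x where y: "y = upair a x" "a \<in> Ob A" "x \<in> Ob X"
      "fo p a = fo g x" using h(1) by (auto elim: pb_cat_Obj)
    then obtain \<phi>1 \<phi>2 where \<phi>: "cart E A \<phi>1" "cart E X \<phi>2"
      "fa p \<phi>1 = fa g \<phi>2" "cd A \<phi>1 = a" "cd X \<phi>2 = x" "pa X \<phi>2 = f"
      using lifts[of a x f] h by auto
    note c = cart[OF this(1-3)]
    then have "upair \<phi>1 \<phi>2 \<in> Arr ?T" by (rule q.cartesian_Arr)
    then show ?thesis using y c \<phi> q by (intro exI[of _ "upair \<phi>1 \<phi>2"]) simp
  qed
  have "cat_functor ?T (total A) fst_fctr" "cat_functor ?T (total X) snd_fctr"
    by (rule cat_functorI; auto simp: T p.S.A.category_axioms g.S.A.category_axioms elim!: pb_cat_Arr pb_cat_Obj)+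
  note f = this[THEN cat_functor_norm(2)]
  let ?h = "mk_map ?P A fst_fctr" and ?k = "mk_map ?P X snd_fctr"
  have "?h \<in> Arr (Fib E)"
  proof (rule mk_map_Arr_lifts)
    show "over (total ?P) (proj ?P) fst_fctr (proj A)"
      by (auto simp: over_def vert elim!: pb_cat_Arr)
    fix y f assume "y \<in> Ob ?P" "f \<in> Arr E" "Cod E f = po ?P y"
    from lifts'[OF this] show "\<exists>\<phi>. cart E ?P \<phi> \<and> cd ?P \<phi> = y \<and>
        pa ?P \<phi> = f \<and> cart E A (amap fst_fctr \<phi>)"
      unfolding fst_fctr_def by auto
  qed (use base Pfib p.S.fib f in auto)
  then have h: "fib_arrow E ?P A ?h" by (intro fib_arrow.intro) (simp_all add: base)
  have "?k \<in> Arr (Fib E)"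
  proof (rule mk_map_Arr_lifts)
    show "over (total ?P) (proj ?P) snd_fctr (proj X)"
      by (auto simp: over_def elim!: pb_cat_Arr)
    fix y f assume "y \<in> Ob ?P" "f \<in> Arr E" "Cod E f = po ?P y"
    from lifts'[OF this] show "\<exists>\<phi>. cart E ?P \<phi> \<and> cd ?P \<phi> = y \<and>
        pa ?P \<phi> = f \<and> cart E X (amap snd_fctr \<phi>)"
      unfolding snd_fctr_def by auto
  qed (use base Pfib g.S.fib f in auto)
  then have k: "fib_arrow E ?P X ?k" by (intro fib_arrow.intro) (simp_all add: base)
  interpret h: fib_arrow E ?P A ?h by (rule h)
  interpret k: fib_arrow E ?P X ?k by (rule k)
  have "pullback_square (Fib E) p g ?h ?k"
    unfolding pullback_square_def
  proof (intro conjI ballI impI)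
    show "p \<cdot>\<^bsub>Fib E\<^esub> ?h = g \<cdot>\<^bsub>Fib E\<^esub> ?k"
      by (rule fib_map_eqI[OF fib_arrow_Comp[OF h p.fib_arrow_axioms] fib_arrow_Comp[OF k g.fib_arrow_axioms]])
        (auto elim!: pb_cat_Arr)
    fix Z s t
    assume "s \<in> hom (Fib E) Z (Dom (Fib E) p)" "t \<in> hom (Fib E) Z (Dom (Fib E) g)"
      and sq: "p \<cdot>\<^bsub>Fib E\<^esub> s = g \<cdot>\<^bsub>Fib E\<^esub> t"
    then have "fib_arrow E Z A s" "fib_arrow E Z X t" by (auto intro!: fib_arrow_hom base)
    then interpret s: fib_arrow E Z A s + t: fib_arrow E Z X t .
    note sq' [simp] = Fib_square[OF s.fib_arrow_axioms t.fib_arrow_axioms sq]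
    let ?G = "\<lparr>omap = \<lambda>z. upair (fo s z) (fo t z),
      amap = \<lambda>f. upair (fa s f) (fa t f)\<rparr>"
    let ?r = "mk_map Z ?P ?G"
    have G: "cat_functor (total Z) (total ?P) ?G"
      by (simp, rule cat_functor_norm, rule cat_functorI) (auto simp: T s.S.A.category_axioms)
    have "?r \<in> Arr (Fib E)"
    proof (rule mk_map_Arr)
      show "over (total Z) (proj Z) ?G (proj ?P)" by (auto simp: over_def)
      fix \<phi> assume c: "cart E Z \<phi>"
      have "cartesian ?T E ?q (amap ?G \<phi>)" using c by (simp add: cart)
      then show "cart E ?P (amap ?G \<phi>)" by (simp add: q)
    qed (use base s.S.fib Pfib G in auto)
    then have r: "fib_arrow E Z ?P ?r" by (intro fib_arrow.intro) (simp_all add: base)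
    show "\<exists>!r. r \<in> hom (Fib E) Z (Dom (Fib E) ?h) \<and> ?h \<cdot>\<^bsub>Fib E\<^esub> r = s \<and> ?k \<cdot>\<^bsub>Fib E\<^esub> r = t"
    proof (rule ex1I[of _ ?r], intro conjI)
      show "?r \<in> hom (Fib E) Z (Dom (Fib E) ?h)" using fib_arrow.arrow[OF r] by (simp add: hom_def)
      show "?h \<cdot>\<^bsub>Fib E\<^esub> ?r = s"
        by (rule fib_map_eqI[OF fib_arrow_Comp[OF r h] s.fib_arrow_axioms]) simp
      show "?k \<cdot>\<^bsub>Fib E\<^esub> ?r = t"
        by (rule fib_map_eqI[OF fib_arrow_Comp[OF r k] t.fib_arrow_axioms]) simp
      fix r' assume r': "r' \<in> hom (Fib E) Z (Dom (Fib E) ?h) \<and> ?h \<cdot>\<^bsub>Fib E\<^esub> r' = s \<and> ?k \<cdot>\<^bsub>Fib E\<^esub> r' = t"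
      then interpret r': fib_arrow E Z ?P r' by (intro fib_arrow_hom[OF base]) simp
      show "r' = ?r"
      proof (rule fib_map_eqI[OF r'.fib_arrow_axioms r])
        fix f assume f: "f \<in> Ar Z"
        have "fa r' f \<in> Arr ?T" using r'.amap_Arr(1)[OF f] by simp
        moreover have "fa (?h \<cdot>\<^bsub>Fib E\<^esub> r') f = fa s f"
          "fa (?k \<cdot>\<^bsub>Fib E\<^esub> r') f = fa t f" using r' by simp_all
        ultimately show "fa r' f = fa ?r f"
          using f by (auto elim!: pb_cat_Arr)
      qed
    qed
  qed (simp_all add: p.arrow g.arrow h.arrow k.arrow)
  moreover have "?h \<in> E_equivalences E" if "g \<in> E_equivalences E"
  proof -
    have ff: "fully_faithful (total X) (total Y) (fun_of g)" and es: "ess_surj (total X) (total Y) (fun_of g)"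
      using that by (auto simp: g.E_equivalences_iff)
    note faithful = fully_faithful_faithful[OF ff _ _ _ _ _ g.S.A.category_axioms]
    have "fully_faithful (total ?P) (total A) (fun_of ?h)"
    proof (rule fully_faithfulI[OF h.cat_functor_axioms])
      fix w z assume hz: "w \<in> Ar ?P" "z \<in> Ar ?P" "dm ?P w = dm ?P z"
        "cd ?P w = cd ?P z" "fa ?h w = fa ?h z"
      obtain \<alpha> \<xi> where w: "w = upair \<alpha> \<xi>" "\<alpha> \<in> Ar A" "\<xi> \<in> Ar X"
        "fa p \<alpha> = fa g \<xi>" using hz(1) by (auto elim: pb_cat_Arr)
      obtain \<alpha>' \<xi>' where z: "z = upair \<alpha>' \<xi>'" "\<alpha>' \<in> Ar A" "\<xi>' \<in> Ar X"
        "fa p \<alpha>' = fa g \<xi>'" using hz(2) by (auto elim: pb_cat_Arr)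
      have "\<alpha> = \<alpha>'" using hz w z by simp
      moreover have "\<xi> = \<xi>'" by (rule faithful) (use hz w z \<open>\<alpha> = \<alpha>'\<close> in auto)
      ultimately show "w = z" using w z by simp
    next
      fix \<alpha> y y' assume hy: "\<alpha> \<in> Ar A" "y \<in> Ob ?P" "y' \<in> Ob ?P"
        "dm A \<alpha> = fo ?h y" "cd A \<alpha> = fo ?h y'"
      obtain a x where y: "y = upair a x" "a \<in> Ob A" "x \<in> Ob X"
        "fo p a = fo g x" using hy(2) by (auto elim: pb_cat_Obj)
      obtain a' x' where y': "y' = upair a' x'" "a' \<in> Ob A" "x' \<in> Ob X"
        "fo p a' = fo g x'" using hy(3) by (auto elim: pb_cat_Obj)
      obtain \<xi> where "\<xi> \<in> Ar X" "dm X \<xi> = x" "cd X \<xi> = x'"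
        "fa g \<xi> = fa p \<alpha>"
        by (rule fully_faithful_full[OF ff, of "fa p \<alpha>" x x']) (use hy y y' in auto)
      then show "\<exists>f\<in>Ar ?P. dm ?P f = y \<and> cd ?P f = y' \<and> fa ?h f = \<alpha>"
        using hy y y' by (intro bexI[of _ "upair \<alpha> \<xi>"]) auto
    qed
    moreover have "ess_surj (total ?P) (total A) (fun_of ?h)"
      unfolding ess_surj_def
    proof
      fix c assume c: "c \<in> Ob A"
      obtain x \<beta> where x: "x \<in> Ob X" "iso (total Y) \<beta>" "dm Y \<beta> = fo g x"
        "cd Y \<beta> = fo p c"
        using es c unfolding ess_surj_def by (meson p.omap_Obj)
      \<comment> \<open>The isofibration moves \<open>c\<close> to an isomorphic object lying
        exactly over the image of \<open>x\<close>, so that the two form an object of the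
        pullback.\<close>
      obtain \<alpha> where \<alpha>: "iso (total A) \<alpha>" "dm A \<alpha> = c" "fa p \<alpha> = inv_arr (total Y) \<beta>"
        using iso[unfolded p.E_isofibrations_iff, rule_format, of c "inv_arr (total Y) \<beta>"] x c by auto
      have "fo p (cd A \<alpha>) = fo g x"
        using p.amap_Arr(3)[of \<alpha>] \<alpha> x by simp
      then show "\<exists>a\<in>Ob ?P. \<exists>\<beta>. iso (total A) \<beta> \<and> dm A \<beta> = fo ?h a \<and> cd A \<beta> = c"
        using \<alpha> x by (intro bexI[of _ "upair (cd A \<alpha>) x"] exI[of _ "inv_arr (total A) \<alpha>"]) auto
    qed
    ultimately show ?thesis by (simp only: h.E_equivalences_iff)
  qed
  ultimately show ?thesis using h k by blast
qed

text \<open>An arbitrary pullback square is compared with the constructed one. The comparison maps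
  exhibit \<open>k\<close> as a retract of the leg \<open>h'\<close>, which is already known to be
  an equivalence.\<close>

lemma right_proper_Fib: "right_proper (Fib E) (E_equivalences E) (E_isofibrations E)"
  unfolding right_proper_def
proof (intro allI impI)
  interpret M: category "Fib E" by (rule category_Fib[OF base])
  fix w p h k assume wp: "w \<in> E_equivalences E \<and> p \<in> E_isofibrations E \<and> pullback_square (Fib E) w p h k"
  then have sq: "pullback_square (Fib E) w p h k" by simp
  then have sqA: "w \<in> Arr (Fib E)" "p \<in> Arr (Fib E)" "h \<in> Arr (Fib E)" "k \<in> Arr (Fib E)" "tgt w = tgt p"
    "tgt h = src w" "tgt k = src p" "src h = src k" "w \<cdot>\<^bsub>Fib E\<^esub> h = p \<cdot>\<^bsub>Fib E\<^esub> k"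
    unfolding pullback_square_def by simp_all
  obtain A Y P X where AYPX: "A = src p" "Y = tgt p" "P = src k" "X = src w" by blast
  have p: "fib_arrow E A Y p" and w: "fib_arrow E X Y w" and h: "fib_arrow E P X h" and k: "fib_arrow E P A k"
    by (rule fib_arrow.intro[OF base]; use sqA AYPX in simp)+
  obtain Q h' k' where h': "fib_arrow E Q A h'" and k': "fib_arrow E Q X k'"
    and sq': "pullback_square (Fib E) p w h' k'" and W: "h' \<in> E_equivalences E"
    using isofibration_pullback[OF p w] wp by blast
  interpret p: fib_arrow E A Y p by (rule p)
  interpret w: fib_arrow E X Y w by (rule w)
  interpret h: fib_arrow E P X h by (rule h)
  interpret k: fib_arrow E P A k by (rule k)
  interpret h': fib_arrow E Q A h' by (rule h')
  interpret k': fib_arrow E Q X k' by (rule k')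
  have u: "\<exists>!r. r \<in> hom (Fib E) P Q \<and> h' \<cdot>\<^bsub>Fib E\<^esub> r = k \<and> k' \<cdot>\<^bsub>Fib E\<^esub> r = h"
    using sq' sqA h.S.fib k.arrow h.arrow unfolding pullback_square_def by (simp add: hom_def)
  have sq'': "p \<cdot>\<^bsub>Fib E\<^esub> h' = w \<cdot>\<^bsub>Fib E\<^esub> k'" using sq' unfolding pullback_square_def by simp
  have univ: "\<exists>!r. r \<in> hom (Fib E) Z P \<and> h \<cdot>\<^bsub>Fib E\<^esub> r = s \<and> k \<cdot>\<^bsub>Fib E\<^esub> r = t"
    if "fib_arrow E Z X s" "fib_arrow E Z A t" "w \<cdot>\<^bsub>Fib E\<^esub> s = p \<cdot>\<^bsub>Fib E\<^esub> t" for Z s t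
  proof -
    interpret s: fib_arrow E Z X s by fact
    interpret t: fib_arrow E Z A t by fact
    show ?thesis
      using sq that(3) s.arrow t.arrow s.S.fib unfolding pullback_square_def by (simp add: hom_def)
  qed
  obtain u where u: "fib_arrow E P Q u" "h' \<cdot>\<^bsub>Fib E\<^esub> u = k" "k' \<cdot>\<^bsub>Fib E\<^esub> u = h"
    using u by (auto intro: fib_arrow_hom[OF base])
  obtain v where v: "fib_arrow E Q P v" "h \<cdot>\<^bsub>Fib E\<^esub> v = k'" "k \<cdot>\<^bsub>Fib E\<^esub> v = h'"
    using univ[OF k' h'] sq'' by (auto intro: fib_arrow_hom[OF base])
  interpret u: fib_arrow E P Q u by (rule u)
  interpret v: fib_arrow E Q P v by (rule v)
  \<comment> \<open>Both sides solve the same factorization problem for the given square.\<close>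
  have "v \<cdot>\<^bsub>Fib E\<^esub> u = Ident (Fib E) P"
  proof -
    have 1: "v \<cdot>\<^bsub>Fib E\<^esub> u \<in> hom (Fib E) P P" "h \<cdot>\<^bsub>Fib E\<^esub> (v \<cdot>\<^bsub>Fib E\<^esub> u) = h" "k \<cdot>\<^bsub>Fib E\<^esub> (v \<cdot>\<^bsub>Fib E\<^esub> u) = k"
      using M.Assoc[of u v h] M.Assoc[of u v k] u v u.arrow v.arrow h.arrow k.arrow by (simp_all add: hom_def)
    have 2: "Ident (Fib E) P \<in> hom (Fib E) P P" "h \<cdot>\<^bsub>Fib E\<^esub> Ident (Fib E) P = h" "k \<cdot>\<^bsub>Fib E\<^esub> Ident (Fib E) P = k"
      using M.Ident_Arr[of P] M.Ident_right[of h P] M.Ident_right[of k P] h.S.fib h.arrow k.arrow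
      by (simp_all add: hom_def del: Fib_simps(4))
    show ?thesis using univ[OF h k sqA(9)] 1 2 by blast
  qed
  then show "k \<in> E_equivalences E"
    by (rule equivalence_retract_left[OF k u(1) h' v(1) _ v(3) W])
qed

end

section \<open>Amalgamated sums\<close>

text \<open>
  The pushout of two cartesian functors \<open>I True\<close>, \<open>I False\<close> that are injective on objects is the
  pushout of the underlying categories: its arrows are words in the arrows of \<open>C True\<close> and
  \<open>C False\<close> modulo \<open>eqv\<close>.  By injectivity, cleavages of \<open>C True\<close> and \<open>C False\<close> can be chosen that
  extend a common cleavage of \<open>A\<close>.  Pulling a word back letter by letter along an arrow of the base
  then respects \<open>eqv\<close>, and this operation shows that cartesian letters stay cartesian.
\<close>

locale amalgam = infinite_base E for E :: "('u, 'u) cat" +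
  fixes A :: "'u fibred_cat" and C :: "bool \<Rightarrow> 'u fibred_cat" and I :: "bool \<Rightarrow> 'u fib_map"
  assumes legs: "fib_arrow E A (C s) (I s)"
    and inj_legs: "inj_on (fo (I s)) (Ob A)"
begin

sublocale I: fib_arrow E A "C s" "I s" for s by (rule legs)

text \<open>The two copies of an object of \<open>A\<close> share the name coming from
  \<open>A\<close>; every other object remembers its side.\<close>

definition ob :: "bool \<Rightarrow> 'u \<Rightarrow> 'u" where
  "ob s b = (if b \<in> fo (I s) ` Ob A
     then upair (utag True) (the_inv_into (Ob A) (fo (I s)) b)
     else upair (utag False) (upair (utag s) b))"

lemma ob_I [simp]: "a \<in> Ob A \<Longrightarrow> ob s (fo (I s) a) = upair (utag True) a"
  using inj_legs by (simp add: ob_def the_inv_into_f_f)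

lemma ob_eqD:
  assumes "ob s b = ob t b'"
  shows "s = t \<and> b = b' \<or> (\<exists>a \<in> Ob A. b = fo (I s) a \<and> b' = fo (I t) a)"
  using assms by (auto simp: ob_def the_inv_into_f_f[OF inj_legs] split: if_splits)

definition objs :: "'u set" where "objs = {ob s b | s b. b \<in> Ob (C s)}"

lemma ob_objs [simp]: "b \<in> Ob (C s) \<Longrightarrow> ob s b \<in> objs"
  by (auto simp: objs_def)

lemma upair_objs [simp]: "a \<in> Ob A \<Longrightarrow> upair (utag True) a \<in> objs"
  using ob_objs[of "fo (I True) a" True] by simp

lemma objs_cases:
  assumes "x \<in> objs"
  obtains s b where "x = ob s b" "b \<in> Ob (C s)"
  using assms by (auto simp: objs_def)

text \<open>Descends a function given on both sides to \<open>objs\<close>; under agreement on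
  \<open>A\<close> the chosen representative does not matter.\<close>

definition glue :: "(bool \<Rightarrow> 'u \<Rightarrow> 'u) \<Rightarrow> 'u \<Rightarrow> 'u" where
  "glue h x = (SOME z. \<exists>s b. b \<in> Ob (C s) \<and> x = ob s b \<and> z = h s b)"

lemma glue_ob:
  assumes "\<And>a s t. a \<in> Ob A \<Longrightarrow> h s (fo (I s) a) = h t (fo (I t) a)"
    and "b \<in> Ob (C s)"
  shows "glue h (ob s b) = h s b"
proof -
  have "\<exists>t c. c \<in> Ob (C t) \<and> ob s b = ob t c \<and> glue h (ob s b) = h t c"
    unfolding glue_def by (rule someI_ex) (use assms(2) in blast)
  then obtain t c where "ob s b = ob t c" "glue h (ob s b) = h t c" by blast
  from ob_eqD[OF this(1)] this(2) show ?thesis using assms(1)[of _ t s] by auto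
qed

section \<open>Words and their congruence\<close>

primrec valid :: "'u \<Rightarrow> (bool \<times> 'u) list \<Rightarrow> bool" where
  "valid x [] \<longleftrightarrow> x \<in> objs"
| "valid x (w # ws) \<longleftrightarrow> snd w \<in> Ar (C (fst w)) \<and> x = ob (fst w) (dm (C (fst w)) (snd w)) \<and>
     valid (ob (fst w) (cd (C (fst w)) (snd w))) ws"

primrec pend :: "'u \<Rightarrow> (bool \<times> 'u) list \<Rightarrow> 'u" where
  "pend x [] = x"
| "pend x (w # ws) = pend (ob (fst w) (cd (C (fst w)) (snd w))) ws"

text \<open>The least congruence that makes the letters of each side a functor and identifies the
  two functors on \<open>A\<close>. The relations carry an arbitrary tail, so a rule for prefixing a
  letter is enough to generate a congruence.\<close>

inductive eqv :: "'u \<Rightarrow> (bool \<times> 'u) list \<Rightarrow> (bool \<times> 'u) list \<Rightarrow> bool" where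
  refl: "valid x ws \<Longrightarrow> eqv x ws ws"
| sym: "eqv x ws ws' \<Longrightarrow> eqv x ws' ws"
| trans: "eqv x ws ws' \<Longrightarrow> eqv x ws' ws'' \<Longrightarrow> eqv x ws ws''"
| Cons: "f \<in> Ar (C s) \<Longrightarrow> eqv (ob s (cd (C s) f)) ws ws' \<Longrightarrow>
    eqv (ob s (dm (C s) f)) ((s, f) # ws) ((s, f) # ws')"
| comp: "f \<in> Ar (C s) \<Longrightarrow> g \<in> Ar (C s) \<Longrightarrow> cd (C s) f = dm (C s) g \<Longrightarrow>
    valid (ob s (cd (C s) g)) ws \<Longrightarrow>
    eqv (ob s (dm (C s) f)) ((s, f) # (s, g) # ws) ((s, g \<cdot>\<^bsub>total (C s)\<^esub> f) # ws)"
| ident: "b \<in> Ob (C s) \<Longrightarrow> valid (ob s b) ws \<Longrightarrow>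
    eqv (ob s b) ((s, idt (C s) b) # ws) ws"
| glued: "\<alpha> \<in> Ar A \<Longrightarrow> valid (upair (utag True) (cd A \<alpha>)) ws \<Longrightarrow>
    eqv (upair (utag True) (dm A \<alpha>))
      ((s, fa (I s) \<alpha>) # ws) ((t, fa (I t) \<alpha>) # ws)"

lemma valid_objs: "valid x ws \<Longrightarrow> x \<in> objs"
  by (cases ws) auto

lemma eqv_valid: "eqv x ws ws' \<Longrightarrow> valid x ws \<and> valid x ws' \<and> pend x ws = pend x ws'"
  by (induction rule: eqv.induct) auto

lemma valid_append [simp]: "valid x (ws @ vs) \<longleftrightarrow> valid x ws \<and> valid (pend x ws) vs"
  by (induction ws arbitrary: x) (auto dest: valid_objs)

lemma pend_append [simp]: "pend x (ws @ vs) = pend (pend x ws) vs"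
  by (induction ws arbitrary: x) auto

lemma pend_objs: "valid x ws \<Longrightarrow> pend x ws \<in> objs"
  by (induction ws arbitrary: x) auto

text \<open>No rule acts at the end of a word, but the free tail of each relation absorbs
  \<open>vs\<close>.\<close>

lemma eqv_append_left: "eqv x ws ws' \<Longrightarrow> valid (pend x ws) vs \<Longrightarrow> eqv x (ws @ vs) (ws' @ vs)"
proof (induction rule: eqv.induct)
  case (refl x ws)
  then show ?case by (intro eqv.refl) simp
next
  case (sym x ws ws')
  then show ?case by (metis eqv.sym eqv_valid)
next
  case (trans x ws ws' ws'')
  then show ?case by (metis eqv.trans eqv_valid)
qed (auto intro: eqv.intros)

lemma eqv_append_right: "valid x ws \<Longrightarrow> eqv (pend x ws) vs vs' \<Longrightarrow> eqv x (ws @ vs) (ws @ vs')"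
proof (induction ws arbitrary: x)
  case (Cons w ws)
  then have "eqv (ob (fst w) (cd (C (fst w)) (snd w))) (ws @ vs) (ws @ vs')" by simp
  then show ?case using eqv.Cons[of "snd w" "fst w" "ws @ vs" "ws @ vs'"] Cons.prems(1) by simp
qed simp

lemma eqv_append:
  assumes "eqv x ws ws'" "eqv (pend x ws) vs vs'"
  shows "eqv x (ws @ vs) (ws' @ vs')"
  by (rule eqv.trans[OF eqv_append_left eqv_append_right]) (use assms eqv_valid in auto)

primrec enc :: "(bool \<times> 'u) list \<Rightarrow> 'u" where
  "enc [] = upair (utag True) (utag True)"
| "enc (w # ws) = upair (utag False) (upair (utag (fst w)) (upair (snd w) (enc ws)))"

lemma enc_inject [simp]: "enc ws = enc vs \<longleftrightarrow> ws = vs"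
proof (induction ws arbitrary: vs)
  case Nil
  then show ?case by (cases vs) auto
next
  case (Cons w ws)
  then show ?case by (cases vs) (auto simp: prod_eq_iff)
qed

definition cls :: "'u \<Rightarrow> (bool \<times> 'u) list \<Rightarrow> 'u" where
  "cls x ws = upair x (enc (SOME ws'. eqv x ws ws'))"

text \<open>Equivalent words satisfy the same predicate \<open>eqv x\<close>, so the choice in
  \<open>cls\<close> selects the same representative for both; conversely a common representative
  links them. The start \<open>x\<close> is stored separately since an empty word does not determine
  it.\<close>

lemma cls_eq_iff:
  assumes "valid x ws" "valid y vs"
  shows "cls x ws = cls y vs \<longleftrightarrow> x = y \<and> eqv x ws vs"
proof
  assume "cls x ws = cls y vs"
  then have xy: "x = y" and e: "(SOME ws'. eqv x ws ws') = (SOME ws'. eqv y vs ws')"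
    by (auto simp: cls_def)
  have "eqv x ws (SOME ws'. eqv x ws ws')" "eqv y vs (SOME ws'. eqv y vs ws')"
    by (rule someI, rule eqv.refl, fact)+
  then show "x = y \<and> eqv x ws vs" using xy e by (metis eqv.sym eqv.trans)
next
  assume "x = y \<and> eqv x ws vs"
  moreover from this have "eqv x ws = eqv x vs" by (blast intro: eqv.sym eqv.trans)
  ultimately show "cls x ws = cls y vs" by (simp add: cls_def)
qed

lemma cls_eqI: "eqv x ws vs \<Longrightarrow> cls x ws = cls x vs"
  using cls_eq_iff eqv_valid by blast

definition word :: "'u \<Rightarrow> (bool \<times> 'u) list" where
  "word z = (SOME ws. valid (ufst z) ws \<and> z = cls (ufst z) ws)"

lemma ufst_cls [simp]: "ufst (cls x ws) = x"
  by (simp add: cls_def)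

lemma word_cls:
  assumes "valid x ws"
  shows "valid x (word (cls x ws))" "eqv x ws (word (cls x ws))"
proof -
  have "valid x (word (cls x ws)) \<and> cls x ws = cls x (word (cls x ws))"
    unfolding word_def ufst_cls by (rule someI_ex) (use assms in blast)
  then show "valid x (word (cls x ws))" "eqv x ws (word (cls x ws))"
    using cls_eq_iff assms by blast+
qed

definition Sum :: "('u, 'u) cat" where
  "Sum = \<lparr>Obj = objs, Arr = {cls x ws | x ws. valid x ws}, Dom = ufst,
     Cod = (\<lambda>z. pend (ufst z) (word z)), Ident = (\<lambda>x. cls x []),
     Comp = (\<lambda>w z. cls (ufst z) (word z @ word w))\<rparr>"

lemma Sum_simps [simp]:
  "Obj Sum = objs" "Dom Sum (cls x ws) = x" "Ident Sum x = cls x []"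
  "valid x ws \<Longrightarrow> cls x ws \<in> Arr Sum"
  by (auto simp: Sum_def)

lemma Cod_Sum [simp]: "valid x ws \<Longrightarrow> Cod Sum (cls x ws) = pend x ws"
  using word_cls[of x ws] eqv_valid by (simp add: Sum_def)

lemma Comp_Sum [simp]:
  assumes "valid x ws" "valid (pend x ws) vs"
  shows "cls (pend x ws) vs \<cdot>\<^bsub>Sum\<^esub> cls x ws = cls x (ws @ vs)"
proof -
  have "cls (pend x ws) vs \<cdot>\<^bsub>Sum\<^esub> cls x ws = cls x (word (cls x ws) @ word (cls (pend x ws) vs))"
    by (simp add: Sum_def)
  also have "\<dots> = cls x (ws @ vs)"
    by (rule cls_eqI[symmetric], rule eqv_append) (use assms word_cls in auto)
  finally show ?thesis .
qed

lemma Arr_Sum: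
  assumes "z \<in> Arr Sum"
  obtains x ws where "z = cls x ws" "valid x ws"
  using assms by (auto simp: Sum_def)

sublocale Sum: category Sum
proof (rule categoryI)
  fix f g assume "f \<in> Arr Sum" "g \<in> Arr Sum" "Cod Sum f = Dom Sum g"
  then show "g \<cdot>\<^bsub>Sum\<^esub> f \<in> Arr Sum \<and> Dom Sum (g \<cdot>\<^bsub>Sum\<^esub> f) = Dom Sum f \<and> Cod Sum (g \<cdot>\<^bsub>Sum\<^esub> f) = Cod Sum g"
    by (auto elim!: Arr_Sum)
next
  fix f assume "f \<in> Arr Sum"
  then obtain x ws where f: "f = cls x ws" "valid x ws" by (rule Arr_Sum)
  then show "Ident Sum (Cod Sum f) \<cdot>\<^bsub>Sum\<^esub> f = f" "f \<cdot>\<^bsub>Sum\<^esub> Ident Sum (Dom Sum f) = f"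
    using Comp_Sum[of x ws "[]"] Comp_Sum[of x "[]" ws] by (auto simp: pend_objs valid_objs)
next
  fix f g h assume "f \<in> Arr Sum" "g \<in> Arr Sum" "h \<in> Arr Sum" "Cod Sum f = Dom Sum g" "Cod Sum g = Dom Sum h"
  then obtain x ws vs us where f: "f = cls x ws" "g = cls (pend x ws) vs" "h = cls (pend (pend x ws) vs) us"
    "valid x ws" "valid (pend x ws) vs" "valid (pend (pend x ws) vs) us"
    by (auto elim!: Arr_Sum)
  then show "h \<cdot>\<^bsub>Sum\<^esub> g \<cdot>\<^bsub>Sum\<^esub> f = h \<cdot>\<^bsub>Sum\<^esub> (g \<cdot>\<^bsub>Sum\<^esub> f)"
    using Comp_Sum[of x "ws @ vs" us] by simp
qed (auto elim!: Arr_Sum simp: valid_objs pend_objs)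

lemma Comp_Sum_Nil [simp]:
  "z \<in> Arr Sum \<Longrightarrow> Dom Sum z = x \<Longrightarrow> z \<cdot>\<^bsub>Sum\<^esub> cls x [] = z"
  "z \<in> Arr Sum \<Longrightarrow> Cod Sum z = x \<Longrightarrow> cls x [] \<cdot>\<^bsub>Sum\<^esub> z = z"
  using Sum.Ident_right[of z x] Sum.Ident_left[of z x] by simp_all

lemma Dom_Cod_Sum_objs [simp]: "z \<in> Arr Sum \<Longrightarrow> Dom Sum z \<in> objs" "z \<in> Arr Sum \<Longrightarrow> Cod Sum z \<in> objs"
  using Sum.Dom_Obj[of z] Sum.Cod_Obj[of z] by simp_all

definition J :: "bool \<Rightarrow> ('u, 'u, 'u, 'u) fctr" where
  "J s = \<lparr>omap = ob s, amap = (\<lambda>f. cls (ob s (dm (C s) f)) [(s, f)])\<rparr>"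

lemma omap_J [simp]: "omap (J s) = ob s"
  by (simp add: J_def)

sublocale J: cat_functor "total (C s)" Sum "J s" for s
proof (rule cat_functorI)
  interpret Cs: category "total (C s)" by (rule I.T.A.category_axioms)
  fix f g assume h: "f \<in> Ar (C s)" "g \<in> Ar (C s)" "cd (C s) f = dm (C s) g"
  have "amap (J s) g \<cdot>\<^bsub>Sum\<^esub> amap (J s) f = cls (ob s (dm (C s) f)) [(s, f), (s, g)]"
    using Comp_Sum[of "ob s (dm (C s) f)" "[(s, f)]" "[(s, g)]"] h by (simp add: J_def)
  also have "\<dots> = amap (J s) (g \<cdot>\<^bsub>total (C s)\<^esub> f)"
    using h by (simp add: J_def cls_eqI eqv.comp)
  finally show "amap (J s) (g \<cdot>\<^bsub>total (C s)\<^esub> f) = amap (J s) g \<cdot>\<^bsub>Sum\<^esub> amap (J s) f" by simp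
next
  fix b assume "b \<in> Ob (C s)"
  then show "amap (J s) (idt (C s) b) = Ident Sum (omap (J s) b)"
    by (simp add: J_def cls_eqI eqv.ident)
qed (auto simp: I.T.A.category_axioms Sum.category_axioms J_def)

lemma J_I: "\<alpha> \<in> Ar A \<Longrightarrow> amap (J s) (fa (I s) \<alpha>) = amap (J t) (fa (I t) \<alpha>)"
  using cls_eqI[OF eqv.glued[of \<alpha> "[]" s t]] by (simp add: J_def)

text \<open>Peels off the letter applied first; inductions over words become inductions over
  composites in \<open>Sum\<close>.\<close>

lemma cls_Cons:
  assumes "valid (ob s (cd (C s) f)) ws" "f \<in> Ar (C s)"
  shows "cls (ob s (dm (C s) f)) ((s, f) # ws) =
    cls (ob s (cd (C s) f)) ws \<cdot>\<^bsub>Sum\<^esub> amap (J s) f"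
  using Comp_Sum[of "ob s (dm (C s) f)" "[(s, f)]" ws] assms by (simp add: J_def)

end

section \<open>Functors out of the sum\<close>

locale amalgam_cocone = amalgam E A C I for E :: "('u, 'u) cat" and A C I +
  fixes Z :: "('u, 'u) cat" and G :: "bool \<Rightarrow> ('u, 'u, 'u, 'u) fctr"
  assumes cocone: "cat_functor (total (C s)) Z (G s)"
    and compatible: "\<alpha> \<in> Ar A \<Longrightarrow>
      amap (G s) (fa (I s) \<alpha>) = amap (G t) (fa (I t) \<alpha>)"
begin

sublocale G: cat_functor "total (C s)" Z "G s" for s by (rule cocone)

definition gob :: "'u \<Rightarrow> 'u" where "gob = glue (\<lambda>s. omap (G s))"

lemma gob_ob [simp]: "b \<in> Ob (C s) \<Longrightarrow> gob (ob s b) = omap (G s) b"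
  unfolding gob_def
proof (rule glue_ob)
  fix a s t assume a: "a \<in> Ob A"
  then have "Dom Z (amap (G s) (fa (I s) (idt A a))) =
      Dom Z (amap (G t) (fa (I t) (idt A a)))"
    using compatible[of "idt A a" s t] by simp
  then show "omap (G s) (fo (I s) a) = omap (G t) (fo (I t) a)"
    using a by simp
qed

lemma gob_upair [simp]: "a \<in> Ob A \<Longrightarrow> gob (upair (utag True) a) = omap (G s) (fo (I s) a)"
  using gob_ob[of "fo (I s) a" s] by simp

primrec gword :: "'u \<Rightarrow> (bool \<times> 'u) list \<Rightarrow> 'u" where
  "gword x [] = Ident Z (gob x)"
| "gword x (w # ws) = gword (ob (fst w) (cd (C (fst w)) (snd w))) ws \<cdot>\<^bsub>Z\<^esub> amap (G (fst w)) (snd w)"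

lemma gob_Obj [simp]: "x \<in> objs \<Longrightarrow> gob x \<in> Obj Z"
  by (auto elim: objs_cases)

lemma gword [simp]:
  assumes "valid x ws"
  shows "gword x ws \<in> Arr Z" "Dom Z (gword x ws) = gob x" "Cod Z (gword x ws) = gob (pend x ws)"
  using assms by (induction ws arbitrary: x) auto

lemma gword_append: "valid x ws \<Longrightarrow> valid (pend x ws) vs \<Longrightarrow>
    gword x (ws @ vs) = gword (pend x ws) vs \<cdot>\<^bsub>Z\<^esub> gword x ws"
  by (induction ws arbitrary: x) auto

text \<open>Evaluation respects \<open>glued\<close> by compatibility of the cocone, and
  \<open>comp\<close> and \<open>ident\<close> by functoriality of each \<open>G s\<close>.\<close>

lemma gword_eqv: "eqv x ws ws' \<Longrightarrow> gword x ws = gword x ws'"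
proof (induction rule: eqv.induct)
  case (glued \<alpha> ws s t)
  then show ?case using compatible[of \<alpha> s t] by simp
qed auto

definition desc :: "('u, 'u, 'u, 'u) fctr" where
  "desc = \<lparr>omap = gob, amap = (\<lambda>z. gword (ufst z) (word z))\<rparr>"

lemma amap_desc_cls: "valid x ws \<Longrightarrow> amap desc (cls x ws) = gword x ws"
  using word_cls[of x ws] by (simp add: desc_def gword_eqv)

lemma amap_desc_Nil [simp]: "x \<in> objs \<Longrightarrow> amap desc (cls x []) = Ident Z (gob x)"
  by (simp add: amap_desc_cls)

lemma omap_desc [simp]: "omap desc = gob"
  by (simp add: desc_def)

sublocale desc: cat_functor Sum Z desc
proof (rule cat_functorI)
  interpret Z: category Z by (rule G.B.category_axioms)
  fix f g assume "f \<in> Arr Sum" "g \<in> Arr Sum" "Cod Sum f = Dom Sum g"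
  then show "amap desc (g \<cdot>\<^bsub>Sum\<^esub> f) = amap desc g \<cdot>\<^bsub>Z\<^esub> amap desc f"
    by (auto simp: amap_desc_cls gword_append elim!: Arr_Sum)
qed (auto simp: Sum.category_axioms G.B.category_axioms amap_desc_cls elim!: Arr_Sum)

lemma desc_J [simp]: "f \<in> Ar (C s) \<Longrightarrow> amap desc (amap (J s) f) = amap (G s) f"
  by (simp add: J_def amap_desc_cls)

text \<open>Letters generate: a word is a composite of letters, and the empty word at
  \<open>ob s b\<close> is the image of an identity of \<open>C s\<close>.\<close>

lemma desc_unique:
  assumes "cat_functor Sum Z F" "\<And>s f. f \<in> Ar (C s) \<Longrightarrow> amap F (amap (J s) f) = amap (G s) f"
    and "z \<in> Arr Sum"
  shows "amap F z = amap desc z"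
proof -
  interpret F: cat_functor Sum Z F by fact
  have "amap F (cls x ws) = amap desc (cls x ws)" if "valid x ws" for x ws
    using that
  proof (induction ws arbitrary: x)
    case Nil
    then obtain s b where x: "x = ob s b" "b \<in> Ob (C s)" by (auto elim: objs_cases)
    then have "amap F (amap (J s) (idt (C s) b)) = amap desc (amap (J s) (idt (C s) b))"
      using assms(2)[of "idt (C s) b" s] desc_J[of "idt (C s) b" s]
      by (metis I.T.A.Ident_Arr(1))
    then show ?case using x by simp
  next
    case (Cons w ws)
    obtain s f where w: "w = (s, f)" by (cases w)
    then have v: "valid (ob s (cd (C s) f)) ws" "f \<in> Ar (C s)" "x = ob s (dm (C s) f)"
      using Cons.prems by auto
    have "amap F (cls x (w # ws)) = amap F (cls (ob s (cd (C s) f)) ws) \<cdot>\<^bsub>Z\<^esub> amap F (amap (J s) f)"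
      using v w by (simp add: cls_Cons)
    also have "\<dots> = amap desc (cls (ob s (cd (C s) f)) ws) \<cdot>\<^bsub>Z\<^esub> amap desc (amap (J s) f)"
      using v Cons.IH assms(2) by simp
    also have "\<dots> = amap desc (cls x (w # ws))"
      using v w by (simp add: cls_Cons del: desc_J)
    finally show ?case .
  qed
  then show ?thesis using assms(3) by (auto elim: Arr_Sum)
qed

end

context amalgam
begin

text \<open>The projections themselves form a cocone, so \<open>base.desc\<close> is the projection
  of the sum to \<open>E\<close> and \<open>base.gword\<close> is the base arrow of a word.\<close>

sublocale base: amalgam_cocone E A C I E "\<lambda>s. proj (C s)"
  by unfold_locales simp_all

lemma base_gob_upair [simp]: "a \<in> Ob A \<Longrightarrow> base.gob (upair (utag True) a) = po A a"
  by (simp add: base.gob_upair[of _ True])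

abbreviation pob :: "'u \<Rightarrow> 'u" where "pob \<equiv> base.gob"
abbreviation par :: "'u \<Rightarrow> 'u" where "par \<equiv> amap base.desc"

section \<open>Compatible cleavages and the pullback of letters\<close>

definition clA :: "'u \<Rightarrow> 'u \<Rightarrow> 'u" where
  "clA a k = (SOME \<phi>. cart E A \<phi> \<and> cd A \<phi> = a \<and> pa A \<phi> = k)"

lemma clA:
  assumes "a \<in> Ob A" "k \<in> Arr E" "Cod E k = po A a"
  shows "cart E A (clA a k)" "cd A (clA a k) = a" "pa A (clA a k) = k"
proof -
  have "cart E A (clA a k) \<and> cd A (clA a k) = a \<and> pa A (clA a k) = k"
    unfolding clA_def by (rule someI_ex) (use I.S.cartesian_over[OF assms] in blast)
  then show "cart E A (clA a k)" "cd A (clA a k) = a" "pa A (clA a k) = k"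
    by auto
qed

definition cl :: "bool \<Rightarrow> 'u \<Rightarrow> 'u \<Rightarrow> 'u" where
  "cl s b k = (SOME \<phi>. cart E (C s) \<phi> \<and> cd (C s) \<phi> = b \<and> pa (C s) \<phi> = k \<and>
     (\<forall>a \<in> Ob A. b = fo (I s) a \<longrightarrow> \<phi> = fa (I s) (clA a k)))"

text \<open>Over an object coming from \<open>A\<close> the image of the lift chosen in
  \<open>A\<close> is taken; it is cartesian because \<open>I s\<close> preserves cartesian arrows,
  and well defined because \<open>I s\<close> is injective on objects. Elsewhere any lift
  serves.\<close>

lemma cl:
  assumes b: "b \<in> Ob (C s)" "k \<in> Arr E" "Cod E k = po (C s) b"
  shows "cart E (C s) (cl s b k)" "cd (C s) (cl s b k) = b"
    "pa (C s) (cl s b k) = k" "cl s b k \<in> Ar (C s)"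
    "a \<in> Ob A \<Longrightarrow> b = fo (I s) a \<Longrightarrow> cl s b k = fa (I s) (clA a k)"
proof -
  have "\<exists>\<phi>. cart E (C s) \<phi> \<and> cd (C s) \<phi> = b \<and> pa (C s) \<phi> = k \<and>
     (\<forall>a \<in> Ob A. b = fo (I s) a \<longrightarrow> \<phi> = fa (I s) (clA a k))"
  proof (cases "b \<in> fo (I s) ` Ob A")
    case True
    then obtain a where a: "a \<in> Ob A" "b = fo (I s) a" by auto
    have k: "Cod E k = po A a" using assms a by simp
    note c = clA[OF a(1) assms(2) k]
    have "clA a k \<in> Ar A" using c by simp
    then show ?thesis
      using c a inj_legs[of s] by (intro exI[of _ "fa (I s) (clA a k)"]) (auto simp: inj_on_def)
  next
    case False
    obtain \<phi> where "cart E (C s) \<phi>" "cd (C s) \<phi> = b" "pa (C s) \<phi> = k"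
      by (rule I.T.cartesian_over[OF assms])
    then show ?thesis using False by (intro exI[of _ \<phi>]) auto
  qed
  then have "cart E (C s) (cl s b k) \<and> cd (C s) (cl s b k) = b \<and>
      pa (C s) (cl s b k) = k \<and>
     (\<forall>a \<in> Ob A. b = fo (I s) a \<longrightarrow> cl s b k = fa (I s) (clA a k))"
    unfolding cl_def by (rule someI_ex)
  then show "cart E (C s) (cl s b k)" "cd (C s) (cl s b k) = b"
    "pa (C s) (cl s b k) = k" "cl s b k \<in> Ar (C s)"
    "a \<in> Ob A \<Longrightarrow> b = fo (I s) a \<Longrightarrow> cl s b k = fa (I s) (clA a k)"
    by auto
qed

lemma proj_Dom_cl [simp]:
  assumes "b \<in> Ob (C s)" "k \<in> Arr E" "Cod E k = po (C s) b"
  shows "po (C s) (dm (C s) (cl s b k)) = Dom E k"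
  using I.T.amap_Arr(2)[of "cl s b k" s] cl[OF assms] by simp

text \<open>The vertical arrow that \<open>f\<close> induces between chosen lifts: from the pullback
  of its domain along \<open>k\<close> to the pullback of its codomain along the composite of
  \<open>k\<close> with the base arrow of \<open>f\<close>.\<close>

definition is_pull :: "bool \<Rightarrow> 'u \<Rightarrow> 'u \<Rightarrow> 'u \<Rightarrow> bool" where
  "is_pull s k f \<chi> \<longleftrightarrow> \<chi> \<in> Ar (C s) \<and> dm (C s) \<chi> = dm (C s) (cl s (dm (C s) f) k) \<and>
     cd (C s) \<chi> = dm (C s) (cl s (cd (C s) f) (pa (C s) f \<cdot>\<^bsub>E\<^esub> k)) \<and>
     pa (C s) \<chi> = Ident E (Dom E k) \<and>
     cl s (cd (C s) f) (pa (C s) f \<cdot>\<^bsub>E\<^esub> k) \<cdot>\<^bsub>total (C s)\<^esub> \<chi> = f \<cdot>\<^bsub>total (C s)\<^esub> cl s (dm (C s) f) k"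

definition pull :: "bool \<Rightarrow> 'u \<Rightarrow> 'u \<Rightarrow> 'u" where "pull s k f = (SOME \<chi>. is_pull s k f \<chi>)"

lemma
  assumes f: "f \<in> Ar (C s)" and k: "k \<in> Arr E" "Cod E k = po (C s) (dm (C s) f)"
  shows pull: "is_pull s k f (pull s k f)"
    and pull_unique: "is_pull s k f \<chi> \<Longrightarrow> pull s k f = \<chi>"
proof -
  let ?b = "dm (C s) f" and ?c = "cd (C s) f" and ?l = "pa (C s) f \<cdot>\<^bsub>E\<^esub> k"
  have b: "?b \<in> Ob (C s)" and c: "?c \<in> Ob (C s)" using f by simp_all
  have l: "?l \<in> Arr E" "Cod E ?l = po (C s) ?c" "Dom E ?l = Dom E k" using f k by simp_all
  note cb = cl[OF b k] and cc = cl[OF c l(1,2)]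
  have d: "po (C s) (dm (C s) (cl s ?b k)) = Dom E k"
    "po (C s) (dm (C s) (cl s ?c ?l)) = Dom E k"
    using proj_Dom_cl[OF b k] proj_Dom_cl[OF c l(1,2)] l by simp_all
  obtain \<chi> where "\<chi> \<in> Ar (C s)" "dm (C s) \<chi> = dm (C s) (f \<cdot>\<^bsub>total (C s)\<^esub> cl s ?b k)"
    "cd (C s) \<chi> = dm (C s) (cl s ?c ?l)" "pa (C s) \<chi> = Ident E (Dom E k)"
    "cl s ?c ?l \<cdot>\<^bsub>total (C s)\<^esub> \<chi> = f \<cdot>\<^bsub>total (C s)\<^esub> cl s ?b k"
    by (rule I.T.cartesian_lift[OF cc(1), of "f \<cdot>\<^bsub>total (C s)\<^esub> cl s ?b k" "Ident E (Dom E k)"])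
      (use f k cb cc d in simp_all)
  then have "\<exists>\<chi>. is_pull s k f \<chi>" unfolding is_pull_def using f cb by auto
  then show p: "is_pull s k f (pull s k f)" unfolding pull_def by (rule someI_ex)
  show "pull s k f = \<chi>" if "is_pull s k f \<chi>" for \<chi>
    by (rule I.T.cartesian_cancel[OF cc(1)]) (use p that in \<open>auto simp: is_pull_def\<close>)
qed

lemma pull_simps [simp]:
  assumes "f \<in> Ar (C s)" "k \<in> Arr E" "Cod E k = po (C s) (dm (C s) f)"
  shows "pull s k f \<in> Ar (C s)"
    "dm (C s) (pull s k f) = dm (C s) (cl s (dm (C s) f) k)"
    "cd (C s) (pull s k f) = dm (C s) (cl s (cd (C s) f) (pa (C s) f \<cdot>\<^bsub>E\<^esub> k))"
    "pa (C s) (pull s k f) = Ident E (Dom E k)"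
    "cl s (cd (C s) f) (pa (C s) f \<cdot>\<^bsub>E\<^esub> k) \<cdot>\<^bsub>total (C s)\<^esub> pull s k f =
      f \<cdot>\<^bsub>total (C s)\<^esub> cl s (dm (C s) f) k"
  using pull[OF assms] by (auto simp: is_pull_def)

lemma pull_Ident [simp]:
  assumes "b \<in> Ob (C s)" "k \<in> Arr E" "Cod E k = po (C s) b"
  shows "pull s k (idt (C s) b) = idt (C s) (dm (C s) (cl s b k))"
  by (rule pull_unique) (use assms cl[OF assms] in \<open>simp_all add: is_pull_def\<close>)

text \<open>Stack the defining squares of \<open>f\<close> and \<open>g\<close>. The index of
  \<open>g\<close> is shifted by the base arrow of \<open>f\<close>.\<close>

lemma pull_Comp [simp]:
  assumes "f \<in> Ar (C s)" "g \<in> Ar (C s)" "cd (C s) f = dm (C s) g"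
    "k \<in> Arr E" "Cod E k = po (C s) (dm (C s) f)"
  shows "pull s k (g \<cdot>\<^bsub>total (C s)\<^esub> f) = pull s (pa (C s) f \<cdot>\<^bsub>E\<^esub> k) g \<cdot>\<^bsub>total (C s)\<^esub> pull s k f"
proof (rule pull_unique)
  let ?l = "pa (C s) f \<cdot>\<^bsub>E\<^esub> k"
  let ?m = "pa (C s) g \<cdot>\<^bsub>E\<^esub> ?l"
  have l: "?l \<in> Arr E" "Cod E ?l = po (C s) (dm (C s) g)" "Dom E ?l = Dom E k"
    "?m \<in> Arr E" "Cod E ?m = po (C s) (cd (C s) g)"
    using assms by simp_all
  note p = pull_simps[OF assms(1,4,5)] and q = pull_simps[OF assms(2) l(1,2)]
  note c1 = cl[of "dm (C s) f" s k] and c2 = cl[of "dm (C s) g" s ?l] and c3 = cl[of "cd (C s) g" s ?m]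
  have "cl s (cd (C s) g) ?m \<cdot>\<^bsub>total (C s)\<^esub> (pull s ?l g \<cdot>\<^bsub>total (C s)\<^esub> pull s k f) =
      (cl s (cd (C s) g) ?m \<cdot>\<^bsub>total (C s)\<^esub> pull s ?l g) \<cdot>\<^bsub>total (C s)\<^esub> pull s k f"
    using p(1-3) q(1-3) c3(2,4) l assms by (simp del: pull_simps(5))
  also have "\<dots> = (g \<cdot>\<^bsub>total (C s)\<^esub> cl s (dm (C s) g) ?l) \<cdot>\<^bsub>total (C s)\<^esub> pull s k f"
    using q(5) by simp
  also have "\<dots> = g \<cdot>\<^bsub>total (C s)\<^esub> (cl s (dm (C s) g) ?l \<cdot>\<^bsub>total (C s)\<^esub> pull s k f)"
    using p(1-3) c2(2,4) l assms by (simp del: pull_simps(5))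
  also have "\<dots> = g \<cdot>\<^bsub>total (C s)\<^esub> (f \<cdot>\<^bsub>total (C s)\<^esub> cl s (dm (C s) f) k)"
    using p(5) assms(3) by simp
  finally show "is_pull s k (g \<cdot>\<^bsub>total (C s)\<^esub> f) (pull s ?l g \<cdot>\<^bsub>total (C s)\<^esub> pull s k f)"
    unfolding is_pull_def using p(1-4) q(1-4) c1(2,4) l assms by simp
qed (use assms in simp_all)

text \<open>Since \<open>cl\<close> extends \<open>clA\<close> on both sides, the defining square of
  the pullback can be formed in \<open>A\<close> and mapped by \<open>I s\<close>. A single
  \<open>\<chi>\<close> serves both sides, as the relation \<open>glued\<close> requires.\<close>

lemma pull_I:
  assumes "\<alpha> \<in> Ar A" "k \<in> Arr E" "Cod E k = po A (dm A \<alpha>)"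
  obtains \<chi> where "\<chi> \<in> Ar A" "\<forall>s. pull s k (fa (I s) \<alpha>) = fa (I s) \<chi>"
    "dm A \<chi> = dm A (clA (dm A \<alpha>) k)"
    "cd A \<chi> = dm A (clA (cd A \<alpha>) (pa A \<alpha> \<cdot>\<^bsub>E\<^esub> k))"
proof -
  let ?b = "dm A \<alpha>" and ?c = "cd A \<alpha>" and ?l = "pa A \<alpha> \<cdot>\<^bsub>E\<^esub> k"
  have l: "?l \<in> Arr E" "Cod E ?l = po A ?c" "Dom E ?l = Dom E k" using assms by simp_all
  note cb = clA[of ?b k, OF _ assms(2,3)] and cc = clA[of ?c ?l, OF _ l(1,2)]
  have arr [simp]: "clA ?b k \<in> Ar A" "clA ?c ?l \<in> Ar A" using cb cc assms by simp_all
  have d: "po A (dm A (clA ?b k)) = Dom E k" "po A (dm A (clA ?c ?l)) = Dom E k"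
    using I.S.amap_Arr(2)[OF arr(1)] I.S.amap_Arr(2)[OF arr(2)] cb cc assms l by simp_all
  obtain \<chi> where \<chi>: "\<chi> \<in> Ar A" "dm A \<chi> = dm A (\<alpha> \<cdot>\<^bsub>total A\<^esub> clA ?b k)"
    "cd A \<chi> = dm A (clA ?c ?l)" "pa A \<chi> = Ident E (Dom E k)"
    "clA ?c ?l \<cdot>\<^bsub>total A\<^esub> \<chi> = \<alpha> \<cdot>\<^bsub>total A\<^esub> clA ?b k"
    by (rule I.S.cartesian_lift[of "clA ?c ?l" "\<alpha> \<cdot>\<^bsub>total A\<^esub> clA ?b k" "Ident E (Dom E k)"])
      (use assms cb cc d in simp_all)
  have \<chi>2: "dm A \<chi> = dm A (clA ?b k)" using \<chi>(2) cb assms by simp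
  have e: "cl s (fo (I s) ?b) k = fa (I s) (clA ?b k)"
    "cl s (fo (I s) ?c) ?l = fa (I s) (clA ?c ?l)" for s
    using cl(5)[of "fo (I s) ?b" s k ?b] cl(5)[of "fo (I s) ?c" s ?l ?c] assms l by simp_all
  have "fa (I s) (clA ?c ?l) \<cdot>\<^bsub>total (C s)\<^esub> fa (I s) \<chi> =
      fa (I s) \<alpha> \<cdot>\<^bsub>total (C s)\<^esub> fa (I s) (clA ?b k)" for s
    using arg_cong[OF \<chi>(5), of "fa (I s)"] \<chi>(1-3) cb cc assms by simp
  then have "is_pull s k (fa (I s) \<alpha>) (fa (I s) \<chi>)" for s
    using assms \<chi>(1,3,4) \<chi>2 by (simp add: is_pull_def e)
  then have "pull s k (fa (I s) \<alpha>) = fa (I s) \<chi>" for s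
    using assms by (intro pull_unique) simp_all
  then show thesis using \<chi>(1,3) \<chi>2 by (intro that[of \<chi>]) simp_all
qed

section \<open>Pullback of words along arrows of the base\<close>

definition star :: "'u \<Rightarrow> 'u \<Rightarrow> 'u" where
  "star k = glue (\<lambda>s b. if Cod E k = po (C s) b then ob s (dm (C s) (cl s b k)) else undefined)"

text \<open>The guard in \<open>star\<close> matters here: \<open>glue_ob\<close> asks for agreement
  at every object of \<open>A\<close>, while \<open>cl\<close> is specified only for arrows into the
  right base object.\<close>

lemma
  assumes k: "k \<in> Arr E"
  shows star_ob [simp]: "b \<in> Ob (C s) \<Longrightarrow> Cod E k = po (C s) b \<Longrightarrow>
      star k (ob s b) = ob s (dm (C s) (cl s b k))"
    and star_upair [simp]: "a \<in> Ob A \<Longrightarrow> Cod E k = po A a \<Longrightarrow>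
      star k (upair (utag True) a) = upair (utag True) (dm A (clA a k))"
proof -
  have c: "cl s (fo (I s) a) k = fa (I s) (clA a k)" "clA a k \<in> Ar A"
    if "a \<in> Ob A" "Cod E k = po A a" for s a
    using cl(5)[of "fo (I s) a" s k a] clA(1)[of a k] that k by simp_all
  show *: "star k (ob s b) = ob s (dm (C s) (cl s b k))"
    if "b \<in> Ob (C s)" "Cod E k = po (C s) b" for s b
    unfolding star_def by (subst glue_ob) (use that in \<open>auto simp: c\<close>)
  show "star k (upair (utag True) a) = upair (utag True) (dm A (clA a k))"
    if "a \<in> Ob A" "Cod E k = po A a"
    using *[of "fo (I True) a" True] that by (simp add: c)
qed

primrec pullw :: "'u \<Rightarrow> (bool \<times> 'u) list \<Rightarrow> (bool \<times> 'u) list" where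
  "pullw k [] = []"
| "pullw k (w # ws) = (fst w, pull (fst w) k (snd w)) # pullw (pa (C (fst w)) (snd w) \<cdot>\<^bsub>E\<^esub> k) ws"

text \<open>Each letter is pulled back along the arrow reached so far, so consecutive pullbacks fit
  together. Every pulled letter is vertical, hence so is the word.\<close>

lemma pullw:
  assumes "valid x ws" "k \<in> Arr E" "Cod E k = pob x"
  shows "valid (star k x) (pullw k ws)"
    and "pend (star k x) (pullw k ws) = star (base.gword x ws \<cdot>\<^bsub>E\<^esub> k) (pend x ws)"
    and "base.gword (star k x) (pullw k ws) = Ident E (Dom E k)"
proof -
  have "valid (star k x) (pullw k ws) \<and>
      pend (star k x) (pullw k ws) = star (base.gword x ws \<cdot>\<^bsub>E\<^esub> k) (pend x ws) \<and>
      base.gword (star k x) (pullw k ws) = Ident E (Dom E k)"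
    using assms
  proof (induction ws arbitrary: x k)
    case Nil
    then show ?case by (auto elim!: objs_cases simp: cl)
  next
    case (Cons w ws)
    obtain s f where w: "w = (s, f)" by (cases w)
    then have v: "valid (ob s (cd (C s) f)) ws" "f \<in> Ar (C s)" "x = ob s (dm (C s) f)"
      using Cons.prems by auto
    have k: "k \<in> Arr E" "Cod E k = po (C s) (dm (C s) f)" using Cons.prems(2,3) v by simp_all
    have "pob (pend (ob s (cd (C s) f)) ws) = Cod E (base.gword (ob s (cd (C s) f)) ws)"
      using v by simp
    then show ?case
      using Cons.IH[OF v(1), of "pa (C s) f \<cdot>\<^bsub>E\<^esub> k"] v k by (simp add: w)
  qed
  then show "valid (star k x) (pullw k ws)"
    "pend (star k x) (pullw k ws) = star (base.gword x ws \<cdot>\<^bsub>E\<^esub> k) (pend x ws)"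
    "base.gword (star k x) (pullw k ws) = Ident E (Dom E k)" by auto
qed

lemma pullw_append:
  "valid x ws \<Longrightarrow> valid (pend x ws) vs \<Longrightarrow> k \<in> Arr E \<Longrightarrow> Cod E k = pob x \<Longrightarrow>
    pullw k (ws @ vs) = pullw k ws @ pullw (base.gword x ws \<cdot>\<^bsub>E\<^esub> k) vs"
proof (induction ws arbitrary: x k)
  case Nil
  then show ?case by simp
next
  case (Cons w ws)
  obtain s f where w: "w = (s, f)" by (cases w)
  then have v: "valid (ob s (cd (C s) f)) ws" "f \<in> Ar (C s)" "x = ob s (dm (C s) f)"
    using Cons.prems by auto
  then show ?case
    using Cons.IH[of "ob s (cd (C s) f)" "pa (C s) f \<cdot>\<^bsub>E\<^esub> k"] Cons.prems by (simp add: w)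
qed

text \<open>The point of the compatible cleavages: \<open>comp\<close> is preserved by
  \<open>pull_Comp\<close>, \<open>ident\<close> by \<open>pull_Ident\<close> and
  \<open>glued\<close> by \<open>pull_I\<close>, so the pullback descends to arrows of the
  sum.\<close>

lemma pullw_eqv:
  "eqv x ws ws' \<Longrightarrow> k \<in> Arr E \<Longrightarrow> Cod E k = pob x \<Longrightarrow> eqv (star k x) (pullw k ws) (pullw k ws')"
proof (induction arbitrary: k rule: eqv.induct)
  case (refl x ws)
  then show ?case by (intro eqv.refl pullw)
next
  case (sym x ws ws')
  then show ?case by (auto intro: eqv.sym)
next
  case (trans x ws ws' ws'')
  then show ?case by (blast intro: eqv.trans)
next
  case (Cons f s ws ws')
  let ?l = "pa (C s) f \<cdot>\<^bsub>E\<^esub> k"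
  have k: "Cod E k = po (C s) (dm (C s) f)" using Cons by simp
  have "eqv (star ?l (ob s (cd (C s) f))) (pullw ?l ws) (pullw ?l ws')"
    by (rule Cons.IH) (use Cons.hyps Cons.prems k in simp_all)
  then show ?case using eqv.Cons[of "pull s k f" s "pullw ?l ws" "pullw ?l ws'"] Cons.hyps Cons.prems k by simp
next
  case (comp f s g ws)
  let ?l = "pa (C s) f \<cdot>\<^bsub>E\<^esub> k"
  let ?m = "pa (C s) g \<cdot>\<^bsub>E\<^esub> ?l"
  have k: "Cod E k = po (C s) (dm (C s) f)" using comp by simp
  have "valid (star ?m (ob s (cd (C s) g))) (pullw ?m ws)"
    by (rule pullw) (use comp k in simp_all)
  then show ?case
    using eqv.comp[of "pull s k f" s "pull s ?l g" "pullw ?m ws"] comp k by simp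
next
  case (ident b s ws)
  have k: "Cod E k = po (C s) b" using ident by simp
  have "valid (star k (ob s b)) (pullw k ws)" by (rule pullw) (use ident k in simp_all)
  then show ?case using eqv.ident[of "dm (C s) (cl s b k)" s "pullw k ws"] ident k cl[of b s k] by simp
next
  case (glued \<alpha> ws s t)
  let ?l = "pa A \<alpha> \<cdot>\<^bsub>E\<^esub> k"
  have k: "Cod E k = po A (dm A \<alpha>)" using glued by simp
  obtain \<chi> where \<chi>: "\<chi> \<in> Ar A" "\<forall>s. pull s k (fa (I s) \<alpha>) = fa (I s) \<chi>"
    "dm A \<chi> = dm A (clA (dm A \<alpha>) k)"
    "cd A \<chi> = dm A (clA (cd A \<alpha>) ?l)"
    by (rule pull_I[OF glued.hyps(1) glued.prems(1) k])
  have "valid (star ?l (upair (utag True) (cd A \<alpha>))) (pullw ?l ws)"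
    by (rule pullw) (use glued k in simp_all)
  then show ?case
    using eqv.glued[of \<chi> "pullw ?l ws" s t] \<chi> glued k by simp
qed

section \<open>Pullback of arrows of the sum and cartesian letters\<close>

definition cc :: "'u \<Rightarrow> 'u \<Rightarrow> 'u" where
  "cc k = glue (\<lambda>s b. if Cod E k = po (C s) b then amap (J s) (cl s b k) else undefined)"

lemma cc_ob [simp]:
  assumes "b \<in> Ob (C s)" "k \<in> Arr E" "Cod E k = po (C s) b"
  shows "cc k (ob s b) = amap (J s) (cl s b k)"
proof -
  have c: "cl s (fo (I s) a) k = fa (I s) (clA a k)" "clA a k \<in> Ar A"
    if "a \<in> Ob A" "Cod E k = po A a" for s a
    using cl(5)[of "fo (I s) a" s k a] clA(1)[of a k] that assms(2) by simp_all
  show ?thesis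
    unfolding cc_def by (subst glue_ob) (use assms in \<open>auto simp: c intro: J_I\<close>)
qed

definition pullz :: "'u \<Rightarrow> 'u \<Rightarrow> 'u" where
  "pullz k z = cls (star k (ufst z)) (pullw k (word z))"

lemma pullz_cls:
  assumes "valid x ws" "k \<in> Arr E" "Cod E k = pob x"
  shows "pullz k (cls x ws) = cls (star k x) (pullw k ws)"
  using cls_eqI[OF pullw_eqv[OF word_cls(2)[OF assms(1)] assms(2,3)]] by (simp add: pullz_def)

lemma pullz:
  assumes "z \<in> Arr Sum" "k \<in> Arr E" "Cod E k = pob (Dom Sum z)"
  shows "pullz k z \<in> Arr Sum" "Dom Sum (pullz k z) = star k (Dom Sum z)"
    "Cod Sum (pullz k z) = star (par z \<cdot>\<^bsub>E\<^esub> k) (Cod Sum z)" "par (pullz k z) = Ident E (Dom E k)"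
proof -
  obtain x ws where z: "z = cls x ws" "valid x ws" using assms(1) by (rule Arr_Sum)
  note p = pullw[OF z(2) assms(2), unfolded pullz_cls]
  show "pullz k z \<in> Arr Sum" "Dom Sum (pullz k z) = star k (Dom Sum z)"
    "Cod Sum (pullz k z) = star (par z \<cdot>\<^bsub>E\<^esub> k) (Cod Sum z)" "par (pullz k z) = Ident E (Dom E k)"
    using z p assms by (simp_all add: pullz_cls base.amap_desc_cls)
qed

lemma pullz_Comp:
  assumes "z \<in> Arr Sum" "w \<in> Arr Sum" "Cod Sum z = Dom Sum w" "k \<in> Arr E" "Cod E k = pob (Dom Sum z)"
  shows "pullz k (w \<cdot>\<^bsub>Sum\<^esub> z) = pullz (par z \<cdot>\<^bsub>E\<^esub> k) w \<cdot>\<^bsub>Sum\<^esub> pullz k z"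
proof -
  obtain x ws where z: "z = cls x ws" "valid x ws" using assms(1) by (rule Arr_Sum)
  obtain vs where w: "w = cls (pend x ws) vs" "valid (pend x ws) vs" using assms(2,3) z by (auto elim: Arr_Sum)
  have k: "Cod E k = pob x" using assms z by simp
  note p = pullw[OF z(2) assms(4) k]
  have "valid (pend (star k x) (pullw k ws)) (pullw (base.gword x ws \<cdot>\<^bsub>E\<^esub> k) vs)"
    unfolding p(2) by (rule pullw) (use z w k assms(4) in simp_all)
  then show ?thesis
    using z w k assms(4) p Comp_Sum[of "star k x" "pullw k ws" "pullw (base.gword x ws \<cdot>\<^bsub>E\<^esub> k) vs"]
    by (simp add: pullz_cls base.amap_desc_cls pullw_append)
qed

lemma pullz_J:
  assumes "f \<in> Ar (C s)" "k \<in> Arr E" "Cod E k = po (C s) (dm (C s) f)"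
  shows "pullz k (amap (J s) f) = amap (J s) (pull s k f)"
  using assms by (simp add: J_def pullz_cls)

text \<open>The arrow \<open>cc k x\<close> is the chosen lift of \<open>k\<close> at
  \<open>x\<close>, viewed in the sum; that such lifts remain cartesian there is shown in
  \<open>J_cartesian\<close>.\<close>

lemma cc [simp]:
  assumes "x \<in> objs" "k \<in> Arr E" "Cod E k = pob x"
  shows "cc k x \<in> Arr Sum" "Dom Sum (cc k x) = star k x" "Cod Sum (cc k x) = x" "par (cc k x) = k"
proof -
  obtain s b where x: "x = ob s b" "b \<in> Ob (C s)" using assms(1) by (rule objs_cases)
  have k: "Cod E k = po (C s) b" using assms x by simp
  note c = cl[OF x(2) assms(2) k]
  show "cc k x \<in> Arr Sum" "Dom Sum (cc k x) = star k x" "Cod Sum (cc k x) = x" "par (cc k x) = k"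
    using x k c(2,3,4) assms(2) by simp_all
qed

text \<open>The cleavage is not normalized, so pulling back along an identity replaces
  \<open>x\<close> by an isomorphic object. This isomorphism is needed to return to
  \<open>x\<close>.\<close>

lemma iso_cc:
  assumes "x \<in> objs"
  shows "iso Sum (cc (Ident E (pob x)) x)"
proof -
  obtain s b where x: "x = ob s b" "b \<in> Ob (C s)" using assms by (rule objs_cases)
  let ?i = "Ident E (po (C s) b)"
  have i: "?i \<in> Arr E" "Cod E ?i = po (C s) b" using x(2) by simp_all
  note c = cl[OF x(2) i]
  have "iso (total (C s)) (cl s b ?i)"
    by (rule I.T.cartesian_over_iso[OF c(1)]) (use c x(2) in simp)
  then show ?thesis using x i by simp
qed

text \<open>The defining square of \<open>pull\<close>, extended from letters to words by pasting
  the square of the first letter to that of the rest.\<close>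

lemma cc_natural:
  assumes "z \<in> Arr Sum" "k \<in> Arr E" "Cod E k = pob (Dom Sum z)"
  shows "cc (par z \<cdot>\<^bsub>E\<^esub> k) (Cod Sum z) \<cdot>\<^bsub>Sum\<^esub> pullz k z = z \<cdot>\<^bsub>Sum\<^esub> cc k (Dom Sum z)"
proof -
  obtain x ws where z: "z = cls x ws" "valid x ws" using assms(1) by (rule Arr_Sum)
  have "cc (par (cls x ws) \<cdot>\<^bsub>E\<^esub> k) (pend x ws) \<cdot>\<^bsub>Sum\<^esub> pullz k (cls x ws) = cls x ws \<cdot>\<^bsub>Sum\<^esub> cc k x"
    using z(2) assms(2,3)[unfolded z] unfolding Sum_simps
  proof (induction ws arbitrary: x k)
    case Nil
    then show ?case
      using Sum.Ident_left[of "cc k x" x] Sum.Ident_right[of "cc k x" "star k x"]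
      by (simp add: pullz_cls base.amap_desc_cls)
  next
    case (Cons w ws)
    obtain s f where w: "w = (s, f)" by (cases w)
    let ?y = "ob s (cd (C s) f)" and ?l = "pa (C s) f \<cdot>\<^bsub>E\<^esub> k"
    have v: "valid ?y ws" "f \<in> Ar (C s)" "x = ob s (dm (C s) f)"
      using Cons.prems w by auto
    have k: "k \<in> Arr E" "Cod E k = po (C s) (dm (C s) f)" using Cons.prems(2,3) v by simp_all
    have l: "?l \<in> Arr E" "Cod E ?l = po (C s) (cd (C s) f)" using k v by simp_all
    have L: "cls ?y ws \<in> Arr Sum" "par (cls ?y ws) \<in> Arr E" "Dom E (par (cls ?y ws)) = po (C s) (cd (C s) f)"
      "Cod E (par (cls ?y ws)) = pob (pend ?y ws)"
      using v by (simp_all add: base.amap_desc_cls)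
    have IH: "cc (par (cls ?y ws) \<cdot>\<^bsub>E\<^esub> ?l) (pend ?y ws) \<cdot>\<^bsub>Sum\<^esub> pullz ?l (cls ?y ws) = cls ?y ws \<cdot>\<^bsub>Sum\<^esub> cc ?l ?y"
      by (rule Cons.IH) (use v l in simp_all)
    have e: "cls x (w # ws) = cls ?y ws \<cdot>\<^bsub>Sum\<^esub> amap (J s) f" using v w by (simp add: cls_Cons)
    have pe: "par (cls x (w # ws)) \<cdot>\<^bsub>E\<^esub> k = par (cls ?y ws) \<cdot>\<^bsub>E\<^esub> ?l"
      unfolding e using v k L by simp
    have pz: "pullz k (cls x (w # ws)) = pullz ?l (cls ?y ws) \<cdot>\<^bsub>Sum\<^esub> amap (J s) (pull s k f)"
      unfolding e using v k L pullz_Comp[of "amap (J s) f" "cls ?y ws" k] by (simp add: pullz_J)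
    note pl = pullz[OF L(1) l(1), unfolded Sum_simps]
    have plA: "pullz ?l (cls ?y ws) \<in> Arr Sum" "Dom Sum (pullz ?l (cls ?y ws)) = ob s (dm (C s) (cl s (cd (C s) f) ?l))"
      "Cod Sum (pullz ?l (cls ?y ws)) = star (par (cls ?y ws) \<cdot>\<^bsub>E\<^esub> ?l) (pend ?y ws)"
      using pl v l k by simp_all
    have c: "cc (par (cls ?y ws) \<cdot>\<^bsub>E\<^esub> ?l) (pend ?y ws) \<in> Arr Sum"
      "Dom Sum (cc (par (cls ?y ws) \<cdot>\<^bsub>E\<^esub> ?l) (pend ?y ws)) = star (par (cls ?y ws) \<cdot>\<^bsub>E\<^esub> ?l) (pend ?y ws)"
      using L l v by (simp_all add: pend_objs)
    note cf = cl[of "dm (C s) f" s k] and cg = cl[of "cd (C s) f" s ?l, OF _ l]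
    \<comment> \<open>The induction hypothesis moves the lift past the tail of the word, then the
      square of the letter \<open>f\<close> moves it past \<open>f\<close>.\<close>
    have "cc (par (cls ?y ws) \<cdot>\<^bsub>E\<^esub> ?l) (pend ?y ws) \<cdot>\<^bsub>Sum\<^esub> (pullz ?l (cls ?y ws) \<cdot>\<^bsub>Sum\<^esub> amap (J s) (pull s k f)) =
      (cls ?y ws \<cdot>\<^bsub>Sum\<^esub> cc ?l ?y) \<cdot>\<^bsub>Sum\<^esub> amap (J s) (pull s k f)"
      unfolding IH[symmetric] using c plA v k by simp
    also have "\<dots> = cls ?y ws \<cdot>\<^bsub>Sum\<^esub> amap (J s) (cl s (cd (C s) f) ?l \<cdot>\<^bsub>total (C s)\<^esub> pull s k f)"
      using v k l L(1) cg(2,4) by (simp del: pull_simps(5))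
    also have "\<dots> = cls ?y ws \<cdot>\<^bsub>Sum\<^esub> amap (J s) (f \<cdot>\<^bsub>total (C s)\<^esub> cl s (dm (C s) f) k)"
      using v k by simp
    also have "\<dots> = (cls ?y ws \<cdot>\<^bsub>Sum\<^esub> amap (J s) f) \<cdot>\<^bsub>Sum\<^esub> cc k x"
      using v k L(1) cf(2,4) by simp
    finally show ?case unfolding pe pz unfolding e by (simp add: w)
  qed
  then show ?thesis using z by simp
qed

text \<open>Pulling an arbitrary arrow of the sum back along an identity leaves a vertical arrow
  ending at a chosen lift, which can be compared with \<open>\<phi>\<close> inside the single
  category \<open>C s\<close>. This yields existence; uniqueness follows because the pullback of
  \<open>\<phi>\<close> itself is an isomorphism.\<close>

lemma J_cartesian:
  assumes \<phi>: "cart E (C s) \<phi>"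
  shows "cartesian Sum E base.desc (amap (J s) \<phi>)"
proof (rule base.desc.cartesianI)
  let ?y = "dm (C s) \<phi>" and ?x = "cd (C s) \<phi>" and ?f = "pa (C s) \<phi>"
  have \<phi>A [simp]: "\<phi> \<in> Ar (C s)" using \<phi> by simp
  show "amap (J s) \<phi> \<in> Arr Sum" by simp
  \<comment> \<open>Both \<open>\<phi>\<close> after the chosen lift of \<open>h\<close> and the
    chosen lift of the composite base arrow are cartesian with the same image, so a vertical
    isomorphism \<open>\<iota>\<close> relates them.\<close>
  have iota: thesis if h: "h \<in> Arr E" "Cod E h = po (C s) ?y" and
    goal: "\<And>\<iota>. iso (total (C s)) \<iota> \<Longrightarrow> dm (C s) \<iota> = dm (C s) (cl s ?y h) \<Longrightarrow>
      cd (C s) \<iota> = dm (C s) (cl s ?x (?f \<cdot>\<^bsub>E\<^esub> h)) \<Longrightarrow> pa (C s) \<iota> = Ident E (Dom E h) \<Longrightarrow>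
      \<phi> \<cdot>\<^bsub>total (C s)\<^esub> cl s ?y h = cl s ?x (?f \<cdot>\<^bsub>E\<^esub> h) \<cdot>\<^bsub>total (C s)\<^esub> \<iota> \<Longrightarrow> thesis" for h thesis
  proof -
    have l: "?f \<cdot>\<^bsub>E\<^esub> h \<in> Arr E" "Cod E (?f \<cdot>\<^bsub>E\<^esub> h) = po (C s) ?x" "Dom E (?f \<cdot>\<^bsub>E\<^esub> h) = Dom E h"
      using h by simp_all
    note c1 = cl[of ?y s h, OF _ h] and c2 = cl[of ?x s "?f \<cdot>\<^bsub>E\<^esub> h", OF _ l(1,2)]
    have c1': "cart E (C s) (cl s ?y h)" "cd (C s) (cl s ?y h) = ?y" "cl s ?y h \<in> Ar (C s)"
      "pa (C s) (cl s ?y h) = h" using c1 by simp_all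
    have c2': "cart E (C s) (cl s ?x (?f \<cdot>\<^bsub>E\<^esub> h))" "cd (C s) (cl s ?x (?f \<cdot>\<^bsub>E\<^esub> h)) = ?x"
      "pa (C s) (cl s ?x (?f \<cdot>\<^bsub>E\<^esub> h)) = ?f \<cdot>\<^bsub>E\<^esub> h" using c2 by simp_all
    have c3: "cart E (C s) (\<phi> \<cdot>\<^bsub>total (C s)\<^esub> cl s ?y h)" using \<phi> c1' by simp
    have e: "cd (C s) (\<phi> \<cdot>\<^bsub>total (C s)\<^esub> cl s ?y h) = cd (C s) (cl s ?x (?f \<cdot>\<^bsub>E\<^esub> h))"
      "pa (C s) (\<phi> \<cdot>\<^bsub>total (C s)\<^esub> cl s ?y h) = pa (C s) (cl s ?x (?f \<cdot>\<^bsub>E\<^esub> h))"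
      using c1' c2' by simp_all
    have d: "po (C s) (dm (C s) (cl s ?x (?f \<cdot>\<^bsub>E\<^esub> h))) = Dom E h"
      using proj_Dom_cl[of ?x s "?f \<cdot>\<^bsub>E\<^esub> h"] l by simp
    have e2: "dm (C s) (\<phi> \<cdot>\<^bsub>total (C s)\<^esub> cl s ?y h) = dm (C s) (cl s ?y h)"
      using c1' by simp
    obtain \<iota> where \<iota>: "iso (total (C s)) \<iota>"
      "dm (C s) \<iota> = dm (C s) (\<phi> \<cdot>\<^bsub>total (C s)\<^esub> cl s ?y h)"
      "cd (C s) \<iota> = dm (C s) (cl s ?x (?f \<cdot>\<^bsub>E\<^esub> h))"
      "pa (C s) \<iota> = Ident E (po (C s) (dm (C s) (cl s ?x (?f \<cdot>\<^bsub>E\<^esub> h))))"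
      "\<phi> \<cdot>\<^bsub>total (C s)\<^esub> cl s ?y h = cl s ?x (?f \<cdot>\<^bsub>E\<^esub> h) \<cdot>\<^bsub>total (C s)\<^esub> \<iota>"
      by (rule I.T.cartesian_unique[OF c2'(1) c3 e])
    show thesis by (rule goal[OF \<iota>(1) \<iota>(2)[unfolded e2] \<iota>(3) \<iota>(4)[unfolded d] \<iota>(5)])
  qed
  {
    fix z h
    assume h: "z \<in> Arr Sum" "Cod Sum z = Cod Sum (amap (J s) \<phi>)" "h \<in> Arr E" "Dom E h = omap base.desc (Dom Sum z)"
      "Cod E h = omap base.desc (Dom Sum (amap (J s) \<phi>))" "par (amap (J s) \<phi>) \<cdot>\<^bsub>E\<^esub> h = par z"
    have h': "Cod Sum z = ob s ?x" "Dom E h = pob (Dom Sum z)" "Cod E h = po (C s) ?y" "?f \<cdot>\<^bsub>E\<^esub> h = par z"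
      using h by simp_all
    obtain \<iota> where \<iota>: "iso (total (C s)) \<iota>" "dm (C s) \<iota> = dm (C s) (cl s ?y h)"
      "cd (C s) \<iota> = dm (C s) (cl s ?x (par z))" "pa (C s) \<iota> = Ident E (Dom E h)"
      "\<phi> \<cdot>\<^bsub>total (C s)\<^esub> cl s ?y h = cl s ?x (par z) \<cdot>\<^bsub>total (C s)\<^esub> \<iota>"
      using iota[OF h(3) h'(3)] unfolding h'(4) by blast
    let ?i = "Ident E (pob (Dom Sum z))" and ?d = "Dom Sum z"
    have i: "?i \<in> Arr E" "Cod E ?i = pob ?d" "Dom E ?i = pob ?d" using h(1) by simp_all
    have "Cod E (par z) = pob (Cod Sum z)" using h(1) by simp
    then have pz2: "Cod E (par z) = po (C s) ?x"
      unfolding h'(1) by (simp only: base.gob_ob I.T.A.Cod_Obj \<phi>A)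
    have "par z \<cdot>\<^bsub>E\<^esub> ?i = par z" using h(1) by simp
    note pz = this pz2
    note D = pullz[OF h(1) i(1,2)]
    have ci: "iso Sum (cc ?i ?d)" using h(1) by (simp add: iso_cc)
    have cA: "cc ?i ?d \<in> Arr Sum" "Dom Sum (cc ?i ?d) = star ?i ?d" "Cod Sum (cc ?i ?d) = ?d" "par (cc ?i ?d) = ?i"
      using h(1) i by simp_all
    have c1: "cl s ?y h \<in> Ar (C s)" "cd (C s) (cl s ?y h) = ?y" "pa (C s) (cl s ?y h) = h"
      using cl[of ?y s h] h(3) h'(3) by simp_all
    have c2: "cl s ?x (par z) \<in> Ar (C s)" "cd (C s) (cl s ?x (par z)) = ?x"
      using cl[of ?x s "par z"] h(1) pz by simp_all
    have D': "Cod Sum (pullz ?i z) = ob s (dm (C s) (cl s ?x (par z)))"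
      using D(3) h'(1) pz h(1) by simp
    let ?\<iota> = "inv_arr (total (C s)) \<iota>"
    let ?c = "inv_arr Sum (cc ?i ?d)"
    \<comment> \<open>Read from right to left: pass from the domain of \<open>z\<close> to its
      pullback, apply the vertical pullback of \<open>z\<close>, correct by \<open>\<iota>\<close>,
      and return by the chosen lift of \<open>h\<close>.\<close>
    let ?\<chi> = "amap (J s) (cl s ?y h \<cdot>\<^bsub>total (C s)\<^esub> ?\<iota>) \<cdot>\<^bsub>Sum\<^esub> (pullz ?i z \<cdot>\<^bsub>Sum\<^esub> ?c)"
    have A1: "cl s ?y h \<cdot>\<^bsub>total (C s)\<^esub> ?\<iota> \<in> Ar (C s)" "dm (C s) (cl s ?y h \<cdot>\<^bsub>total (C s)\<^esub> ?\<iota>) = dm (C s) (cl s ?x (par z))"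
      "cd (C s) (cl s ?y h \<cdot>\<^bsub>total (C s)\<^esub> ?\<iota>) = ?y"
      using c1 \<iota>(1-3) by simp_all
    have A2: "pullz ?i z \<cdot>\<^bsub>Sum\<^esub> ?c \<in> Arr Sum" "Dom Sum (pullz ?i z \<cdot>\<^bsub>Sum\<^esub> ?c) = ?d"
      "Cod Sum (pullz ?i z \<cdot>\<^bsub>Sum\<^esub> ?c) = ob s (dm (C s) (cl s ?x (par z)))"
      using D(1,2) D' ci cA by simp_all
    have chi: "?\<chi> \<in> Arr Sum" "Dom Sum ?\<chi> = ?d" "Cod Sum ?\<chi> = ob s ?y" using A1 A2 by simp_all
    have "\<phi> \<cdot>\<^bsub>total (C s)\<^esub> (cl s ?y h \<cdot>\<^bsub>total (C s)\<^esub> ?\<iota>) = (\<phi> \<cdot>\<^bsub>total (C s)\<^esub> cl s ?y h) \<cdot>\<^bsub>total (C s)\<^esub> ?\<iota>"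
      using c1 \<iota>(1-3) by simp
    also have "\<dots> = cl s ?x (par z)" unfolding \<iota>(5) using c2 \<iota>(1-3) by simp
    finally have e: "\<phi> \<cdot>\<^bsub>total (C s)\<^esub> (cl s ?y h \<cdot>\<^bsub>total (C s)\<^esub> ?\<iota>) = cl s ?x (par z)" .
    have "amap (J s) \<phi> \<cdot>\<^bsub>Sum\<^esub> ?\<chi> = amap (J s) (\<phi> \<cdot>\<^bsub>total (C s)\<^esub> (cl s ?y h \<cdot>\<^bsub>total (C s)\<^esub> ?\<iota>)) \<cdot>\<^bsub>Sum\<^esub> (pullz ?i z \<cdot>\<^bsub>Sum\<^esub> ?c)"
      using A1 A2 by (simp only: J.amap_comp \<phi>A) simp
    also have "\<dots> = (cc (par z) (Cod Sum z) \<cdot>\<^bsub>Sum\<^esub> pullz ?i z) \<cdot>\<^bsub>Sum\<^esub> ?c"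
      unfolding e h'(1) using c2 D(1,2) D' ci cA pz h(1) by simp
    also have "\<dots> = (z \<cdot>\<^bsub>Sum\<^esub> cc ?i ?d) \<cdot>\<^bsub>Sum\<^esub> ?c"
      using cc_natural[OF h(1) i(1,2)] pz by simp
    also have "\<dots> = z" using h(1) ci cA by simp
    finally have "amap (J s) \<phi> \<cdot>\<^bsub>Sum\<^esub> ?\<chi> = z" .
    moreover have "par ?\<chi> = h"
    proof -
      have "par ?\<chi> = pa (C s) (cl s ?y h \<cdot>\<^bsub>total (C s)\<^esub> ?\<iota>) \<cdot>\<^bsub>E\<^esub> (par (pullz ?i z) \<cdot>\<^bsub>E\<^esub> par ?c)"
        using A1 A2 D(1,2) ci cA by (simp only: base.desc.amap_comp J.amap_Arr base.desc_J omap_J Sum.inv_arr)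
      also have "\<dots> = h" using c1 \<iota> D ci cA h' h i by simp
      finally show ?thesis .
    qed
    ultimately show "\<exists>\<chi>\<in>Arr Sum. Dom Sum \<chi> = Dom Sum z \<and> Cod Sum \<chi> = Dom Sum (amap (J s) \<phi>) \<and> par \<chi> = h \<and>
        amap (J s) \<phi> \<cdot>\<^bsub>Sum\<^esub> \<chi> = z"
      using chi by (intro bexI[of _ ?\<chi>]) simp_all
  next
    fix z z'
    assume h: "z \<in> Arr Sum" "z' \<in> Arr Sum" "Cod Sum z = Dom Sum (amap (J s) \<phi>)" "Cod Sum z' = Dom Sum (amap (J s) \<phi>)"
      "Dom Sum z = Dom Sum z'" "par z = par z'" "amap (J s) \<phi> \<cdot>\<^bsub>Sum\<^esub> z = amap (J s) \<phi> \<cdot>\<^bsub>Sum\<^esub> z'"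
    let ?d = "Dom Sum z'"
    let ?i = "Ident E (pob ?d)"
    let ?h = "par z'"
    have i: "?i \<in> Arr E" "Cod E ?i = pob ?d" "Dom E ?i = pob ?d" using h(2) by simp_all
    have hE: "?h \<in> Arr E" "Cod E ?h = po (C s) ?y" "?h \<cdot>\<^bsub>E\<^esub> ?i = ?h"
      using h(2,4) base.desc.amap_Arr(3)[OF h(2)] by simp_all
    obtain \<iota> where \<iota>: "iso (total (C s)) \<iota>" "dm (C s) \<iota> = dm (C s) (cl s ?y ?h)"
      "cd (C s) \<iota> = dm (C s) (cl s ?x (?f \<cdot>\<^bsub>E\<^esub> ?h))" "pa (C s) \<iota> = Ident E (Dom E ?h)"
      "\<phi> \<cdot>\<^bsub>total (C s)\<^esub> cl s ?y ?h = cl s ?x (?f \<cdot>\<^bsub>E\<^esub> ?h) \<cdot>\<^bsub>total (C s)\<^esub> \<iota>"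
      using iota[OF hE(1,2)] by blast
    \<comment> \<open>The equation for \<open>\<iota>\<close> is exactly the square defining the
      pullback of \<open>\<phi>\<close>. Its invertibility allows it to be cancelled from the
      pullbacks of the two composites.\<close>
    have "pull s ?h \<phi> = \<iota>" by (rule pull_unique) (use \<iota> hE in \<open>simp_all add: is_pull_def\<close>)
    then have iso: "iso Sum (amap (J s) (pull s ?h \<phi>))" using \<iota> by simp
    have e: "pullz ?i (amap (J s) \<phi> \<cdot>\<^bsub>Sum\<^esub> w) = amap (J s) (pull s ?h \<phi>) \<cdot>\<^bsub>Sum\<^esub> pullz ?i w"
      if "w \<in> Arr Sum" "Cod Sum w = ob s ?y" "Dom Sum w = ?d" "par w = ?h" for w
      using pullz_Comp[of w "amap (J s) \<phi>" ?i] that i hE by (simp add: pullz_J)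
    have ez: "pullz ?i z \<in> Arr Sum" "pullz ?i z' \<in> Arr Sum" "Cod Sum (pullz ?i z) = ob s (dm (C s) (cl s ?y ?h))"
      "Cod Sum (pullz ?i z') = ob s (dm (C s) (cl s ?y ?h))"
      using pullz[OF h(1), of ?i] pullz[OF h(2), of ?i] h(1-6) i hE by simp_all
    have L: "pullz ?i z = pullz ?i z'"
    proof (rule Sum.iso_cancel_left[OF iso])
      show "amap (J s) (pull s ?h \<phi>) \<cdot>\<^bsub>Sum\<^esub> pullz ?i z = amap (J s) (pull s ?h \<phi>) \<cdot>\<^bsub>Sum\<^esub> pullz ?i z'"
        using e[of z] e[of z'] h by simp
    qed (use ez hE in simp_all)
    have ci: "iso Sum (cc ?i ?d)" using h(2) by (simp add: iso_cc)
    \<comment> \<open>Equal pullbacks give equal composites with the isomorphism \<open>cc\<close>,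
      by naturality.\<close>
    have "z \<cdot>\<^bsub>Sum\<^esub> cc ?i ?d = z' \<cdot>\<^bsub>Sum\<^esub> cc ?i ?d"
      using cc_natural[OF h(1), of ?i] cc_natural[OF h(2), of ?i] L h(3-6) i by simp
    then show "z = z'"
      by (rule Sum.iso_cancel_right[OF ci]) (use h(1-5) i in simp_all)
  }
qed

section \<open>The sum as a pushout of fibred categories\<close>

definition Pushout :: "'u fibred_cat" where "Pushout = mk_fib Sum base.desc"

definition leg :: "bool \<Rightarrow> 'u fib_map" where "leg s = mk_map (C s) Pushout (J s)"

lemma Pushout_fibred: "fibred_category E Pushout"
  unfolding Pushout_def
proof (rule mk_fib_fibred[OF base.desc.cat_functor_axioms])
  fix y f assume "y \<in> Obj Sum" "f \<in> Arr E" "Cod E f = omap base.desc y"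
  moreover then obtain s b where "y = ob s b" "b \<in> Ob (C s)" by (auto elim: objs_cases)
  ultimately show "\<exists>\<phi>. cartesian Sum E base.desc \<phi> \<and> Cod Sum \<phi> = y \<and> par \<phi> = f"
    using cl[of b s f] J_cartesian by (intro exI[of _ "amap (J s) (cl s b f)"]) simp
qed

lemma leg: "fib_arrow E (C s) Pushout (leg s)"
proof -
  have "leg s \<in> Arr (Fib E)"
    unfolding leg_def
  proof (rule mk_map_Arr)
    show "cat_functor (total (C s)) (total Pushout) (J s)"
      by (simp add: Pushout_def cat_functor_norm J.cat_functor_axioms)
    show "over (total (C s)) (proj (C s)) (J s) (proj Pushout)"
      by (auto simp: over_def Pushout_def)
    show "cart E Pushout (amap (J s) \<phi>)"
      if "cart E (C s) \<phi>" for \<phi>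
      using J_cartesian[OF that] by (simp add: Pushout_def base.desc.cat_functor_axioms)
  qed (auto simp: I.base Pushout_fibred I.T.fib)
  then show ?thesis by (intro fib_arrow.intro) (simp_all add: I.base leg_def)
qed

lemma pushout_leg: "pushout_square (Fib E) (I True) (I False) (leg True) (leg False)"
  unfolding pushout_square_def
proof (intro conjI ballI impI)
  show "leg True \<cdot>\<^bsub>Fib E\<^esub> I True = leg False \<cdot>\<^bsub>Fib E\<^esub> I False"
    by (rule fib_map_eqI[OF fib_arrow_Comp[OF legs leg] fib_arrow_Comp[OF legs leg]])
      (use J_I in \<open>auto simp: leg_def\<close>)
  fix Z u v
  assume uv: "u \<in> hom (Fib E) (Cod (Fib E) (I True)) Z" "v \<in> hom (Fib E) (Cod (Fib E) (I False)) Z"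
    and sq: "u \<cdot>\<^bsub>Fib E\<^esub> I True = v \<cdot>\<^bsub>Fib E\<^esub> I False"
  define w where "w s = (if s then u else v)" for s
  have w: "fib_arrow E (C s) Z (w s)" for s
    using uv by (cases s) (simp_all add: w_def fib_arrow_hom[OF I.base])
  interpret w: fib_arrow E "C s" Z "w s" for s by (rule w)
  have comp: "fa (w s) (fa (I s) \<alpha>) = fa (w t) (fa (I t) \<alpha>)"
    if "\<alpha> \<in> Ar A" for \<alpha> s t
    using Fib_square(1)[OF legs legs sq that] by (cases s; cases t) (simp_all add: w_def)
  interpret co: amalgam_cocone E A C I "total Z" "\<lambda>s. fun_of (w s)"
    by unfold_locales (rule comp)
  let ?r = "mk_map Pushout Z co.desc"
  \<comment> \<open>The projection of \<open>Z\<close> after the induced functor extends the cocone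
    of projections, so it is the projection of the sum by uniqueness.\<close>
  have o: "pa Z (amap co.desc z) = par z" if "z \<in> Arr Sum" for z
  proof -
    let ?F = "\<lparr>omap = \<lambda>x. po Z (omap co.desc x), amap = \<lambda>z. pa Z (amap co.desc z)\<rparr>"
    have "cat_functor Sum E ?F"
      by (rule cat_functorI) (auto simp: Sum.category_axioms I.base)
    then have "amap ?F z = par z" by (rule base.desc_unique) (use that in simp_all)
    then show ?thesis by simp
  qed
  have "?r \<in> Arr (Fib E)"
  proof (rule mk_map_Arr_lifts)
    show "cat_functor (total Pushout) (total Z) co.desc"
      by (simp add: Pushout_def cat_functor_norm co.desc.cat_functor_axioms)
    show "over (total Pushout) (proj Pushout) co.desc (proj Z)"
      by (simp add: over_def Pushout_def o)
    fix y f assume h: "y \<in> Ob Pushout" "f \<in> Arr E" "Cod E f = po Pushout y"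
    then obtain s b where y: "y = ob s b" "b \<in> Ob (C s)" by (auto simp: Pushout_def elim: objs_cases)
    have f: "Cod E f = po (C s) b" using h y by (simp add: Pushout_def)
    note c = cl[OF y(2) h(2) f]
    \<comment> \<open>Letters from the cleavage suffice as test lifts, and the induced functor acts
      on them as the cartesian functor \<open>w s\<close>.\<close>
    show "\<exists>\<phi>. cart E Pushout \<phi> \<and> cd Pushout \<phi> = y \<and>
        pa Pushout \<phi> = f \<and> cart E Z (amap co.desc \<phi>)"
      using J_cartesian[OF c(1)] c y
      by (intro exI[of _ "amap (J s) (cl s b f)"]) (simp add: Pushout_def base.desc.cat_functor_axioms)
  qed (auto simp: I.base Pushout_fibred w.T.fib)
  then have r: "fib_arrow E Pushout Z ?r" by (intro fib_arrow.intro) (simp_all add: I.base)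
  have rl: "?r \<cdot>\<^bsub>Fib E\<^esub> leg s = w s" for s
    by (rule fib_map_eqI[OF fib_arrow_Comp[OF leg r] w]) (simp add: leg_def, simp add: Pushout_def)
  show "\<exists>!r. r \<in> hom (Fib E) (Cod (Fib E) (leg True)) Z \<and> r \<cdot>\<^bsub>Fib E\<^esub> leg True = u \<and> r \<cdot>\<^bsub>Fib E\<^esub> leg False = v"
  proof (rule ex1I[of _ ?r], intro conjI)
    show "?r \<in> hom (Fib E) (Cod (Fib E) (leg True)) Z"
      using fib_arrow.arrow[OF r] by (simp add: hom_def leg_def)
    show "?r \<cdot>\<^bsub>Fib E\<^esub> leg True = u" "?r \<cdot>\<^bsub>Fib E\<^esub> leg False = v"
      using rl[of True] rl[of False] by (simp_all add: w_def)
    fix r' assume r': "r' \<in> hom (Fib E) (Cod (Fib E) (leg True)) Z \<and> r' \<cdot>\<^bsub>Fib E\<^esub> leg True = u \<and> r' \<cdot>\<^bsub>Fib E\<^esub> leg False = v"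
    then have "fib_arrow E Pushout Z r'" by (intro fib_arrow_hom[OF I.base]) (simp add: leg_def)
    then interpret r': fib_arrow E Pushout Z r' .
    have r'l: "r' \<cdot>\<^bsub>Fib E\<^esub> leg s = w s" for s using r' by (cases s) (simp_all add: w_def)
    show "r' = ?r"
    proof (rule fib_map_eqI[OF r'.fib_arrow_axioms r])
      fix z assume z: "z \<in> Ar Pushout"
      \<comment> \<open>The carrier of \<open>Pushout\<close> is the normalization of
        \<open>Sum\<close>; uniqueness is stated for functors on \<open>Sum\<close> itself.\<close>
      have F: "cat_functor Sum (total Z) (fun_of r')"
      proof (rule cat_functorI)
        fix f g assume "f \<in> Arr Sum" "g \<in> Arr Sum" "Cod Sum f = Dom Sum g"
        then show "fa r' (g \<cdot>\<^bsub>Sum\<^esub> f) = fa r' g \<cdot>\<^bsub>total Z\<^esub> fa r' f"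
          using r'.amap_comp[of f g] by (simp add: Pushout_def)
      qed (use r'.omap_Obj r'.amap_Arr r'.amap_Id in \<open>auto simp: Pushout_def Sum.category_axioms w.T.A.category_axioms\<close>)
      have J: "fa r' (amap (J s) f) = fa (w s) f" if "f \<in> Ar (C s)" for s f
        using arg_cong[OF r'l[of s], of "\<lambda>h. fa h f"] that by (simp add: leg_def)
      have zS: "z \<in> Arr Sum" using z by (simp add: Pushout_def)
      show "fa r' z = fa ?r z"
        using co.desc_unique[OF F J zS] z by simp
    qed
  qed
qed (use I.arrow fib_arrow.arrow[OF leg[of True]] fib_arrow.arrow[OF leg[of False]] in \<open>simp_all add: leg_def\<close>)

end

lemma (in infinite_base) pushout_injections:
  assumes "fib_arrow E A B i" "fib_arrow E A X g" "i \<in> E_injections E" "g \<in> E_injections E"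
  shows "\<exists>P h k. fib_arrow E B P h \<and> fib_arrow E X P k \<and> pushout_square (Fib E) i g h k"
proof -
  interpret amalgam E A "\<lambda>s. if s then B else X" "\<lambda>s. if s then i else g"
    by (intro amalgam.intro amalgam_axioms.intro infinite_base_axioms)
      (use assms fib_arrow.E_injections_iff[OF assms(1)] fib_arrow.E_injections_iff[OF assms(2)] in auto)
  show ?thesis using leg[of True] leg[of False] pushout_leg by auto
qed

section \<open>Pushout squares\<close>

lemma pushout_squareD:
  assumes "pushout_square M f g h k"
  shows "f \<in> Arr M" "g \<in> Arr M" "h \<in> Arr M" "k \<in> Arr M" "Dom M f = Dom M g" "Dom M h = Cod M f"
    "Dom M k = Cod M g" "Cod M h = Cod M k" "h \<cdot>\<^bsub>M\<^esub> f = k \<cdot>\<^bsub>M\<^esub> g"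
  using assms by (simp_all add: pushout_square_def)

lemma pushout_square_sym:
  assumes "pushout_square M f g h k"
  shows "pushout_square M g f k h"
proof -
  note d = pushout_squareD[OF assms]
  have *: "\<exists>!r. r \<in> hom M (Cod M k) z \<and> r \<cdot>\<^bsub>M\<^esub> k = s \<and> r \<cdot>\<^bsub>M\<^esub> h = t"
    if "z \<in> Obj M" "s \<in> hom M (Cod M g) z" "t \<in> hom M (Cod M f) z" "s \<cdot>\<^bsub>M\<^esub> g = t \<cdot>\<^bsub>M\<^esub> f" for z s t
  proof -
    have "\<exists>!r. r \<in> hom M (Cod M h) z \<and> r \<cdot>\<^bsub>M\<^esub> h = t \<and> r \<cdot>\<^bsub>M\<^esub> k = s"
      using assms that(1-3) that(4)[symmetric] unfolding pushout_square_def by blast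
    then show ?thesis by (simp only: d(8) conj_ac)
  qed
  show ?thesis
    unfolding pushout_square_def
    by (intro conjI ballI impI d(1-4,6,7) d(5,8,9)[symmetric]) (rule *; assumption)
qed

context category
begin

lemma pushout_desc:
  assumes "pushout_square C f g h k" "s \<in> Arr C" "t \<in> Arr C" "Dom C s = Cod C f" "Dom C t = Cod C g"
    "Cod C s = Cod C t" "s \<cdot> f = t \<cdot> g"
  obtains r where "r \<in> Arr C" "Dom C r = Cod C h" "Cod C r = Cod C s" "r \<cdot> h = s" "r \<cdot> k = t"
proof -
  have "s \<in> hom C (Cod C f) (Cod C s)" "t \<in> hom C (Cod C g) (Cod C s)" "Cod C s \<in> Obj C"
    using assms(2-6) by (simp_all add: hom_def)
  then have "\<exists>!r. r \<in> hom C (Cod C h) (Cod C s) \<and> r \<cdot> h = s \<and> r \<cdot> k = t"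
    using assms(1,7) unfolding pushout_square_def by blast
  then show thesis using that by (auto simp: hom_def)
qed

lemma pushout_unique:
  assumes sq: "pushout_square C f g h k" and "r \<in> Arr C" "r' \<in> Arr C" "Dom C r = Cod C h" "Dom C r' = Cod C h"
    "Cod C r = Cod C r'" "r \<cdot> h = r' \<cdot> h" "r \<cdot> k = r' \<cdot> k"
  shows "r = r'"
proof -
  note d = pushout_squareD[OF sq]
  have "(r' \<cdot> h) \<cdot> f = (r' \<cdot> k) \<cdot> g" using assms(2-6) d by simp
  moreover have "r' \<cdot> h \<in> hom C (Cod C f) (Cod C r')" "r' \<cdot> k \<in> hom C (Cod C g) (Cod C r')" "Cod C r' \<in> Obj C"
    using assms(2-6) d by (simp_all add: hom_def)
  ultimately have "\<exists>!m. m \<in> hom C (Cod C h) (Cod C r') \<and> m \<cdot> h = r' \<cdot> h \<and> m \<cdot> k = r' \<cdot> k"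
    using sq unfolding pushout_square_def by blast
  then show ?thesis using assms by (auto simp: hom_def)
qed

lemma pushout_squareI:
  assumes "f \<in> Arr C" "g \<in> Arr C" "h \<in> Arr C" "k \<in> Arr C" "Dom C f = Dom C g" "Dom C h = Cod C f"
    "Dom C k = Cod C g" "Cod C h = Cod C k" "h \<cdot> f = k \<cdot> g"
    and ex: "\<And>s t. s \<in> Arr C \<Longrightarrow> t \<in> Arr C \<Longrightarrow> Dom C s = Cod C f \<Longrightarrow> Dom C t = Cod C g \<Longrightarrow> Cod C s = Cod C t \<Longrightarrow>
      s \<cdot> f = t \<cdot> g \<Longrightarrow> \<exists>r \<in> Arr C. Dom C r = Cod C h \<and> Cod C r = Cod C s \<and> r \<cdot> h = s \<and> r \<cdot> k = t"
    and un: "\<And>r r'. r \<in> Arr C \<Longrightarrow> r' \<in> Arr C \<Longrightarrow> Dom C r = Cod C h \<Longrightarrow> Dom C r' = Cod C h \<Longrightarrow>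
      Cod C r = Cod C r' \<Longrightarrow> r \<cdot> h = r' \<cdot> h \<Longrightarrow> r \<cdot> k = r' \<cdot> k \<Longrightarrow> r = r'"
  shows "pushout_square C f g h k"
  unfolding pushout_square_def
proof (intro conjI ballI impI)
  fix z s t assume st: "s \<in> hom C (Cod C f) z" "t \<in> hom C (Cod C g) z" "s \<cdot> f = t \<cdot> g"
  then obtain r where r: "r \<in> Arr C" "Dom C r = Cod C h" "Cod C r = z" "r \<cdot> h = s" "r \<cdot> k = t"
    using ex[of s t] by (auto simp: hom_def)
  show "\<exists>!r. r \<in> hom C (Cod C h) z \<and> r \<cdot> h = s \<and> r \<cdot> k = t"
  proof (rule ex1I[of _ r])
    show "r \<in> hom C (Cod C h) z \<and> r \<cdot> h = s \<and> r \<cdot> k = t" using r by (simp add: hom_def)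
    fix r' assume "r' \<in> hom C (Cod C h) z \<and> r' \<cdot> h = s \<and> r' \<cdot> k = t"
    then show "r' = r" using r by (intro un[of r' r]) (simp_all add: hom_def)
  qed
qed fact+

lemma pushout_paste:
  assumes sq1: "pushout_square C i j h1 k1" and sq2: "pushout_square C k1 q h2 k2"
  shows "pushout_square C i (q \<cdot> j) (h2 \<cdot> h1) k2"
proof -
  note d1 = pushout_squareD[OF sq1] and d2 = pushout_squareD[OF sq2]
  show ?thesis
  proof (rule pushout_squareI)
    have "(h2 \<cdot> h1) \<cdot> i = h2 \<cdot> (h1 \<cdot> i)" using d1(1-8) d2(1-8) by simp
    also have "\<dots> = (h2 \<cdot> k1) \<cdot> j" using d1 d2(1-8) by simp
    also have "\<dots> = k2 \<cdot> (q \<cdot> j)" unfolding d2(9) using d1(1-8) d2(1-8) by simp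
    finally show "h2 \<cdot> h1 \<cdot> i = k2 \<cdot> (q \<cdot> j)" .
  next
    fix s t
    assume h: "s \<in> Arr C" "t \<in> Arr C" "Dom C s = Cod C i" "Dom C t = Cod C (q \<cdot> j)" "Cod C s = Cod C t"
      "s \<cdot> i = t \<cdot> (q \<cdot> j)"
    have e: "s \<cdot> i = (t \<cdot> q) \<cdot> j" using h d1(1-8) d2(1-8) by simp
    obtain r1 where r1: "r1 \<in> Arr C" "Dom C r1 = Cod C h1" "Cod C r1 = Cod C s" "r1 \<cdot> h1 = s" "r1 \<cdot> k1 = t \<cdot> q"
      by (rule pushout_desc[OF sq1 _ _ _ _ _ e]) (use h(1-5) d1(1-8) d2(1-8) in simp_all)
    obtain r2 where r2: "r2 \<in> Arr C" "Dom C r2 = Cod C h2" "Cod C r2 = Cod C r1" "r2 \<cdot> h2 = r1" "r2 \<cdot> k2 = t"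
      by (rule pushout_desc[OF sq2, of r1 t]) (use r1 h(1-5) d1(1-8) d2(1-8) in simp_all)
    have "r2 \<cdot> (h2 \<cdot> h1) = (r2 \<cdot> h2) \<cdot> h1" using r2(1-3) d1(1-8) d2(1-8) by simp
    also have "\<dots> = s" unfolding r2(4) by (rule r1(4))
    finally show "\<exists>r\<in>Arr C. Dom C r = Cod C (h2 \<cdot> h1) \<and> Cod C r = Cod C s \<and> r \<cdot> (h2 \<cdot> h1) = s \<and> r \<cdot> k2 = t"
      using r1(3) r2 d1(1-8) d2(1-8) by (intro bexI[of _ r2]) simp_all
  next
    fix r r'
    assume h: "r \<in> Arr C" "r' \<in> Arr C" "Dom C r = Cod C (h2 \<cdot> h1)" "Dom C r' = Cod C (h2 \<cdot> h1)"
      "Cod C r = Cod C r'" "r \<cdot> (h2 \<cdot> h1) = r' \<cdot> (h2 \<cdot> h1)" "r \<cdot> k2 = r' \<cdot> k2"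
    have D: "Dom C r = Cod C h2" "Dom C r' = Cod C h2" using h(3,4) d1(1-8) d2(1-8) by simp_all
    have "(r \<cdot> h2) \<cdot> h1 = (r' \<cdot> h2) \<cdot> h1" using h(1,2,5,6) D d1(1-8) d2(1-8) by simp
    moreover have "(x \<cdot> h2) \<cdot> k1 = (x \<cdot> k2) \<cdot> q" if "x \<in> Arr C" "Dom C x = Cod C h2" for x
      using that d1(1-8) d2 by simp
    then have "(r \<cdot> h2) \<cdot> k1 = (r' \<cdot> h2) \<cdot> k1" using h(1,2,7) D by simp
    ultimately have "r \<cdot> h2 = r' \<cdot> h2"
      by (intro pushout_unique[OF sq1, of "r \<cdot> h2" "r' \<cdot> h2"]) (use h(1,2,5) D d1(1-8) d2(1-8) in simp_all)
    then show "r = r'" by (intro pushout_unique[OF sq2, of r r']) (use h(1,2,5,7) D in simp_all)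
  qed (use d1(1-8) d2(1-8) in simp_all)
qed

text \<open>A cocone on the right square restricts along \<open>h1\<close> to a cocone on the outer
  one. The arrow so obtained is correct on \<open>m\<close> because the first square is a
  pushout.\<close>

lemma pushout_paste_cancel:
  assumes sq1: "pushout_square C i j h1 k1" and sq: "pushout_square C i (q \<cdot> j) h k"
    and "q \<in> Arr C" "Dom C q = Cod C j"
    and m: "m \<in> Arr C" "Dom C m = Cod C h1" "Cod C m = Cod C h" "m \<cdot> h1 = h" "m \<cdot> k1 = k \<cdot> q"
  shows "pushout_square C k1 q m k"
proof -
  note d1 = pushout_squareD[OF sq1] and d = pushout_squareD[OF sq]
  have kq: "Dom C k = Cod C q" using d assms(3,4) d1 by simp
  show ?thesis
  proof (rule pushout_squareI)
    fix s t
    assume h: "s \<in> Arr C" "t \<in> Arr C" "Dom C s = Cod C k1" "Dom C t = Cod C q" "Cod C s = Cod C t"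
      "s \<cdot> k1 = t \<cdot> q"
    have D: "Dom C s = Cod C h1" using h d1(8) by simp
    have "(s \<cdot> h1) \<cdot> i = (s \<cdot> k1) \<cdot> j" using h(1-5) d1 by simp
    also have "\<dots> = t \<cdot> (q \<cdot> j)" unfolding h(6) using h(1-5) d1(1-8) assms(3,4) by simp
    finally have e: "(s \<cdot> h1) \<cdot> i = t \<cdot> (q \<cdot> j)" .
    obtain r where r: "r \<in> Arr C" "Dom C r = Cod C h" "Cod C r = Cod C (s \<cdot> h1)" "r \<cdot> h = s \<cdot> h1" "r \<cdot> k = t"
      by (rule pushout_desc[OF sq _ _ _ _ _ e]) (use h(1-5) D d1(1-8) assms(3,4) in simp_all)
    have Cr: "Cod C r = Cod C s" using r(3) h(1) D d1(3) by simp
    have "r \<cdot> m = s"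
    proof (rule pushout_unique[OF sq1])
      have "(r \<cdot> m) \<cdot> h1 = r \<cdot> (m \<cdot> h1)" using r(1,2) m(1-3) d1(1-8) by simp
      then show "(r \<cdot> m) \<cdot> h1 = s \<cdot> h1" unfolding m(4) r(4) .
      have "(r \<cdot> m) \<cdot> k1 = r \<cdot> (m \<cdot> k1)" using r(1,2) m(1-3) d1(1-8) by simp
      also have "\<dots> = (r \<cdot> k) \<cdot> q" unfolding m(5) using r(1,2) d(1-8) kq assms(3) by simp
      finally show "(r \<cdot> m) \<cdot> k1 = s \<cdot> k1" unfolding r(5) h(6) .
    qed (use r(1,2) m(1-3) h(1) D Cr in simp_all)
    then show "\<exists>r\<in>Arr C. Dom C r = Cod C m \<and> Cod C r = Cod C s \<and> r \<cdot> m = s \<and> r \<cdot> k = t"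
      using r(1,2,5) m(3) Cr by (intro bexI[of _ r]) simp_all
  next
    fix r r'
    assume h: "r \<in> Arr C" "r' \<in> Arr C" "Dom C r = Cod C m" "Dom C r' = Cod C m" "Cod C r = Cod C r'"
      "r \<cdot> m = r' \<cdot> m" "r \<cdot> k = r' \<cdot> k"
    have "x \<cdot> h = (x \<cdot> m) \<cdot> h1" if "x \<in> Arr C" "Dom C x = Cod C m" for x
      using that m d1(1-8) by simp
    then have "r \<cdot> h = r' \<cdot> h" using h by simp
    then show "r = r'" by (intro pushout_unique[OF sq, of r r']) (use h(1-5,7) m(3) in simp_all)
  qed (use m d(1-8) d1(1-8) assms(3,4) kq in simp_all)
qed

text \<open>Solve the lifting problem for \<open>f\<close> obtained by restricting along
  \<open>g\<close> and \<open>h\<close>; its solution and \<open>s\<close> together form a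
  cocone.\<close>

lemma has_lift_pushout:
  assumes sq: "pushout_square C f g h k" and "has_lift C f p" and p: "p \<in> Arr C"
  shows "has_lift C k p"
  unfolding has_lift_def
proof (intro ballI impI)
  note d = pushout_squareD[OF sq]
  fix s t assume "s \<in> hom C (Dom C k) (Dom C p)" "t \<in> hom C (Cod C k) (Cod C p)" and e: "p \<cdot> s = t \<cdot> k"
  then have st: "s \<in> Arr C" "Dom C s = Dom C k" "Cod C s = Dom C p" "t \<in> Arr C" "Dom C t = Cod C k" "Cod C t = Cod C p"
    by (simp_all add: hom_def)
  have "p \<cdot> (s \<cdot> g) = (p \<cdot> s) \<cdot> g" using st d(1-8) p by simp
  also have "\<dots> = (t \<cdot> h) \<cdot> f" unfolding e using st d p by simp
  finally have "p \<cdot> (s \<cdot> g) = (t \<cdot> h) \<cdot> f" .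
  moreover have "s \<cdot> g \<in> hom C (Dom C f) (Dom C p)" "t \<cdot> h \<in> hom C (Cod C f) (Cod C p)"
    using st d(1-8) p by (simp_all add: hom_def)
  ultimately obtain l where l: "l \<in> hom C (Cod C f) (Dom C p)" "l \<cdot> f = s \<cdot> g" "p \<cdot> l = t \<cdot> h"
    using assms(2) unfolding has_lift_def by blast
  then have lA: "l \<in> Arr C" "Dom C l = Cod C f" "Cod C l = Dom C p" by (simp_all add: hom_def)
  obtain r where r: "r \<in> Arr C" "Dom C r = Cod C h" "Cod C r = Cod C l" "r \<cdot> h = l" "r \<cdot> k = s"
    by (rule pushout_desc[OF sq, of l s]) (use lA l(2) st d(1-8) in simp_all)
  have "p \<cdot> r = t"
  proof (rule pushout_unique[OF sq])
    have "(p \<cdot> r) \<cdot> h = p \<cdot> (r \<cdot> h)" using r(1-3) p lA d(1-8) by simp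
    then show "(p \<cdot> r) \<cdot> h = t \<cdot> h" unfolding r(4) l(3) .
    have "(p \<cdot> r) \<cdot> k = p \<cdot> (r \<cdot> k)" using r(1-3) p lA d(1-8) by simp
    then show "(p \<cdot> r) \<cdot> k = t \<cdot> k" unfolding r(5) e .
  qed (use r(1-3) p lA st d(1-8) in simp_all)
  then show "\<exists>d\<in>hom C (Cod C k) (Dom C p). d \<cdot> k = s \<and> p \<cdot> d = t"
    using r lA d(8) by (intro bexI[of _ r]) (simp_all add: hom_def)
qed

end

section \<open>Weak factorization systems\<close>

text \<open>The retract argument: an arrow with a lifting property, factored as
  \<open>p \<cdot> j\<close>, lifts against one of its own factors and thereby becomes a retract of
  the other. What remains are the two closure conditions \<open>left\<close> and
  \<open>right\<close>.\<close>

lemma (in category) weak_factorization_systemI: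
  assumes sub: "L \<subseteq> Arr C" "R \<subseteq> Arr C"
    and lift: "\<And>i p. i \<in> L \<Longrightarrow> p \<in> R \<Longrightarrow> has_lift C i p"
    and fact: "\<And>f. f \<in> Arr C \<Longrightarrow> \<exists>j \<in> L. \<exists>p \<in> R. Cod C j = Dom C p \<and> f = p \<cdot> j"
    and left: "\<And>j p d. j \<in> L \<Longrightarrow> p \<in> R \<Longrightarrow> Cod C j = Dom C p \<Longrightarrow> d \<in> hom C (Cod C p) (Dom C p) \<Longrightarrow>
      d \<cdot> (p \<cdot> j) = j \<Longrightarrow> p \<cdot> d = Ident C (Cod C p) \<Longrightarrow> p \<cdot> j \<in> L"
    and right: "\<And>j p r. j \<in> L \<Longrightarrow> p \<in> R \<Longrightarrow> Cod C j = Dom C p \<Longrightarrow> r \<in> hom C (Cod C j) (Dom C j) \<Longrightarrow>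
      r \<cdot> j = Ident C (Dom C j) \<Longrightarrow> (p \<cdot> j) \<cdot> r = p \<Longrightarrow> p \<cdot> j \<in> R"
  shows "weak_factorization_system C L R"
proof -
  have "f \<in> L" if f: "f \<in> Arr C" "\<forall>p \<in> R. has_lift C f p" for f
  proof -
    obtain j p where jp: "j \<in> L" "p \<in> R" "Cod C j = Dom C p" "f = p \<cdot> j" using fact[OF f(1)] by blast
    have A: "j \<in> Arr C" "p \<in> Arr C" using jp sub by auto
    have fA: "Dom C f = Dom C j" "Cod C f = Cod C p" using A jp by simp_all
    have "j \<in> hom C (Dom C f) (Dom C p)" "Ident C (Cod C p) \<in> hom C (Cod C f) (Cod C p)"
      "p \<cdot> j = Ident C (Cod C p) \<cdot> f" using A fA jp(3) f(1) by (simp_all add: hom_def jp(4))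
    then obtain d where "d \<in> hom C (Cod C f) (Dom C p)" "d \<cdot> f = j" "p \<cdot> d = Ident C (Cod C p)"
      using f(2) jp(2) unfolding has_lift_def by blast
    then show ?thesis using left[OF jp(1-3), of d] fA jp(4) by simp
  qed
  moreover have "f \<in> R" if f: "f \<in> Arr C" "\<forall>i \<in> L. has_lift C i f" for f
  proof -
    obtain j p where jp: "j \<in> L" "p \<in> R" "Cod C j = Dom C p" "f = p \<cdot> j" using fact[OF f(1)] by blast
    have A: "j \<in> Arr C" "p \<in> Arr C" using jp sub by auto
    have fA: "Dom C f = Dom C j" "Cod C f = Cod C p" using A jp by simp_all
    have "Ident C (Dom C j) \<in> hom C (Dom C j) (Dom C f)" "p \<in> hom C (Cod C j) (Cod C f)"
      "f \<cdot> Ident C (Dom C j) = p \<cdot> j" using A fA jp(3) f(1) by (simp_all add: hom_def jp(4))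
    then obtain r where "r \<in> hom C (Cod C j) (Dom C f)" "r \<cdot> j = Ident C (Dom C j)" "f \<cdot> r = p"
      using f(2) jp(1) unfolding has_lift_def by blast
    then show ?thesis using right[OF jp(1-3), of r] fA jp(4) by simp
  qed
  ultimately show ?thesis
    unfolding weak_factorization_system_def using sub lift fact by blast
qed

lemma has_lift_FibE:
  assumes "has_lift (Fib E) i p" "fib_arrow E A B i" "fib_arrow E X Y p" "fib_arrow E A X s" "fib_arrow E B Y t"
    "p \<cdot>\<^bsub>Fib E\<^esub> s = t \<cdot>\<^bsub>Fib E\<^esub> i"
  obtains d where "fib_arrow E B X d" "d \<cdot>\<^bsub>Fib E\<^esub> i = s" "p \<cdot>\<^bsub>Fib E\<^esub> d = t"
proof -
  interpret i: fib_arrow E A B i by fact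
  interpret p: fib_arrow E X Y p by fact
  interpret s: fib_arrow E A X s by fact
  interpret t: fib_arrow E B Y t by fact
  have "s \<in> hom (Fib E) (Dom (Fib E) i) (Dom (Fib E) p)" "t \<in> hom (Fib E) (Cod (Fib E) i) (Cod (Fib E) p)"
    using s.arrow t.arrow by (simp_all add: hom_def)
  then obtain d where d: "d \<in> hom (Fib E) (Cod (Fib E) i) (Dom (Fib E) p)" "d \<cdot>\<^bsub>Fib E\<^esub> i = s" "p \<cdot>\<^bsub>Fib E\<^esub> d = t"
    using assms(1,6) unfolding has_lift_def by blast
  have "fib_arrow E B X d" by (rule fib_arrow_hom[OF i.base]) (use d(1) in simp)
  then show thesis using d(2,3) by (rule that)
qed

context infinite_base
begin

lemma injection_retract:
  assumes "j \<in> E_injections E" "fib_arrow E A B i" "fib_arrow E B Q d" "d \<cdot>\<^bsub>Fib E\<^esub> i = j"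
  shows "i \<in> E_injections E"
proof -
  interpret i: fib_arrow E A B i by fact
  interpret d: fib_arrow E B Q d by fact
  interpret j: fib_arrow E A Q j
    using fib_arrow_Comp[OF assms(2,3)] unfolding assms(4) .
  have "fo j a = fo d (fo i a)" if "a \<in> Ob A" for a
    using that by (simp flip: assms(4))
  then show ?thesis
    using assms(1) unfolding i.E_injections_iff j.E_injections_iff by (auto simp: inj_on_def)
qed

lemma wfs_cof_trivial_fib:
  "weak_factorization_system (Fib E) (E_injections E) (E_isofibrations E \<inter> E_equivalences E)"
proof (rule category.weak_factorization_systemI[OF category_Fib[OF base]])
  fix j p assume jp: "j \<in> E_injections E" "p \<in> E_isofibrations E \<inter> E_equivalences E" "Cod (Fib E) j = Dom (Fib E) p"
  have j: "fib_arrow E (src j) (src p) j" and p: "fib_arrow E (src p) (tgt p) p"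
    using jp base by (auto intro!: fib_arrow.intro simp: E_injections_def E_isofibrations_def)
  have pj: "fib_arrow E (src j) (tgt p) (p \<cdot>\<^bsub>Fib E\<^esub> j)" by (rule fib_arrow_Comp[OF j p])
  {
    fix d assume d: "d \<in> hom (Fib E) (Cod (Fib E) p) (Dom (Fib E) p)" "d \<cdot>\<^bsub>Fib E\<^esub> (p \<cdot>\<^bsub>Fib E\<^esub> j) = j"
    have "fib_arrow E (tgt p) (src p) d" using fib_arrow_hom[OF base d(1)] by simp
    then show "p \<cdot>\<^bsub>Fib E\<^esub> j \<in> E_injections E" using injection_retract[OF jp(1) pj _ d(2)] by blast
  next
    fix r assume r: "r \<in> hom (Fib E) (Cod (Fib E) j) (Dom (Fib E) j)" "r \<cdot>\<^bsub>Fib E\<^esub> j = Ident (Fib E) (Dom (Fib E) j)"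
      "(p \<cdot>\<^bsub>Fib E\<^esub> j) \<cdot>\<^bsub>Fib E\<^esub> r = p"
    have "fib_arrow E (src p) (src j) r" using fib_arrow_hom[OF base r(1)] jp(3) by simp
    note retract = pj j p this r(2)[unfolded Fib_simps(2)] r(3)
    show "p \<cdot>\<^bsub>Fib E\<^esub> j \<in> E_isofibrations E \<inter> E_equivalences E"
      using isofibration_retract[OF retract] equivalence_retract_left[OF retract] jp(2) by simp
  }
qed (use has_lift_cof_trivial_fib[OF base] factorization_cof_trivial_fib in
    \<open>auto simp: E_injections_def E_isofibrations_def\<close>)

lemma wfs_trivial_cof_fib:
  "weak_factorization_system (Fib E) (E_injections E \<inter> E_equivalences E) (E_isofibrations E)"
proof (rule category.weak_factorization_systemI[OF category_Fib[OF base]])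
  fix j p assume jp: "j \<in> E_injections E \<inter> E_equivalences E" "p \<in> E_isofibrations E" "Cod (Fib E) j = Dom (Fib E) p"
  have j: "fib_arrow E (src j) (src p) j" and p: "fib_arrow E (src p) (tgt p) p"
    using jp base by (auto intro!: fib_arrow.intro simp: E_injections_def E_isofibrations_def)
  have pj: "fib_arrow E (src j) (tgt p) (p \<cdot>\<^bsub>Fib E\<^esub> j)" by (rule fib_arrow_Comp[OF j p])
  {
    fix d assume d: "d \<in> hom (Fib E) (Cod (Fib E) p) (Dom (Fib E) p)" "d \<cdot>\<^bsub>Fib E\<^esub> (p \<cdot>\<^bsub>Fib E\<^esub> j) = j"
      "p \<cdot>\<^bsub>Fib E\<^esub> d = Ident (Fib E) (Cod (Fib E) p)"
    have d': "fib_arrow E (tgt p) (src p) d" using fib_arrow_hom[OF base d(1)] by simp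
    show "p \<cdot>\<^bsub>Fib E\<^esub> j \<in> E_injections E \<inter> E_equivalences E"
      using injection_retract[OF _ pj d' d(2)] jp(1)
        equivalence_retract_right[OF pj j p d' d(3)[unfolded Fib_simps(3)] d(2)] by simp
  next
    fix r assume r: "r \<in> hom (Fib E) (Cod (Fib E) j) (Dom (Fib E) j)" "r \<cdot>\<^bsub>Fib E\<^esub> j = Ident (Fib E) (Dom (Fib E) j)"
      "(p \<cdot>\<^bsub>Fib E\<^esub> j) \<cdot>\<^bsub>Fib E\<^esub> r = p"
    have r': "fib_arrow E (src p) (src j) r" using fib_arrow_hom[OF base r(1)] jp(3) by simp
    show "p \<cdot>\<^bsub>Fib E\<^esub> j \<in> E_isofibrations E"
      using isofibration_retract[OF pj j p r' r(2)[unfolded Fib_simps(2)] r(3) jp(2)] .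
  }
qed (use has_lift_trivial_cof_fib[OF base] factorization_trivial_cof_fib in
    \<open>auto simp: E_injections_def E_isofibrations_def\<close>)

text \<open>Cofibrations are determined by a lifting property, which pushouts inherit; no
  description of the objects of the pushout is needed.\<close>

lemma injection_pushout:
  assumes "pushout_square (Fib E) i g h k" "i \<in> E_injections E"
  shows "k \<in> E_injections E"
proof -
  interpret M: category "Fib E" by (rule category_Fib[OF base])
  note w = wfs_cof_trivial_fib[unfolded weak_factorization_system_def, THEN conjunct1]
  have "has_lift (Fib E) k p" if "p \<in> E_isofibrations E \<inter> E_equivalences E" for p
    using that assms has_lift_cof_trivial_fib[OF base]
    by (intro M.has_lift_pushout[OF assms(1)]) (auto simp: E_isofibrations_def)
  then show ?thesis by (subst w) (use pushout_squareD(4)[OF assms(1)] in auto)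
qed

lemma trivial_cofibration_pushout:
  assumes "pushout_square (Fib E) i g h k" "i \<in> E_injections E" "i \<in> E_equivalences E"
  shows "k \<in> E_equivalences E"
proof -
  interpret M: category "Fib E" by (rule category_Fib[OF base])
  note w = wfs_trivial_cof_fib[unfolded weak_factorization_system_def, THEN conjunct1]
  have "has_lift (Fib E) k p" if "p \<in> E_isofibrations E" for p
    using that assms has_lift_trivial_cof_fib[OF base]
    by (intro M.has_lift_pushout[OF assms(1)]) (auto simp: E_isofibrations_def)
  then have "k \<in> {i \<in> Arr (Fib E). \<forall>p\<in>E_isofibrations E. has_lift (Fib E) i p}"
    using pushout_squareD(4)[OF assms(1)] by auto
  then show ?thesis using w by blast
qed

text \<open>The map from the empty fibred category to \<open>X\<close> is a cofibration, so the
  identity of \<open>X\<close> lifts along \<open>q\<close>.\<close>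

lemma trivial_fibration_section:
  assumes "fib_arrow E A X q" "q \<in> E_isofibrations E" "q \<in> E_equivalences E"
  obtains \<sigma> where "fib_arrow E X A \<sigma>" "q \<cdot>\<^bsub>Fib E\<^esub> \<sigma> = Ident (Fib E) X"
proof -
  interpret M: category "Fib E" by (rule category_Fib[OF base])
  interpret q: fib_arrow E A X q by fact
  obtain N where N: "fibred_category E N" "Ob N = {}"
    "\<forall>P. fibred_category E P \<longrightarrow> (\<exists>!f. f \<in> hom (Fib E) N P)" by (rule empty_initial)
  obtain u v where u: "u \<in> hom (Fib E) N A" and v: "v \<in> hom (Fib E) N X"
    using N(3)[rule_format, OF q.S.fib] N(3)[rule_format, OF q.T.fib] by blast
  interpret u: fib_arrow E N A u by (rule fib_arrow_hom[OF base u])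
  interpret v: fib_arrow E N X v by (rule fib_arrow_hom[OF base v])
  interpret I: fib_arrow E X X "Ident (Fib E) X" by (rule fib_arrow_Ident[OF base q.T.fib])
  have "v \<in> E_injections E" by (simp add: v.E_injections_iff N)
  then have "has_lift (Fib E) v q" by (rule has_lift_cof_trivial_fib[OF base _ assms(2,3)])
  moreover have "q \<cdot>\<^bsub>Fib E\<^esub> u = Ident (Fib E) X \<cdot>\<^bsub>Fib E\<^esub> v"
  proof -
    have "q \<cdot>\<^bsub>Fib E\<^esub> u \<in> hom (Fib E) N X" "Ident (Fib E) X \<cdot>\<^bsub>Fib E\<^esub> v \<in> hom (Fib E) N X"
      using fib_arrow_Comp[OF u.fib_arrow_axioms q.fib_arrow_axioms]
        fib_arrow_Comp[OF v.fib_arrow_axioms I.fib_arrow_axioms]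
      by (auto simp: hom_def dest: fib_arrow.arrow)
    then show ?thesis using N(3)[rule_format, OF q.T.fib] by blast
  qed
  ultimately show thesis
    using that by (rule has_lift_FibE[OF _ v.fib_arrow_axioms assms(1) u.fib_arrow_axioms I.fib_arrow_axioms])
qed

section \<open>Pushouts of trivial fibrations\<close>

text \<open>
  Conjugating by the isomorphisms \<open>a \<cong> \<sigma> (q a)\<close> gives an idempotent \<open>R\<close> of \<open>B\<close>, isomorphic to the
  identity.  The pushout of \<open>q\<close> along \<open>i\<close> splits \<open>R\<close>.
\<close>

lemma trivial_fibration_idempotent:
  assumes "fib_arrow E A X q" "q \<in> E_equivalences E"
    and "fib_arrow E X A \<sigma>" and q\<sigma>: "q \<cdot>\<^bsub>Fib E\<^esub> \<sigma> = Ident (Fib E) X"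
    and "fib_arrow E A B i" "i \<in> E_injections E"
  obtains R u where "fib_arrow E B B R" "R \<cdot>\<^bsub>Fib E\<^esub> i = (i \<cdot>\<^bsub>Fib E\<^esub> \<sigma>) \<cdot>\<^bsub>Fib E\<^esub> q" "R \<cdot>\<^bsub>Fib E\<^esub> R = R"
    "\<And>b. b \<in> Ob B \<Longrightarrow> iso (total B) (u b) \<and> dm B (u b) = b \<and> cd B (u b) = fo R b"
    "\<And>\<beta>. \<beta> \<in> Ar B \<Longrightarrow> fa R \<beta> =
      u (cd B \<beta>) \<cdot>\<^bsub>total B\<^esub> (\<beta> \<cdot>\<^bsub>total B\<^esub> inv_arr (total B) (u (dm B \<beta>)))"
    "\<And>Z s t b. fib_arrow E B Z s \<Longrightarrow> fib_arrow E X Z t \<Longrightarrow> s \<cdot>\<^bsub>Fib E\<^esub> i = t \<cdot>\<^bsub>Fib E\<^esub> q \<Longrightarrow> b \<in> Ob B \<Longrightarrow>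
      fa s (u b) = idt Z (fo s b)"
proof -
  interpret q: fib_arrow E A X q by fact
  interpret \<sigma>: fib_arrow E X A \<sigma> by fact
  interpret i: fib_arrow E A B i by fact
  have q\<sigma>o [simp]: "fo q (fo \<sigma> x) = x" if "x \<in> Ob X" for x
    using arg_cong[OF q\<sigma>, of "\<lambda>h. fo h x"] that by simp
  have q\<sigma>a [simp]: "fa q (fa \<sigma> x) = x" if "x \<in> Ar X" for x
    using arg_cong[OF q\<sigma>, of "\<lambda>h. fa h x"] that by simp
  have ff: "fully_faithful (total A) (total X) (fun_of q)" using assms(2) by (simp add: q.E_equivalences_iff)
  note faithful = fully_faithful_faithful[OF ff _ _ _ _ _ q.S.A.category_axioms]
  have inj: "inj_on (fo i) (Ob A)" using assms(6) by (simp add: i.E_injections_iff)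
  \<comment> \<open>Both \<open>a\<close> and its image under \<open>\<sigma> q\<close> lie over the
    same object of \<open>X\<close>; full faithfulness lifts the identity there to an isomorphism
    between them.\<close>
  have "\<exists>v. v \<in> Ar A \<and> dm A v = a \<and> cd A v = fo \<sigma> (fo q a) \<and>
      fa q v = idt X (fo q a)" if "a \<in> Ob A" for a
    by (rule fully_faithful_full[OF ff, of "idt X (fo q a)" a "fo \<sigma> (fo q a)"])
      (use that in auto)
  then obtain v where v [simp]: "\<And>a. a \<in> Ob A \<Longrightarrow> v a \<in> Ar A"
    "\<And>a. a \<in> Ob A \<Longrightarrow> dm A (v a) = a"
    "\<And>a. a \<in> Ob A \<Longrightarrow> cd A (v a) = fo \<sigma> (fo q a)"
    "\<And>a. a \<in> Ob A \<Longrightarrow> fa q (v a) = idt X (fo q a)"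
    by metis
  have vi [simp]: "iso (total A) (v a)" if "a \<in> Ob A" for a
    by (rule fully_faithful_reflects_iso[OF q.cat_functor_axioms ff]) (use that in simp_all)
  have v\<sigma> [simp]: "v (fo \<sigma> x) = idt A (fo \<sigma> x)" if "x \<in> Ob X" for x
    by (rule faithful) (use that in simp_all)
  have v_natural: "v (cd A \<alpha>) \<cdot>\<^bsub>total A\<^esub> (\<alpha> \<cdot>\<^bsub>total A\<^esub> inv_arr (total A) (v (dm A \<alpha>))) =
      fa \<sigma> (fa q \<alpha>)" if "\<alpha> \<in> Ar A" for \<alpha>
    by (rule faithful) (use that in simp_all)
  \<comment> \<open>The isomorphisms are transported to \<open>B\<close> along the injection
    \<open>i\<close> and extended by identities.\<close>
  define u where "u = (\<lambda>b. if b \<in> fo i ` Ob A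
    then fa i (v (the_inv_into (Ob A) (fo i) b)) else idt B b)"
  have u_i [simp]: "u (fo i a) = fa i (v a)" if "a \<in> Ob A" for a
    using that inj by (simp add: u_def the_inv_into_f_f)
  have u_cases: "(\<exists>a \<in> Ob A. b = fo i a) \<or> u b = idt B b" for b
    by (auto simp: u_def)
  have u [simp]: "iso (total B) (u b)" "dm B (u b) = b"
    "pa B (u b) = Ident E (po B b)" if "b \<in> Ob B" for b
  proof -
    have "pa A (v a) = Ident E (po A a)" if "a \<in> Ob A" for a
      using that q.proj_amap[of "v a"] by simp
    then show "iso (total B) (u b)" "dm B (u b) = b" "pa B (u b) = Ident E (po B b)"
      using that u_cases[of b] by auto
  qed
  define G where "G = \<lparr>omap = \<lambda>b. cd B (u b), amap = \<lambda>\<beta>. u (cd B \<beta>) \<cdot>\<^bsub>total B\<^esub>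
    (\<beta> \<cdot>\<^bsub>total B\<^esub> inv_arr (total B) (u (dm B \<beta>)))\<rparr>"
  have G [simp]: "omap G b = cd B (u b)" "amap G \<beta> = u (cd B \<beta>) \<cdot>\<^bsub>total B\<^esub>
    (\<beta> \<cdot>\<^bsub>total B\<^esub> inv_arr (total B) (u (dm B \<beta>)))" for b \<beta>
    by (simp_all add: G_def)
  have f: "cat_functor (total B) (total B) G"
    by (rule cat_functorI) (auto simp: i.T.A.category_axioms)
  \<comment> \<open>The codomain of a nontrivial \<open>u b\<close> comes from the section
    \<open>\<sigma>\<close>, where \<open>v\<close> is an identity. Hence conjugating twice is
    conjugating once.\<close>
  have uG [simp]: "u (cd B (u b)) = idt B (cd B (u b))" if "b \<in> Ob B" for b
    using that u_cases[of b] by auto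
  have pG: "po B (cd B (u b)) = po B b" if "b \<in> Ob B" for b
    using that i.T.amap_Arr(3)[of "u b"] by simp
  let ?R = "mk_map B B G"
  have "?R \<in> Arr (Fib E)"
  proof (rule mk_map_Arr)
    show "over (total B) (proj B) G (proj B)" by (simp add: over_def)
  qed (use base f i.T.fib in auto)
  then have R: "fib_arrow E B B ?R" using base by (intro fib_arrow.intro) simp_all
  then interpret R: fib_arrow E B B ?R .
  show thesis
  proof (rule that[OF R])
    show "?R \<cdot>\<^bsub>Fib E\<^esub> i = (i \<cdot>\<^bsub>Fib E\<^esub> \<sigma>) \<cdot>\<^bsub>Fib E\<^esub> q"
      by (rule fib_map_eqI[OF fib_arrow_Comp[OF i.fib_arrow_axioms R]
            fib_arrow_Comp[OF q.fib_arrow_axioms fib_arrow_Comp[OF \<sigma>.fib_arrow_axioms i.fib_arrow_axioms]]])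
        (use v_natural[symmetric] in simp)
    show "?R \<cdot>\<^bsub>Fib E\<^esub> ?R = ?R"
      by (rule fib_map_eqI[OF fib_arrow_Comp[OF R R] R]) simp
    show "iso (total B) (u b) \<and> dm B (u b) = b \<and> cd B (u b) = fo ?R b"
      if "b \<in> Ob B" for b using that by simp
    show "fa ?R \<beta> = u (cd B \<beta>) \<cdot>\<^bsub>total B\<^esub> (\<beta> \<cdot>\<^bsub>total B\<^esub> inv_arr (total B) (u (dm B \<beta>)))"
      if "\<beta> \<in> Ar B" for \<beta> using that by simp
    fix Z s t b
    assume s: "fib_arrow E B Z s" and t: "fib_arrow E X Z t" and sq: "s \<cdot>\<^bsub>Fib E\<^esub> i = t \<cdot>\<^bsub>Fib E\<^esub> q" and b: "b \<in> Ob B"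
    interpret s: fib_arrow E B Z s by (rule s)
    interpret t: fib_arrow E X Z t by (rule t)
    note sq' [simp] = Fib_square[OF i.fib_arrow_axioms q.fib_arrow_axioms sq]
    \<comment> \<open>Where \<open>u b\<close> comes from \<open>v a\<close>, the cocone sends it to
      the image under \<open>t\<close> of the identity over which \<open>v a\<close> lies.\<close>
    show "fa s (u b) = idt Z (fo s b)"
      using u_cases[of b] b by auto
  qed
qed

text \<open>The splitting is the subcategory of objects and arrows fixed by \<open>R\<close>, with
  \<open>R\<close> and the composite of \<open>i\<close> and \<open>\<sigma>\<close> as legs. A
  cocone sends the isomorphisms \<open>u\<close> to identities, so it is unchanged by
  \<open>R\<close> and determined by its restriction to the fixed part.\<close>

lemma pushout_trivial_fibration:
  assumes "fib_arrow E A B i" "i \<in> E_injections E" "fib_arrow E A X q" "q \<in> E_isofibrations E" "q \<in> E_equivalences E"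
  shows "\<exists>h k. pushout_square (Fib E) i q h k"
proof -
  interpret i: fib_arrow E A B i by fact
  interpret q: fib_arrow E A X q by fact
  obtain \<sigma> where \<sigma>: "fib_arrow E X A \<sigma>" "q \<cdot>\<^bsub>Fib E\<^esub> \<sigma> = Ident (Fib E) X"
    by (rule trivial_fibration_section[OF assms(3-5)])
  interpret \<sigma>: fib_arrow E X A \<sigma> by fact
  have q\<sigma> [simp]: "fa q (fa \<sigma> x) = x" if "x \<in> Ar X" for x
    using arg_cong[OF \<sigma>(2), of "\<lambda>h. fa h x"] that by simp
  obtain R u where R: "fib_arrow E B B R" and Ri: "R \<cdot>\<^bsub>Fib E\<^esub> i = (i \<cdot>\<^bsub>Fib E\<^esub> \<sigma>) \<cdot>\<^bsub>Fib E\<^esub> q" and RR: "R \<cdot>\<^bsub>Fib E\<^esub> R = R"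
    and u0: "\<And>b. b \<in> Ob B \<Longrightarrow> iso (total B) (u b) \<and> dm B (u b) = b \<and> cd B (u b) = fo R b"
    and Ru: "\<And>\<beta>. \<beta> \<in> Ar B \<Longrightarrow> fa R \<beta> =
      u (cd B \<beta>) \<cdot>\<^bsub>total B\<^esub> (\<beta> \<cdot>\<^bsub>total B\<^esub> inv_arr (total B) (u (dm B \<beta>)))"
    and su: "\<And>Z s t b. fib_arrow E B Z s \<Longrightarrow> fib_arrow E X Z t \<Longrightarrow> s \<cdot>\<^bsub>Fib E\<^esub> i = t \<cdot>\<^bsub>Fib E\<^esub> q \<Longrightarrow> b \<in> Ob B \<Longrightarrow>
      fa s (u b) = idt Z (fo s b)"
    by (rule trivial_fibration_idempotent[OF assms(3,5) \<sigma> assms(1,2)]) blast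
  interpret R: fib_arrow E B B R by (rule R)
  have RRa [simp]: "fa R (fa R \<beta>) = fa R \<beta>" if "\<beta> \<in> Ar B" for \<beta>
    using arg_cong[OF RR, of "\<lambda>h. fa h \<beta>"] that by simp
  have RRo [simp]: "fo R (fo R b) = fo R b" if "b \<in> Ob B" for b
    using arg_cong[OF RR, of "\<lambda>h. fo h b"] that by simp
  have Ria: "fa R (fa i \<alpha>) = fa i (fa \<sigma> (fa q \<alpha>))"
    if "\<alpha> \<in> Ar A" for \<alpha>
    using arg_cong[OF Ri, of "\<lambda>h. fa h \<alpha>"] that by simp
  define T where "T = (total B)\<lparr>Obj := {b \<in> Ob B. fo R b = b}, Arr := {\<beta> \<in> Ar B. fa R \<beta> = \<beta>}\<rparr>"
  have T_simps [simp]: "Obj T = {b \<in> Ob B. fo R b = b}"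
    "Arr T = {\<beta> \<in> Ar B. fa R \<beta> = \<beta>}" "Dom T = dm B" "Cod T = cd B"
    "Ident T = idt B" "Comp T = Comp (total B)"
    by (simp_all add: T_def)
  have fix_ends: "fo R (dm B \<beta>) = dm B \<beta>" "fo R (cd B \<beta>) = cd B \<beta>"
    if "fa R \<beta> = \<beta>" "\<beta> \<in> Ar B" for \<beta>
    using that R.amap_Arr(2,3)[of \<beta>] by simp_all
  have T: "category T" by (rule categoryI) (auto simp: fix_ends)
  have p: "cat_functor T E (proj B)" by (rule cat_functorI) (auto simp: T base)
  interpret p: cat_functor T E "proj B" by (rule p)
  have cart: "cartesian T E (proj B) \<phi>" if \<phi>: "cart E B \<phi>" "fa R \<phi> = \<phi>" for \<phi>
  proof (rule p.cartesianI)
    have \<phi>A: "\<phi> \<in> Ar B" using \<phi> by simp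
    show "\<phi> \<in> Arr T" using \<phi> by simp
    fix \<psi> g assume h: "\<psi> \<in> Arr T" "Cod T \<psi> = Cod T \<phi>" "g \<in> Arr E" "Dom E g = po B (Dom T \<psi>)"
      "Cod E g = po B (Dom T \<phi>)" "pa B \<phi> \<cdot>\<^bsub>E\<^esub> g = pa B \<psi>"
    obtain \<chi> where \<chi>: "\<chi> \<in> Ar B" "dm B \<chi> = dm B \<psi>" "cd B \<chi> = dm B \<phi>"
      "pa B \<chi> = g" "\<phi> \<cdot>\<^bsub>total B\<^esub> \<chi> = \<psi>"
      by (rule i.T.cartesian_lift[OF \<phi>(1), of \<psi> g]) (use h in simp_all)
    have "\<phi> \<cdot>\<^bsub>total B\<^esub> fa R \<chi> = fa R (\<phi> \<cdot>\<^bsub>total B\<^esub> \<chi>)"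
      using \<chi>(1-3) \<phi>A \<phi>(2) by simp
    also have "\<dots> = \<phi> \<cdot>\<^bsub>total B\<^esub> \<chi>" unfolding \<chi>(5) using h by simp
    finally have e: "\<phi> \<cdot>\<^bsub>total B\<^esub> fa R \<chi> = \<phi> \<cdot>\<^bsub>total B\<^esub> \<chi>" .
    have "fa R \<chi> = \<chi>"
      by (rule i.T.cartesian_cancel[OF \<phi>(1) _ _ _ _ _ _ e])
        (use \<chi>(1-4) h(1) fix_ends[OF \<phi>(2) \<phi>A] fix_ends[of \<psi>] in simp_all)
    then show "\<exists>\<chi>\<in>Arr T. Dom T \<chi> = Dom T \<psi> \<and> Cod T \<chi> = Dom T \<phi> \<and> pa B \<chi> = g \<and> \<phi> \<cdot>\<^bsub>T\<^esub> \<chi> = \<psi>"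
      using \<chi> by (intro bexI[of _ \<chi>]) simp_all
  next
    fix \<chi> \<chi>' assume h: "\<chi> \<in> Arr T" "\<chi>' \<in> Arr T" "Cod T \<chi> = Dom T \<phi>" "Cod T \<chi>' = Dom T \<phi>"
      "Dom T \<chi> = Dom T \<chi>'" "pa B \<chi> = pa B \<chi>'" "\<phi> \<cdot>\<^bsub>T\<^esub> \<chi> = \<phi> \<cdot>\<^bsub>T\<^esub> \<chi>'"
    show "\<chi> = \<chi>'" by (rule i.T.cartesian_cancel[OF \<phi>(1)]) (use h in simp_all)
  qed
  have lifts: "\<exists>\<phi>. cart E B \<phi> \<and> fa R \<phi> = \<phi> \<and> cd B \<phi> = y \<and> pa B \<phi> = f"
    if y: "y \<in> Ob B" "fo R y = y" "f \<in> Arr E" "Cod E f = po B y" for y f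
  proof -
    obtain \<phi> where \<phi>: "cart E B \<phi>" "cd B \<phi> = y" "pa B \<phi> = f"
      by (rule i.T.cartesian_over[OF y(1,3,4)])
    then have "\<phi> \<in> Ar B" by simp
    \<comment> \<open>Applying the cartesian functor \<open>R\<close> makes any lift at
      \<open>y\<close> fixed and keeps its codomain and base arrow.\<close>
    then show ?thesis using \<phi> y by (intro exI[of _ "fa R \<phi>"]) simp
  qed
  define P where "P = mk_fib T (proj B)"
  have P [simp]: "total P = norm_cat T" "proj P = norm_fctr T (proj B)" by (simp_all add: P_def)
  have Pfib: "fibred_category E P"
    unfolding P_def
  proof (rule mk_fib_fibred[OF p])
    fix y f assume "y \<in> Obj T" "f \<in> Arr E" "Cod E f = po B y"
    then obtain \<phi> where "cart E B \<phi>" "fa R \<phi> = \<phi>" "cd B \<phi> = y" "pa B \<phi> = f"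
      using lifts[of y f] by auto
    then show "\<exists>\<phi>. cartesian T E (proj B) \<phi> \<and> Cod T \<phi> = y \<and> pa B \<phi> = f"
      using cart by (intro exI[of _ \<phi>]) simp
  qed
  have cart': "cart E P \<phi>" if "cart E B \<phi>" "fa R \<phi> = \<phi>" for \<phi>
    using cart[OF that] p by simp
  let ?h = "mk_map B P (fun_of R)"
  have "cat_functor (total B) T (fun_of R)"
    by (rule cat_functorI) (auto simp: T i.T.A.category_axioms)
  then have "?h \<in> Arr (Fib E)"
    by (intro mk_map_Arr) (auto simp: base Pfib i.T.fib over_def cat_functor_norm cart' simp del: cartesian_norm P, auto simp: cat_functor_norm)
  then have h: "fib_arrow E B P ?h" by (intro fib_arrow.intro) (simp_all add: base)
  obtain K where K_def: "K = i \<cdot>\<^bsub>Fib E\<^esub> \<sigma>" by blast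
  interpret K: fib_arrow E X B K
    unfolding K_def by (rule fib_arrow_Comp[OF \<sigma>.fib_arrow_axioms i.fib_arrow_axioms])
  have K: "fa K \<xi> = fa i (fa \<sigma> \<xi>)" if "\<xi> \<in> Ar X" for \<xi>
    using that by (simp add: K_def)
  have Ka [simp]: "fa R (fa K \<xi>) = fa K \<xi>" if "\<xi> \<in> Ar X" for \<xi>
    using that by (simp add: Ria K)
  have Ko [simp]: "fo R (fo K x) = fo K x" if "x \<in> Ob X" for x
    using fix_ends(1)[OF Ka[of "idt X x"]] that by simp
  let ?k = "mk_map X P (fun_of K)"
  have "cat_functor (total X) T (fun_of K)"
    by (rule cat_functorI) (simp_all add: T q.T.A.category_axioms)
  then have f: "cat_functor (total X) (total P) (fun_of K)" by (simp add: cat_functor_norm)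
  have "?k \<in> Arr (Fib E)"
  proof (rule mk_map_Arr[OF base q.T.fib Pfib f])
    show "over (total X) (proj X) (fun_of K) (proj P)"
      by (simp add: over_def)
    fix \<phi> assume c: "cart E X \<phi>"
    then have "\<phi> \<in> Ar X" by simp
    then show "cart E P (fa K \<phi>)"
      using c by (intro cart') simp_all
  qed
  then have k: "fib_arrow E X P ?k" by (intro fib_arrow.intro) (simp_all add: base)
  interpret M: category "Fib E" by (rule category_Fib[OF base])
  interpret h: fib_arrow E B P ?h by (rule h)
  interpret k: fib_arrow E X P ?k by (rule k)
  have "pushout_square (Fib E) i q ?h ?k"
  proof (rule M.pushout_squareI)
    show "?h \<cdot>\<^bsub>Fib E\<^esub> i = ?k \<cdot>\<^bsub>Fib E\<^esub> q"
      by (rule fib_map_eqI[OF fib_arrow_Comp[OF i.fib_arrow_axioms h] fib_arrow_Comp[OF q.fib_arrow_axioms k]])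
        (simp add: Ria K)
  next
    fix s t assume st: "s \<in> Arr (Fib E)" "t \<in> Arr (Fib E)" "Dom (Fib E) s = Cod (Fib E) i" "Dom (Fib E) t = Cod (Fib E) q"
      "Cod (Fib E) s = Cod (Fib E) t" and sq: "s \<cdot>\<^bsub>Fib E\<^esub> i = t \<cdot>\<^bsub>Fib E\<^esub> q"
    obtain Z where Z: "Z = tgt s" by blast
    have s: "fib_arrow E B Z s" and t: "fib_arrow E X Z t" using st Z by (auto intro!: fib_arrow.intro base)
    interpret s: fib_arrow E B Z s by (rule s)
    interpret t: fib_arrow E X Z t by (rule t)
    note sq' [simp] = Fib_square[OF i.fib_arrow_axioms q.fib_arrow_axioms sq]
    note su' = su[OF s t sq]
    \<comment> \<open>By \<open>Ru\<close> the action of \<open>R\<close> is conjugation by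
      \<open>u\<close>, which \<open>s\<close> does not see.\<close>
    have sR: "fa s (fa R \<beta>) = fa s \<beta>" if "\<beta> \<in> Ar B" for \<beta>
      unfolding Ru[OF that] using that u0 su' by simp
    let ?r = "mk_map P Z (fun_of s)"
    have "cat_functor T (total Z) (fun_of s)"
      by (rule cat_functorI) (auto simp: T s.T.A.category_axioms)
    then have f: "cat_functor (total P) (total Z) (fun_of s)" by (simp add: cat_functor_norm)
    have "?r \<in> Arr (Fib E)"
    proof (rule mk_map_Arr_lifts[OF base Pfib s.T.fib f])
      show "over (total P) (proj P) (fun_of s) (proj Z)" by (simp add: over_def)
      fix y f assume y: "y \<in> Ob P" "f \<in> Arr E" "Cod E f = po P y"
      then obtain \<phi> where \<phi>: "cart E B \<phi>" "fa R \<phi> = \<phi>" "cd B \<phi> = y" "pa B \<phi> = f"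
        using lifts[of y f] by auto
      show "\<exists>\<phi>. cart E P \<phi> \<and> cd P \<phi> = y \<and> pa P \<phi> = f \<and>
          cart E Z (fa s \<phi>)"
        using \<phi> cart[OF \<phi>(1,2)] p by (intro exI[of _ \<phi>]) simp
    qed
    then have r: "fib_arrow E P Z ?r" by (intro fib_arrow.intro) (simp_all add: base)
    have "?r \<cdot>\<^bsub>Fib E\<^esub> ?h = s"
      by (rule fib_map_eqI[OF fib_arrow_Comp[OF h r] s]) (simp add: sR)
    moreover have "?r \<cdot>\<^bsub>Fib E\<^esub> ?k = t"
      by (rule fib_map_eqI[OF fib_arrow_Comp[OF k r] t]) (simp add: K Ria)
    ultimately show "\<exists>r\<in>Arr (Fib E). Dom (Fib E) r = Cod (Fib E) ?h \<and> Cod (Fib E) r = Cod (Fib E) s \<and>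
        r \<cdot>\<^bsub>Fib E\<^esub> ?h = s \<and> r \<cdot>\<^bsub>Fib E\<^esub> ?k = t"
      using fib_arrow.arrow[OF r] by (intro bexI[of _ ?r]) simp_all
  next
    fix r r' assume r0: "r \<in> Arr (Fib E)" "r' \<in> Arr (Fib E)" "Dom (Fib E) r = Cod (Fib E) ?h" "Dom (Fib E) r' = Cod (Fib E) ?h"
      "Cod (Fib E) r = Cod (Fib E) r'" and e: "r \<cdot>\<^bsub>Fib E\<^esub> ?h = r' \<cdot>\<^bsub>Fib E\<^esub> ?h"
    obtain Z where Z: "Z = tgt r" by blast
    have r: "fib_arrow E P Z r" and r': "fib_arrow E P Z r'" using r0 Z by (auto intro!: fib_arrow.intro base)
    show "r = r'"
    proof (rule fib_map_eqI[OF r r'])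
      fix \<beta> assume "\<beta> \<in> Ar P"
      then have \<beta>: "\<beta> \<in> Ar B" "fa R \<beta> = \<beta>" by simp_all
      show "fa r \<beta> = fa r' \<beta>"
        using arg_cong[OF e, of "\<lambda>h. fa h \<beta>"] \<beta> by simp
    qed
  qed (use i.arrow q.arrow h.arrow k.arrow in simp_all)
  then show ?thesis by blast
qed

text \<open>After the first pushout the leg \<open>k1\<close> is again an injection, so the second
  pushout, along the trivial fibration, is available; the two squares are pasted.\<close>

lemma pushouts_of_injections:
  assumes "i \<in> E_injections E" "g \<in> Arr (Fib E)" "Dom (Fib E) g = Dom (Fib E) i"
  shows "\<exists>h k. pushout_square (Fib E) i g h k"
proof -
  interpret M: category "Fib E" by (rule category_Fib[OF base])
  have "i \<in> Arr (Fib E)" using assms(1) by (simp add: E_injections_def)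
  then obtain A B where i: "fib_arrow E A B i" using fib_arrow_Arr[OF base] by blast
  obtain j q where jq: "j \<in> E_injections E" "q \<in> E_isofibrations E" "q \<in> E_equivalences E" "tgt j = src q" "g = q \<cdot>\<^bsub>Fib E\<^esub> j"
    using factorization_cof_trivial_fib[OF assms(2)] by auto
  obtain Y X where Y: "Y = src q" "X = tgt q" by blast
  have j: "fib_arrow E A Y j" and q: "fib_arrow E Y X q"
    using jq assms(3) fib_arrow.src[OF i] Y by (auto intro!: fib_arrow.intro base simp: E_injections_def E_isofibrations_def)
  obtain P h1 k1 where k1: "fib_arrow E Y P k1" and sq1: "pushout_square (Fib E) i j h1 k1"
    using pushout_injections[OF i j assms(1) jq(1)] by blast
  have "k1 \<in> E_injections E" by (rule injection_pushout[OF sq1 assms(1)])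
  then obtain h2 k2 where "pushout_square (Fib E) k1 q h2 k2"
    using pushout_trivial_fibration[OF k1 _ q jq(2,3)] by blast
  then show ?thesis using M.pushout_paste[OF sq1] jq(5) by blast
qed

text \<open>For any pushout square, \<open>R\<close> and the composite of \<open>i\<close> and
  \<open>\<sigma>\<close> induce a map \<open>r\<close> back to \<open>B\<close>. Then
  \<open>h\<close> after \<open>r\<close> is the identity and \<open>r\<close> after
  \<open>h\<close> is \<open>R\<close>, which is isomorphic to the identity by
  \<open>u\<close>.\<close>

lemma pushout_trivial_fibration_equivalence:
  assumes sq: "pushout_square (Fib E) i q h k" and i: "i \<in> E_injections E"
    and q: "q \<in> E_isofibrations E" "q \<in> E_equivalences E"
  shows "h \<in> E_equivalences E"
proof -
  interpret M: category "Fib E" by (rule category_Fib[OF base])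
  note d = pushout_squareD[OF sq, unfolded Fib_simps]
  obtain A B X P where ABXP: "A = src i" "B = tgt i" "X = tgt q" "P = tgt h" by blast
  have arrows: "fib_arrow E A B i" "fib_arrow E A X q" "fib_arrow E B P h" "fib_arrow E X P k"
    by (rule fib_arrow.intro[OF base]; use d(1-8) ABXP in simp)+
  interpret i: fib_arrow E A B i by (rule arrows)
  interpret q: fib_arrow E A X q by (rule arrows)
  interpret h: fib_arrow E B P h by (rule arrows)
  interpret k: fib_arrow E X P k by (rule arrows)
  obtain \<sigma> where \<sigma>: "fib_arrow E X A \<sigma>" "q \<cdot>\<^bsub>Fib E\<^esub> \<sigma> = Ident (Fib E) X"
    by (rule trivial_fibration_section[OF q.fib_arrow_axioms q])
  interpret \<sigma>: fib_arrow E X A \<sigma> by fact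
  obtain R u where R: "fib_arrow E B B R" and Ri: "R \<cdot>\<^bsub>Fib E\<^esub> i = (i \<cdot>\<^bsub>Fib E\<^esub> \<sigma>) \<cdot>\<^bsub>Fib E\<^esub> q"
    and u0: "\<And>b. b \<in> Ob B \<Longrightarrow> iso (total B) (u b) \<and> dm B (u b) = b \<and> cd B (u b) = fo R b"
    and Ru: "\<And>\<beta>. \<beta> \<in> Ar B \<Longrightarrow> fa R \<beta> =
      u (cd B \<beta>) \<cdot>\<^bsub>total B\<^esub> (\<beta> \<cdot>\<^bsub>total B\<^esub> inv_arr (total B) (u (dm B \<beta>)))"
    and su: "\<And>Z s t b. fib_arrow E B Z s \<Longrightarrow> fib_arrow E X Z t \<Longrightarrow> s \<cdot>\<^bsub>Fib E\<^esub> i = t \<cdot>\<^bsub>Fib E\<^esub> q \<Longrightarrow> b \<in> Ob B \<Longrightarrow>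
      fa s (u b) = idt Z (fo s b)"
    by (rule trivial_fibration_idempotent[OF q.fib_arrow_axioms q(2) \<sigma> i.fib_arrow_axioms i]) blast
  interpret R: fib_arrow E B B R by (rule R)
  interpret i\<sigma>: fib_arrow E X B "i \<cdot>\<^bsub>Fib E\<^esub> \<sigma>" by (rule fib_arrow_Comp[OF \<sigma>.fib_arrow_axioms i.fib_arrow_axioms])
  have hu: "fa h (u b) = idt P (fo h b)" if "b \<in> Ob B" for b
    by (rule su[OF h.fib_arrow_axioms k.fib_arrow_axioms d(9) that])
  obtain r where r: "r \<in> Arr (Fib E)" "Dom (Fib E) r = Cod (Fib E) h" "Cod (Fib E) r = Cod (Fib E) R"
    and rh: "r \<cdot>\<^bsub>Fib E\<^esub> h = R" and rk: "r \<cdot>\<^bsub>Fib E\<^esub> k = i \<cdot>\<^bsub>Fib E\<^esub> \<sigma>"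
    by (rule M.pushout_desc[OF sq, of R "i \<cdot>\<^bsub>Fib E\<^esub> \<sigma>"]) (use Ri R.arrow i\<sigma>.arrow in simp_all)
  interpret r: fib_arrow E P B r using r by (intro fib_arrow.intro base) simp_all
  have hr: "h \<cdot>\<^bsub>Fib E\<^esub> r = Ident (Fib E) P"
  proof (rule M.pushout_unique[OF sq])
    \<comment> \<open>The map \<open>h\<close> sends \<open>u\<close> to identities, so conjugation
      by \<open>u\<close> becomes invisible after \<open>h\<close>.\<close>
    have hR: "h \<cdot>\<^bsub>Fib E\<^esub> R = h"
    proof (rule fib_map_eqI[OF fib_arrow_Comp[OF R h.fib_arrow_axioms] h.fib_arrow_axioms])
      fix \<beta> assume b: "\<beta> \<in> Ar B"
      then have "fa (h \<cdot>\<^bsub>Fib E\<^esub> R) \<beta> = fa h (fa R \<beta>)" by simp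
      also have "\<dots> = fa h \<beta>" unfolding Ru[OF b] using b u0 hu by simp
      finally show "fa (h \<cdot>\<^bsub>Fib E\<^esub> R) \<beta> = fa h \<beta>" .
    qed
    have "(h \<cdot>\<^bsub>Fib E\<^esub> r) \<cdot>\<^bsub>Fib E\<^esub> h = h"
      using M.Assoc[of h r h] h.arrow r.arrow h.src h.tgt r.src r.tgt hR rh by simp
    then show "(h \<cdot>\<^bsub>Fib E\<^esub> r) \<cdot>\<^bsub>Fib E\<^esub> h = Ident (Fib E) P \<cdot>\<^bsub>Fib E\<^esub> h"
      using M.Ident_left[of h P] h.arrow h.tgt by simp
    have "(h \<cdot>\<^bsub>Fib E\<^esub> r) \<cdot>\<^bsub>Fib E\<^esub> k = h \<cdot>\<^bsub>Fib E\<^esub> (i \<cdot>\<^bsub>Fib E\<^esub> \<sigma>)"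
      using M.Assoc[of k r h] h.arrow r.arrow k.arrow h.src k.tgt r.src r.tgt rk by simp
    also have "\<dots> = (k \<cdot>\<^bsub>Fib E\<^esub> q) \<cdot>\<^bsub>Fib E\<^esub> \<sigma>"
      using M.Assoc[of \<sigma> i h] h.arrow i.arrow \<sigma>.arrow h.src i.src i.tgt \<sigma>.tgt d(9) by simp
    also have "\<dots> = k \<cdot>\<^bsub>Fib E\<^esub> Ident (Fib E) X"
      using M.Assoc[of \<sigma> q k] k.arrow q.arrow \<sigma>.arrow k.src q.src q.tgt \<sigma>.tgt \<sigma>(2) by simp
    also have "\<dots> = k" using M.Ident_right[of k X] k.arrow k.src by simp
    finally show "(h \<cdot>\<^bsub>Fib E\<^esub> r) \<cdot>\<^bsub>Fib E\<^esub> k = Ident (Fib E) P \<cdot>\<^bsub>Fib E\<^esub> k"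
      using M.Ident_left[of k P] k.arrow k.tgt by simp
  qed (use fib_arrow.arrow[OF fib_arrow_Comp[OF r.fib_arrow_axioms h.fib_arrow_axioms]]
      fib_arrow.arrow[OF fib_arrow_Ident[OF base h.T.fib]] in simp_all)
  have hra: "fa h (fa r \<gamma>) = \<gamma>" if "\<gamma> \<in> Ar P" for \<gamma>
    using arg_cong[OF hr, of "\<lambda>h. fa h \<gamma>"] that by simp
  have hro: "fo h (fo r c) = c" if "c \<in> Ob P" for c
    using arg_cong[OF hr, of "\<lambda>h. fo h c"] that by simp
  have rha: "fa r (fa h \<beta>) = fa R \<beta>" if "\<beta> \<in> Ar B" for \<beta>
    using arg_cong[OF rh, of "\<lambda>h. fa h \<beta>"] that by simp
  have rho: "fo r (fo h b) = fo R b" if "b \<in> Ob B" for b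
    using arg_cong[OF rh, of "\<lambda>h. fo h b"] that by simp
  have "fully_faithful (total B) (total P) (fun_of h)"
  proof (rule fully_faithfulI[OF h.cat_functor_axioms])
    fix \<beta> \<beta>' assume b: "\<beta> \<in> Ar B" "\<beta>' \<in> Ar B" "dm B \<beta> = dm B \<beta>'"
      "cd B \<beta> = cd B \<beta>'" "fa h \<beta> = fa h \<beta>'"
    \<comment> \<open>Undoing the conjugation by \<open>u\<close> recovers an arrow from its image
      under \<open>R\<close>.\<close>
    have recover: "x = inv_arr (total B) (u (cd B x)) \<cdot>\<^bsub>total B\<^esub> (fa R x \<cdot>\<^bsub>total B\<^esub> u (dm B x))"
      if "x \<in> Ar B" for x
      unfolding Ru[OF that] using that u0 by simp
    have "fa R \<beta> = fa R \<beta>'" using rha b by metis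
    then show "\<beta> = \<beta>'" using recover[OF b(1)] recover[OF b(2)] b(3,4) by simp
  next
    fix g x y assume g: "g \<in> Ar P" "x \<in> Ob B" "y \<in> Ob B"
      "dm P g = fo h x" "cd P g = fo h y"
    \<comment> \<open>The arrow \<open>r g\<close> has ends moved by \<open>R\<close>; conjugating
      back by \<open>u\<close> gives the required ends without changing the image under
      \<open>h\<close>.\<close>
    let ?f = "inv_arr (total B) (u y) \<cdot>\<^bsub>total B\<^esub> (fa r g \<cdot>\<^bsub>total B\<^esub> u x)"
    have "fa h ?f = g" using g u0 hu hra rho by simp
    then show "\<exists>f\<in>Ar B. dm B f = x \<and> cd B f = y \<and> fa h f = g"
      using g u0 rho by (intro bexI[of _ ?f]) simp_all
  qed
  moreover have "ess_surj (total B) (total P) (fun_of h)"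
    unfolding ess_surj_def
  proof
    fix c assume "c \<in> Ob P"
    then show "\<exists>a\<in>Ob B. \<exists>\<beta>. iso (total P) \<beta> \<and> dm P \<beta> = fo h a \<and> cd P \<beta> = c"
      using hro by (intro bexI[of _ "fo r c"] exI[of _ "idt P c"]) simp_all
  qed
  ultimately show ?thesis by (simp add: h.E_equivalences_iff)
qed

text \<open>In the factorization \<open>w = q \<cdot> j\<close> the injection \<open>j\<close> is an
  equivalence by two out of three. The pushout of \<open>w\<close> is then a pushout of a trivial
  cofibration followed by a pushout of a trivial fibration along an injection.\<close>

lemma left_proper_Fib: "left_proper (Fib E) (E_equivalences E) (E_injections E)"
  unfolding left_proper_def
proof (intro allI impI)
  interpret M: category "Fib E" by (rule category_Fib[OF base])
  fix w i h k assume "w \<in> E_equivalences E \<and> i \<in> E_injections E \<and> pushout_square (Fib E) w i h k"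
  then have w: "w \<in> E_equivalences E" and i: "i \<in> E_injections E" and sq: "pushout_square (Fib E) i w k h"
    by (auto intro: pushout_square_sym)
  note d = pushout_squareD[OF sq, unfolded Fib_simps]
  obtain j q where jq: "j \<in> E_injections E" "q \<in> E_isofibrations E" "q \<in> E_equivalences E" "tgt j = src q" "w = q \<cdot>\<^bsub>Fib E\<^esub> j"
    using factorization_cof_trivial_fib[OF d(2)] by auto
  have jA: "j \<in> Arr (Fib E)" "q \<in> Arr (Fib E)" using jq by (auto simp: E_injections_def E_isofibrations_def)
  have src: "src j = src w" "tgt q = tgt w" using jq(5) by simp_all
  have jW: "j \<in> E_equivalences E"
  proof (rule E_equivalences_left_cancel)
    show "fib_arrow E (src j) (src q) j" "fib_arrow E (src q) (tgt q) q"
      using jA jq(4) by (auto intro!: fib_arrow.intro base)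
  qed (use jq w in simp_all)
  obtain h1 k1 where sq1: "pushout_square (Fib E) i j h1 k1"
    using pushouts_of_injections[OF i jA(1)] d(5) src by auto
  note d1 = pushout_squareD[OF sq1, unfolded Fib_simps]
  have k1: "k1 \<in> E_injections E" by (rule injection_pushout[OF sq1 i])
  have h1: "h1 \<in> E_equivalences E"
    by (rule trivial_cofibration_pushout[OF pushout_square_sym[OF sq1] jq(1) jW])
  have hq: "h \<cdot>\<^bsub>Fib E\<^esub> q \<in> Arr (Fib E)" using M.Comp_Arr(1)[of q h] jA d(1-8) src by simp
  \<comment> \<open>The comparison from the intermediate pushout to the given one; cancelling the
    first square makes the remaining square a pushout with leg \<open>m\<close>.\<close>
  obtain m where m: "m \<in> Arr (Fib E)" "Dom (Fib E) m = Cod (Fib E) h1" "Cod (Fib E) m = Cod (Fib E) k"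
    "m \<cdot>\<^bsub>Fib E\<^esub> h1 = k" "m \<cdot>\<^bsub>Fib E\<^esub> k1 = h \<cdot>\<^bsub>Fib E\<^esub> q"
  proof (rule M.pushout_desc[OF sq1, of k "h \<cdot>\<^bsub>Fib E\<^esub> q"])
    have "(h \<cdot>\<^bsub>Fib E\<^esub> q) \<cdot>\<^bsub>Fib E\<^esub> j = h \<cdot>\<^bsub>Fib E\<^esub> (q \<cdot>\<^bsub>Fib E\<^esub> j)"
      by (rule M.Assoc) (use jA d(1-8) src jq(4) in simp_all)
    then show "k \<cdot>\<^bsub>Fib E\<^esub> i = (h \<cdot>\<^bsub>Fib E\<^esub> q) \<cdot>\<^bsub>Fib E\<^esub> j"
      unfolding jq(5)[symmetric] d(9) by (rule sym)
  qed (use hq d(1-8) src jq(4) in simp_all)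
  have "pushout_square (Fib E) k1 q m h"
    by (rule M.pushout_paste_cancel[OF sq1 sq[unfolded jq(5)]]) (use jA jq(4) m in simp_all)
  then have "m \<in> E_equivalences E"
    by (rule pushout_trivial_fibration_equivalence[OF _ k1 jq(2,3)])
  moreover have "fib_arrow E (src h1) (tgt h1) h1" "fib_arrow E (tgt h1) (tgt m) m"
    using d1(3) m(1,2) by (auto intro!: fib_arrow.intro base)
  ultimately have "m \<cdot>\<^bsub>Fib E\<^esub> h1 \<in> E_equivalences E" using E_equivalences_Comp h1 by blast
  then show "k \<in> E_equivalences E" unfolding m(4) .
qed

end

theorem theorem13:
  fixes E :: "('u, 'u) cat"
  assumes "infinite (UNIV :: 'u set)"
    and "category E"
  shows "proper_generalized_model_category (Fib E)
    (E_equivalences E) (E_injections E) (E_isofibrations E)"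
proof -
  interpret infinite_base E by (rule infinite_base.intro) (use assms in auto)
  interpret M: category "Fib E" by (rule category_Fib[OF base])
  show ?thesis
  proof
    show "\<exists>h k. pullback_square (Fib E) p g h k"
      if pg: "p \<in> E_isofibrations E" "g \<in> Arr (Fib E)" "Cod (Fib E) g = Cod (Fib E) p" for p g
    proof -
      have "fib_arrow E (src p) (tgt p) p" "fib_arrow E (src g) (tgt p) g"
        using pg base by (auto intro!: fib_arrow.intro simp: E_isofibrations_def)
      then show ?thesis using isofibration_pullback pg(1) by blast
    qed
    show "E_equivalences E \<subseteq> Arr (Fib E)" "E_injections E \<subseteq> Arr (Fib E)" "E_isofibrations E \<subseteq> Arr (Fib E)"
      by (auto simp: E_equivalences_def E_injections_def E_isofibrations_def)
    show "\<exists>h k. pushout_square (Fib E) i g h k"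
      if "i \<in> E_injections E" "g \<in> Arr (Fib E)" "Dom (Fib E) g = Dom (Fib E) i" for i g
      by (rule pushouts_of_injections[OF that])
  qed (rule has_initial_Fib has_terminal_Fib two_out_of_three_E_equivalences[OF base]
      wfs_cof_trivial_fib wfs_trivial_cof_fib left_proper_Fib right_proper_Fib)+
qed

end
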